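(* Let $G=\bigstar_{i\leq n} G_i$ be a free product of finitely many groups $(G_i)_{i\leq n}$, each of them being either finite or cyclic. Then $G$ has the strong topological Rokhlin property.
   Context: $\mathcal{C}$ is the Cantor space and $\mathrm{Homeo}(\mathcal{C})$ is the topological group of its self-homeomorphisms with the uniform topology. For a countable group $G$, $\mathrm{Act}_G(\mathcal{C})$ is the Polish space of all continuous actions of $G$ on $\mathcal{C}$, identified with the set of homomorphisms $G\to\mathrm{Homeo}(\mathcal{C})$, a closed subset of $\mathrm{Homeo}(\mathcal{C})^G$ with the product topology. $\mathrm{Homeo}(\mathcal{C})$ acts on $\mathrm{Act}_G(\mathcal{C})$ by conjugation, $(\phi\alpha\phi^{-1})(g)=\phi\alpha(g)\phi^{-1}$. $G$ has the strong topological Rokhlin property if there is $\alpha\in\mathrm{Act}_G(\mathcal{C})$ whose conjugacy class $\{\phi\alpha\phi^{-1}:\phi\in\mathrm{Homeo}(\mathcal{C})\}$ is comeager in $\mathrm{Act}_G(\mathcal{C})$. *)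

theory Defs
  imports "HOL-Analysis.Analysis" "HOL-Algebra.Elementary_Groups"
begin

section \<open>Comeager sets\<close>

definition nowhere_dense_in :: "'a topology \<Rightarrow> 'a set \<Rightarrow> bool" where
  "nowhere_dense_in X S \<longleftrightarrow> S \<subseteq> topspace X \<and> X interior_of (X closure_of S) = {}"

definition meager_in :: "'a topology \<Rightarrow> 'a set \<Rightarrow> bool" where
  "meager_in X S \<longleftrightarrow> (\<exists>\<F>. countable \<F> \<and> (\<forall>A\<in>\<F>. nowhere_dense_in X A) \<and> S = \<Union>\<F>)"

definition comeager_in :: "'a topology \<Rightarrow> 'a set \<Rightarrow> bool" where
  "comeager_in X S \<longleftrightarrow> S \<subseteq> topspace X \<and> meager_in X (topspace X - S)"


section \<open>The Cantor space and its homeomorphism group\<close>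

text \<open>The Cantor space is the type \<^typ>\<open>nat \<Rightarrow> bool\<close>, whose type class topology is the product
  of the discrete topologies.\<close>

type_synonym cantor = "nat \<Rightarrow> bool"

definition cantor_dist :: "cantor \<Rightarrow> cantor \<Rightarrow> real" where
  "cantor_dist x y = (if x = y then 0 else (1/2) ^ (LEAST n. x n \<noteq> y n))"

definition cantor_metric :: "cantor metric" where
  "cantor_metric = metric (UNIV, cantor_dist)"

definition homeo_group :: "(cantor \<Rightarrow> cantor) monoid" where
  "homeo_group = \<lparr>carrier = {f. homeomorphic_map euclidean euclidean f}, mult = (\<circ>), one = id\<rparr>"

text \<open>\<^const>\<open>cfunspace\<close> carries the supremum metric. The uniform topology does not depend on the
  choice of a compatible metric on the (compact) Cantor space.\<close>

definition homeo_topology :: "(cantor \<Rightarrow> cantor) topology" where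
  "homeo_topology =
     subtopology (mtopology_of (cfunspace euclidean cantor_metric)) (carrier homeo_group)"

lemma cantor_dist_less_iff:
  "cantor_dist x y < (1/2) ^ n \<longleftrightarrow> (\<forall>i\<le>n. x i = y i)"
proof (cases "x = y")
  case True
  then show ?thesis by (simp add: cantor_dist_def)
next
  case False
  define m where "m = (LEAST n. x n \<noteq> y n)"
  from False obtain k where "x k \<noteq> y k" by auto
  then have m1: "x m \<noteq> y m" unfolding m_def by (rule LeastI)
  have m2: "x i = y i" if "i < m" for i
    using not_less_Least[of i "\<lambda>n. x n \<noteq> y n"] that by (auto simp: m_def)
  have "cantor_dist x y < (1/2) ^ n \<longleftrightarrow> (1/2::real) ^ m < (1/2) ^ n"
    using False by (simp add: cantor_dist_def m_def)
  also have "\<dots> \<longleftrightarrow> n < m"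
    by (rule power_strict_decreasing_iff) auto
  also have "\<dots> \<longleftrightarrow> (\<forall>i\<le>n. x i = y i)"
    using m1 m2 by (meson le_less_trans not_le_imp_less)
  finally show ?thesis .
qed

lemma Metric_space_cantor: "Metric_space UNIV cantor_dist"
proof
  fix x y z :: cantor
  show "0 \<le> cantor_dist x y" by (simp add: cantor_dist_def)
  have "(\<lambda>n. x n \<noteq> y n) = (\<lambda>n. y n \<noteq> x n)" by auto
  then show "cantor_dist x y = cantor_dist y x"
    unfolding cantor_dist_def by metis
  show "cantor_dist x y = 0 \<longleftrightarrow> x = y" by (simp add: cantor_dist_def)
  show "cantor_dist x z \<le> cantor_dist x y + cantor_dist y z"
  proof (cases "x = z")
    case True
    then show ?thesis by (simp add: cantor_dist_def)
  next
    case False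
    define m where "m = (LEAST n. x n \<noteq> z n)"
    from False obtain k where "x k \<noteq> z k" by auto
    then have m1: "x m \<noteq> z m" unfolding m_def by (rule LeastI)
    have d: "cantor_dist x z = (1/2) ^ m" using False by (simp add: cantor_dist_def m_def)
    have "\<not> cantor_dist x y < (1/2) ^ m \<or> \<not> cantor_dist y z < (1/2) ^ m"
      using m1 unfolding cantor_dist_less_iff by auto
    moreover have "0 \<le> cantor_dist x y" "0 \<le> cantor_dist y z" by (auto simp: cantor_dist_def)
    ultimately show ?thesis using d by linarith
  qed
qed

lemma mspace_cantor_metric [simp]: "mspace cantor_metric = UNIV"
  and mdist_cantor_metric [simp]: "mdist cantor_metric = cantor_dist"
  by (auto simp: cantor_metric_def Metric_space.mspace_metric[OF Metric_space_cantor]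
      Metric_space.mdist_metric[OF Metric_space_cantor])

lemma mtopology_of_cantor_metric [simp]: "mtopology_of cantor_metric = euclidean"
proof (rule topology_eq[THEN iffD2], intro allI iffI)
  interpret M: Metric_space "UNIV :: cantor set" cantor_dist by (rule Metric_space_cantor)
  have top: "mtopology_of cantor_metric = M.mtopology" by (simp add: mtopology_of_def)
  fix U :: "cantor set"
  { assume "openin (mtopology_of cantor_metric) U"
    then have *: "\<exists>r>0. M.mball x r \<subseteq> U" if "x \<in> U" for x
      using that by (auto simp: top M.openin_mtopology)
    have "\<exists>T. open T \<and> x \<in> T \<and> T \<subseteq> U" if x: "x \<in> U" for x
    proof -
      obtain r where r: "r > 0" "M.mball x r \<subseteq> U" using *[OF x] by auto
      obtain n where n: "(1/2::real) ^ n < r" using real_arch_pow_inv[OF r(1), of "1/2"] by auto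
      define T where "T = {y::cantor. \<forall>i\<in>{..n}. y i \<in> {x i}}"
      have "T = (\<Inter>i\<in>{..n}. (\<lambda>y. y i) -` {x i})" by (auto simp: T_def)
      moreover have "open ((\<lambda>y::cantor. y i) -` {x i})" for i
        by (rule open_vimage[OF open_discrete])
           (simp add: continuous_on_product_coordinates)
      ultimately have "open T" by auto
      moreover have "T \<subseteq> M.mball x r"
      proof
        fix y assume "y \<in> T"
        then have "cantor_dist x y < (1/2) ^ n"
          unfolding cantor_dist_less_iff by (auto simp: T_def)
        with n show "y \<in> M.mball x r" by (simp add: M.mball_def)
      qed
      ultimately show ?thesis using r(2) by (intro exI[of _ T]) (auto simp: T_def)
    qed
    then have "open U" by (subst open_subopen) blast
    then show "openin euclidean U" by simp
  }
  { assume "openin euclidean U"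
    then have oU: "openin (product_topology (\<lambda>_. euclidean) UNIV) U"
      by (simp add: euclidean_product_topology)
    have "\<exists>r>0. M.mball x r \<subseteq> U" if x: "x \<in> U" for x
    proof -
      obtain X where X: "x \<in> Pi\<^sub>E UNIV X" "finite {i. X i \<noteq> (UNIV :: bool set)}" "Pi\<^sub>E UNIV X \<subseteq> U"
        using product_topology_open_contains_basis[OF oU x] by (auto simp: topspace_euclidean)
      obtain n where n: "{i. X i \<noteq> UNIV} \<subseteq> {..n}"
        using X(2) finite_nat_iff_bounded_le by blast
      have "M.mball x ((1/2) ^ n) \<subseteq> Pi\<^sub>E UNIV X"
      proof
        fix y assume "y \<in> M.mball x ((1/2) ^ n)"
        then have y: "\<forall>i\<le>n. x i = y i" by (simp add: M.mball_def cantor_dist_less_iff)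
        have "y i \<in> X i" for i
        proof (cases "i \<le> n")
          case True
          then have "y i = x i" using y by simp
          then show ?thesis using X(1) by (simp add: PiE_iff)
        next
          case False
          then show ?thesis using n by auto
        qed
        then show "y \<in> Pi\<^sub>E UNIV X" by auto
      qed
      with X(3) show ?thesis by (intro exI[of _ "(1/2) ^ n"]) auto
    qed
    then show "openin (mtopology_of cantor_metric) U"
      by (auto simp: top M.openin_mtopology)
  }
qed

lemma topspace_homeo_topology [simp]: "topspace homeo_topology = carrier homeo_group"
proof -
  interpret M: Metric_space "UNIV :: cantor set" cantor_dist by (rule Metric_space_cantor)
  have "cantor_dist x y \<le> 1" for x y
    by (simp add: cantor_dist_def power_le_one)
  then have "M.mbounded S" for S
    unfolding M.mbounded_alt by blast
  then have "carrier homeo_group \<subseteq> mspace (cfunspace euclidean cantor_metric)"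
    by (auto simp: homeo_group_def dest!: homeomorphic_imp_continuous_map)
  then show ?thesis by (auto simp: homeo_topology_def)
qed

lemma group_homeo_group: "group homeo_group"
proof (rule groupI)
  fix f g h :: "cantor \<Rightarrow> cantor"
  assume f: "f \<in> carrier homeo_group"
  show "\<one>\<^bsub>homeo_group\<^esub> \<otimes>\<^bsub>homeo_group\<^esub> f = f" by (simp add: homeo_group_def)
  from f obtain k where k: "homeomorphic_maps euclidean euclidean f k"
    unfolding homeo_group_def homeomorphic_map_maps by auto
  then have "homeomorphic_map euclidean euclidean k"
    by (metis homeomorphic_map_maps homeomorphic_maps_sym)
  moreover have "k \<circ> f = id"
    using k by (auto simp: homeomorphic_maps_def)
  ultimately show "\<exists>k\<in>carrier homeo_group. k \<otimes>\<^bsub>homeo_group\<^esub> f = \<one>\<^bsub>homeo_group\<^esub>"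
    by (auto simp: homeo_group_def)
qed (auto simp: homeo_group_def intro: homeomorphic_map_compose)


section \<open>Actions on the Cantor space\<close>

definition actions :: "('g, 'b) monoid_scheme \<Rightarrow> ('g \<Rightarrow> cantor \<Rightarrow> cantor) set" where
  "actions G = hom G homeo_group \<inter> extensional (carrier G)"

definition action_topology :: "('g, 'b) monoid_scheme \<Rightarrow> ('g \<Rightarrow> cantor \<Rightarrow> cantor) topology" where
  "action_topology G =
     subtopology (product_topology (\<lambda>_. homeo_topology) (carrier G)) (actions G)"

definition conjugate_action ::
    "('g, 'b) monoid_scheme \<Rightarrow> (cantor \<Rightarrow> cantor) \<Rightarrow> ('g \<Rightarrow> cantor \<Rightarrow> cantor) \<Rightarrow> 'g \<Rightarrow> cantor \<Rightarrow> cantor"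
  where "conjugate_action G \<phi> \<alpha> = (\<lambda>g\<in>carrier G. \<phi> \<circ> \<alpha> g \<circ> inv_into UNIV \<phi>)"

definition conjugacy_class ::
    "('g, 'b) monoid_scheme \<Rightarrow> ('g \<Rightarrow> cantor \<Rightarrow> cantor) \<Rightarrow> ('g \<Rightarrow> cantor \<Rightarrow> cantor) set" where
  "conjugacy_class G \<alpha> = {conjugate_action G \<phi> \<alpha> |\<phi>. \<phi> \<in> carrier homeo_group}"

definition strong_topological_Rokhlin :: "('g, 'b) monoid_scheme \<Rightarrow> bool" where
  "strong_topological_Rokhlin G \<longleftrightarrow>
     (\<exists>\<alpha>\<in>actions G. comeager_in (action_topology G) (conjugacy_class G \<alpha>))"

lemma topspace_action_topology [simp]: "topspace (action_topology G) = actions G"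
  by (auto simp: action_topology_def actions_def PiE_def hom_def)


section \<open>Free products\<close>

text \<open>The free product is the set of words in the letters \<open>(i, g)\<close> with \<open>g \<in> G i\<close>, modulo the
  congruence generated by deleting identity letters and multiplying adjacent letters from the
  same factor.\<close>

definition free_product_words :: "'i set \<Rightarrow> ('i \<Rightarrow> ('a, 'b) monoid_scheme) \<Rightarrow> ('i \<times> 'a) list set" where
  "free_product_words I G = lists (SIGMA i:I. carrier (G i))"

inductive_set free_product_rel ::
    "'i set \<Rightarrow> ('i \<Rightarrow> ('a, 'b) monoid_scheme) \<Rightarrow> (('i \<times> 'a) list \<times> ('i \<times> 'a) list) set"
  for I :: "'i set" and G :: "'i \<Rightarrow> ('a, 'b) monoid_scheme" where
  refl: "w \<in> free_product_words I G \<Longrightarrow> (w, w) \<in> free_product_rel I G"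
| sym: "(v, w) \<in> free_product_rel I G \<Longrightarrow> (w, v) \<in> free_product_rel I G"
| trans: "(u, v) \<in> free_product_rel I G \<Longrightarrow> (v, w) \<in> free_product_rel I G
    \<Longrightarrow> (u, w) \<in> free_product_rel I G"
| unit: "u \<in> free_product_words I G \<Longrightarrow> v \<in> free_product_words I G \<Longrightarrow> i \<in> I
    \<Longrightarrow> (u @ [(i, \<one>\<^bsub>G i\<^esub>)] @ v, u @ v) \<in> free_product_rel I G"
| mult: "u \<in> free_product_words I G \<Longrightarrow> v \<in> free_product_words I G \<Longrightarrow> i \<in> I
    \<Longrightarrow> g \<in> carrier (G i) \<Longrightarrow> h \<in> carrier (G i)
    \<Longrightarrow> (u @ [(i, g), (i, h)] @ v, u @ [(i, g \<otimes>\<^bsub>G i\<^esub> h)] @ v) \<in> free_product_rel I G"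

definition free_product ::
    "'i set \<Rightarrow> ('i \<Rightarrow> ('a, 'b) monoid_scheme) \<Rightarrow> ('i \<times> 'a) list set monoid" where
  "free_product I G =
     \<lparr>carrier = free_product_words I G // free_product_rel I G,
      mult = (\<lambda>A B. free_product_rel I G `` {u @ v |u v. u \<in> A \<and> v \<in> B}),
      one = free_product_rel I G `` {[]}\<rparr>"

definition free_product_incl ::
    "'i set \<Rightarrow> ('i \<Rightarrow> ('a, 'b) monoid_scheme) \<Rightarrow> 'i \<Rightarrow> 'a \<Rightarrow> ('i \<times> 'a) list set" where
  "free_product_incl I G i g = free_product_rel I G `` {[(i, g)]}"

context
  fixes I :: "'i set" and G :: "'i \<Rightarrow> ('a, 'b) monoid_scheme"
  assumes grp: "\<And>i. i \<in> I \<Longrightarrow> group (G i)"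
begin

private abbreviation (input) "W \<equiv> free_product_words I G"
private abbreviation (input) "R \<equiv> free_product_rel I G"
private abbreviation (input) "P \<equiv> free_product I G"

lemma free_product_words_simps [simp]:
  "[] \<in> W"
  "(i, g) # w \<in> W \<longleftrightarrow> i \<in> I \<and> g \<in> carrier (G i) \<and> w \<in> W"
  "u @ v \<in> W \<longleftrightarrow> u \<in> W \<and> v \<in> W"
  by (auto simp: free_product_words_def)

lemma free_product_rel_words: "(v, w) \<in> R \<Longrightarrow> v \<in> W \<and> w \<in> W"
  by (induction rule: free_product_rel.induct)
     (auto intro: monoid.m_closed monoid.one_closed dest: grp group.is_monoid)

lemma equiv_free_product_rel: "equiv W R"
proof (rule equivI)
  show "R \<subseteq> W \<times> W" using free_product_rel_words by auto
  show "refl_on W R" by (auto simp: refl_on_def intro: free_product_rel.refl)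
  show "sym R" by (auto simp: sym_def intro: free_product_rel.sym)
  show "trans R" by (auto simp: trans_def intro: free_product_rel.trans)
qed

lemma free_product_rel_append_left: "(v, w) \<in> R \<Longrightarrow> u \<in> W \<Longrightarrow> (u @ v, u @ w) \<in> R"
proof (induction rule: free_product_rel.induct)
  case (unit p q i)
  then show ?case using free_product_rel.unit[of "u @ p" I G q i] by simp
next
  case (mult p q i g h)
  then show ?case using free_product_rel.mult[of "u @ p" I G q i g h] by simp
next
  case (trans p q r)
  then show ?case by (meson free_product_rel.trans)
qed (auto intro: free_product_rel.refl free_product_rel.sym)

lemma free_product_rel_append_right: "(v, w) \<in> R \<Longrightarrow> u \<in> W \<Longrightarrow> (v @ u, w @ u) \<in> R"
proof (induction rule: free_product_rel.induct)
  case (unit p q i)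
  then show ?case using free_product_rel.unit[of p I G "q @ u" i] by simp
next
  case (mult p q i g h)
  then show ?case using free_product_rel.mult[of p I G "q @ u" i g h] by simp
next
  case (trans p q r)
  then show ?case by (meson free_product_rel.trans)
qed (auto intro: free_product_rel.refl free_product_rel.sym)

lemma free_product_rel_append:
  "(u, u') \<in> R \<Longrightarrow> (v, v') \<in> R \<Longrightarrow> (u @ v, u' @ v') \<in> R"
  by (meson free_product_rel.trans free_product_rel_append_left free_product_rel_append_right
      free_product_rel_words)

lemma free_product_mult_class:
  assumes "u \<in> W" "v \<in> W"
  shows "R `` {u} \<otimes>\<^bsub>P\<^esub> R `` {v} = R `` {u @ v}"
proof -
  have "(u @ v, x) \<in> R" if "(u, u') \<in> R" "(v, v') \<in> R" "(u' @ v', x) \<in> R" for x u' v'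
    using free_product_rel.trans[OF free_product_rel_append[OF that(1,2)] that(3)] .
  moreover have "(u, u) \<in> R" "(v, v) \<in> R" using assms by (auto intro: free_product_rel.refl)
  ultimately show ?thesis by (fastforce simp: free_product_def)
qed

lemma free_product_carrier: "carrier P = {R `` {w} |w. w \<in> W}"
  by (auto simp: free_product_def quotient_def)

lemma free_product_class_in: "w \<in> W \<Longrightarrow> R `` {w} \<in> carrier P"
  unfolding free_product_carrier by blast

lemma free_product_carrierE:
  assumes "x \<in> carrier P"
  obtains w where "x = R `` {w}" "w \<in> W"
  using assms unfolding free_product_carrier by blast

lemma free_product_class_eq: "(u, v) \<in> R \<Longrightarrow> R `` {u} = R `` {v}"
  by (rule equiv_class_eq[OF equiv_free_product_rel])

lemma free_product_one: "\<one>\<^bsub>P\<^esub> = R `` {[]}"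
  by (simp add: free_product_def)

lemma free_product_left_inverse: "w \<in> W \<Longrightarrow> \<exists>v\<in>W. (v @ w, []) \<in> R"
proof (induction w)
  case Nil
  then show ?case by (intro bexI[of _ "[]"]) (auto intro: free_product_rel.refl)
next
  case (Cons a w)
  obtain i g where a: "a = (i, g)" by (cases a)
  with Cons.prems have ig: "i \<in> I" "g \<in> carrier (G i)" "w \<in> W" by auto
  interpret group "G i" by (rule grp[OF ig(1)])
  obtain v where v: "v \<in> W" "(v @ w, []) \<in> R" using Cons.IH ig(3) by auto
  have "(v @ [(i, inv\<^bsub>G i\<^esub> g), (i, g)] @ w, v @ [(i, \<one>\<^bsub>G i\<^esub>)] @ w) \<in> R"
    using free_product_rel.mult[of v I G w i "inv\<^bsub>G i\<^esub> g" g] ig v by simp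
  moreover have "(v @ [(i, \<one>\<^bsub>G i\<^esub>)] @ w, v @ w) \<in> R"
    by (rule free_product_rel.unit[OF v(1) ig(3,1)])
  ultimately have "((v @ [(i, inv\<^bsub>G i\<^esub> g)]) @ a # w, []) \<in> R"
    using free_product_rel.trans free_product_rel.trans[OF _ v(2)] unfolding a
    by (metis append.assoc append_Cons append_Nil)
  then show ?case using v(1) ig by (intro bexI[of _ "v @ [(i, inv\<^bsub>G i\<^esub> g)]"]) auto
qed

lemma group_free_product: "group P"
proof (rule groupI)
  fix x y z assume x: "x \<in> carrier P" and y: "y \<in> carrier P" and z: "z \<in> carrier P"
  obtain u v w where *: "x = R `` {u}" "y = R `` {v}" "z = R `` {w}" "u \<in> W" "v \<in> W" "w \<in> W"
    using x y z by (metis free_product_carrierE)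
  show "x \<otimes>\<^bsub>P\<^esub> y \<in> carrier P"
    using * by (simp add: free_product_mult_class free_product_class_in)
  show "x \<otimes>\<^bsub>P\<^esub> y \<otimes>\<^bsub>P\<^esub> z = x \<otimes>\<^bsub>P\<^esub> (y \<otimes>\<^bsub>P\<^esub> z)"
    using * by (simp add: free_product_mult_class)
next
  show "\<one>\<^bsub>P\<^esub> \<in> carrier P" by (simp add: free_product_class_in free_product_one)
next
  fix x assume "x \<in> carrier P"
  then obtain u where u: "x = R `` {u}" "u \<in> W" by (rule free_product_carrierE)
  show "\<one>\<^bsub>P\<^esub> \<otimes>\<^bsub>P\<^esub> x = x"
    using free_product_mult_class[of "[]" u] u by (simp add: free_product_one)
  obtain v where v: "v \<in> W" "(v @ u, []) \<in> R" using free_product_left_inverse u(2) by auto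
  have "R `` {v} \<otimes>\<^bsub>P\<^esub> x = \<one>\<^bsub>P\<^esub>"
    using free_product_mult_class[of v u] free_product_class_eq[OF v(2)] u v
    by (simp add: free_product_one)
  moreover have "R `` {v} \<in> carrier P" using v by (simp add: free_product_class_in)
  ultimately show "\<exists>y\<in>carrier P. y \<otimes>\<^bsub>P\<^esub> x = \<one>\<^bsub>P\<^esub>" by blast
qed

lemma free_product_incl_hom:
  assumes i: "i \<in> I"
  shows "free_product_incl I G i \<in> hom (G i) P"
proof (rule homI)
  fix g h assume gh: "g \<in> carrier (G i)" "h \<in> carrier (G i)"
  show "free_product_incl I G i g \<in> carrier P"
    using i gh by (simp add: free_product_incl_def free_product_class_in)
  have "([(i, g), (i, h)], [(i, g \<otimes>\<^bsub>G i\<^esub> h)]) \<in> R"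
    using free_product_rel.mult[of "[]" I G "[]" i g h] i gh by simp
  then show "free_product_incl I G i (g \<otimes>\<^bsub>G i\<^esub> h)
      = free_product_incl I G i g \<otimes>\<^bsub>P\<^esub> free_product_incl I G i h"
    using free_product_mult_class[of "[(i, g)]" "[(i, h)]"] i gh
    by (simp add: free_product_incl_def free_product_class_eq)
qed

text \<open>The universal property of the free product.\<close>

lemma free_product_universal:
  fixes H :: "('c, 'd) monoid_scheme"
  assumes H: "group H" and f: "\<And>i. i \<in> I \<Longrightarrow> f i \<in> hom (G i) H"
  shows "\<exists>!F. F \<in> hom P H \<inter> extensional (carrier P) \<and>
     (\<forall>i\<in>I. \<forall>g\<in>carrier (G i). F (free_product_incl I G i g) = f i g)"
proof -
  interpret H: group H by (rule H)
  define ev where "ev w = foldr (\<lambda>(i, g) r. f i g \<otimes>\<^bsub>H\<^esub> r) w \<one>\<^bsub>H\<^esub>" for w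
  have f_closed: "f i g \<in> carrier H" if "i \<in> I" "g \<in> carrier (G i)" for i g
    using f that by (auto simp: hom_def)
  have ev_simps: "ev [] = \<one>\<^bsub>H\<^esub>" "ev ((i, g) # w) = f i g \<otimes>\<^bsub>H\<^esub> ev w" for i g w
    by (auto simp: ev_def)
  have ev_closed: "ev w \<in> carrier H" if "w \<in> W" for w
    using that by (induction w) (auto simp: ev_simps f_closed)
  have ev_append: "ev (u @ v) = ev u \<otimes>\<^bsub>H\<^esub> ev v" if "u \<in> W" "v \<in> W" for u v
    using that by (induction u) (auto simp: ev_simps f_closed ev_closed H.m_assoc)
  have ev_rel: "ev v = ev w" if "(v, w) \<in> R" for v w
    using that
  proof (induction rule: free_product_rel.induct)
    case (unit u v i)
    then have "f i \<one>\<^bsub>G i\<^esub> = \<one>\<^bsub>H\<^esub>"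
      by (meson H f grp group_hom.hom_one group_hom.intro group_hom_axioms.intro)
    moreover have "\<one>\<^bsub>G i\<^esub> \<in> carrier (G i)" using grp[OF unit(3)] by (simp add: group.is_monoid)
    ultimately show ?case using unit by (simp add: ev_append ev_simps ev_closed)
  next
    case (mult u v i g h)
    have "g \<otimes>\<^bsub>G i\<^esub> h \<in> carrier (G i)"
      using grp[OF mult(3)] mult by (simp add: group.is_monoid monoid.m_closed)
    moreover have "f i (g \<otimes>\<^bsub>G i\<^esub> h) = f i g \<otimes>\<^bsub>H\<^esub> f i h"
      using f mult by (simp add: hom_mult)
    ultimately show ?case
      using mult by (simp add: ev_append ev_simps ev_closed f_closed H.m_assoc)
  qed auto
  define F where "F = (\<lambda>A\<in>carrier P. ev (SOME w. w \<in> A))"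
  have F_class: "F (R `` {w}) = ev w" if w: "w \<in> W" for w
  proof -
    have "w \<in> R `` {w}" using w by (auto intro: free_product_rel.refl)
    then have "(SOME v. v \<in> R `` {w}) \<in> R `` {w}" by (rule someI)
    then have "ev (SOME v. v \<in> R `` {w}) = ev w"
      using ev_rel[of w "SOME v. v \<in> R `` {w}"] by simp
    then show ?thesis using w by (simp add: F_def free_product_class_in)
  qed
  show ?thesis
  proof (rule ex1I[of _ F], intro conjI IntI ballI)
    show "F \<in> hom P H"
    proof (rule homI)
      fix x y assume "x \<in> carrier P" "y \<in> carrier P"
      then obtain u v where *: "x = R `` {u}" "u \<in> W" "y = R `` {v}" "v \<in> W"
        by (metis free_product_carrierE)
      then show "F x \<in> carrier H" by (simp add: F_class ev_closed)
      show "F (x \<otimes>\<^bsub>P\<^esub> y) = F x \<otimes>\<^bsub>H\<^esub> F y"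
        using * by (simp add: free_product_mult_class F_class ev_append)
    qed
    show "F \<in> extensional (carrier P)" by (simp add: F_def)
    fix i g assume "i \<in> I" "g \<in> carrier (G i)"
    then show "F (free_product_incl I G i g) = f i g"
      by (simp add: free_product_incl_def F_class ev_simps f_closed)
  next
    fix F' assume F': "F' \<in> hom P H \<inter> extensional (carrier P) \<and>
      (\<forall>i\<in>I. \<forall>g\<in>carrier (G i). F' (free_product_incl I G i g) = f i g)"
    then interpret F': group_hom P H F'
      by (auto simp: group_hom_def group_hom_axioms_def group_free_product H)
    have F'_class: "F' (R `` {w}) = ev w" if "w \<in> W" for w
      using that
    proof (induction w)
      case Nil
      then show ?case using F'.hom_one by (simp add: ev_simps free_product_one)
    next
      case (Cons a w)
      obtain i g where a: "a = (i, g)" by (cases a)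
      with Cons.prems have ig: "i \<in> I" "g \<in> carrier (G i)" "w \<in> W" by auto
      have "R `` {a # w} = free_product_incl I G i g \<otimes>\<^bsub>P\<^esub> R `` {w}"
        using free_product_mult_class[of "[a]" w] ig a by (simp add: free_product_incl_def)
      moreover have "free_product_incl I G i g \<in> carrier P"
        using ig by (simp add: free_product_incl_def free_product_class_in)
      moreover have "R `` {w} \<in> carrier P" using ig by (simp add: free_product_class_in)
      ultimately show ?case using Cons.IH ig F' a by (simp add: ev_simps)
    qed
    show "F' = F"
    proof (rule extensionalityI[of _ "carrier P"])
      show "F' \<in> extensional (carrier P)" using F' by auto
      show "F \<in> extensional (carrier P)" by (simp add: F_def)
      fix x assume "x \<in> carrier P"
      then obtain w where "x = R `` {w}" "w \<in> W" by (rule free_product_carrierE)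
      then show "F' x = F x" by (simp add: F_class F'_class)
    qed
  qed
qed

end

lemma countable_free_product:
  assumes "countable I" "\<And>i. i \<in> I \<Longrightarrow> countable (carrier (G i))"
  shows "countable (carrier (free_product I G))"
proof -
  have "countable (free_product_words I G)"
    unfolding free_product_words_def using assms by (intro countable_lists countable_SIGMA)
  then show ?thesis
    by (simp add: free_product_def quotient_def UNION_singleton_eq_range)
qed

end

theory Submission
  imports Defs "HOL-Algebra.Multiplicative_Group"
begin

text \<open>A locally constant label on the Cantor space turns an action into a family of local patterns: for
  each of finitely many windows (a finite factor, or the two edges \<open>{\<one>, s}\<close> and \<open>{\<one>, inv s}\<close> of an
  infinite cyclic factor), the finite set of patterns of labels that are seen through it. In a free
  product these families can be prescribed at will, subject to an obvious necessary consistency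
  (\<open>patterns_realized\<close>): the factors may act independently of each other, and nonempty clopen sets
  can be cut into any number of copies of the Cantor space for a factor to permute.

  The core is that families which determine the set of all itineraries, called rigid, are abundant.
  The Cayley graph of a free product is tree-like. Add to every label the direction in which a root
  lies, and let the labels farther away from the root be a fixed function of the label at hand. In
  such a rooted family a root determines its whole itinerary, and a configuration whose root has
  escaped to infinity is a limit of configurations with a root; hence rooted families are rigid
  (\<open>rigid_rooted\<close>), while forgetting the directions gives back an arbitrary consistent family.

  This yields two kinds of dense open conditions on an action. First, every label is refined by a
  rigid one (\<open>dense_refinable\<close>). Secondly, whenever the patterns of a label are rigid and lift to the
  patterns of some label of some action, the label itself lifts (\<open>dense_lifting\<close>); here rigidity makes
  the fibre product of the two labeled actions project onto both of them, and the patterns of the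
  fibre product are realized near the given action. Up to recoding there are only countably many
  labels and families, and the space of actions is completely metrizable, so by Baire category there
  is a generic action, one that satisfies all the conditions.

  Between two generic actions a back-and-forth construction produces finer and finer labels with the
  same itineraries on both sides. In the limit these labels separate points, and sending a point to
  the point with the same itineraries conjugates one action to the other
  (\<open>generic_actions_conjugate\<close>). So a single conjugacy class contains all generic actions, which
  form a comeager set.\<close>

section \<open>Labels of the Cantor space\<close>

text \<open>The first \<open>m\<close> coordinates, coded as a number so that labels of all sizes take
  values in one countable type.\<close>

definition level :: "nat \<Rightarrow> cantor \<Rightarrow> nat" where
  "level m x = to_nat (map x [0..<m])"

lemma level_eq_iff: "level m x = level m y \<longleftrightarrow> (\<forall>n<m. x n = y n)"
  by (auto simp: level_def)

lemma level_mono: "level m x = level m y \<Longrightarrow> k \<le> m \<Longrightarrow> level k x = level k y"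
  by (simp add: level_eq_iff)

lemma finite_range_level: "finite (range (level m))"
proof -
  have "range (level m) \<subseteq> to_nat ` {bs::bool list. set bs \<subseteq> UNIV \<and> length bs = m}"
    by (auto simp: level_def)
  then show ?thesis
    by (rule finite_subset) (intro finite_imageI finite_lists_length_eq, simp)
qed

text \<open>By compactness these are exactly the continuous maps into a discrete space
  (\<open>label_iff_open\<close>). The uniform form gives finite ranges and common refinements
  for free.\<close>

definition label :: "(cantor \<Rightarrow> 'l) \<Rightarrow> bool" where
  "label q \<longleftrightarrow> (\<exists>k. \<forall>x y. level k x = level k y \<longrightarrow> q x = q y)"

lemma label_level: "label (level m)"
  by (auto simp: label_def)

lemma label_const: "label (\<lambda>x. c)"
  by (auto simp: label_def)

lemma label_depends: 
  assumes "label q" "\<And>x y. q x = q y \<Longrightarrow> r x = r y"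
  shows "label r"
  using assms unfolding label_def by blast

lemma label_comp: "label q \<Longrightarrow> label (\<lambda>x. f (q x))"
  by (erule label_depends) simp

lemma labelE:
  assumes "label q"
  obtains k where "\<forall>x y. level k x = level k y \<longrightarrow> q x = q y"
  using assms[unfolded label_def] by (elim exE)

lemma label_obtain_bound:
  assumes "label q"
  obtains k where "\<And>m x y. k \<le> m \<Longrightarrow> level m x = level m y \<Longrightarrow> q x = q y"
  using assms level_mono unfolding label_def by blast

lemma label_finite_range:
  assumes "label q" shows "finite (range q)"
proof -
  obtain k where k: "\<And>x y. level k x = level k y \<Longrightarrow> q x = q y"
    using assms unfolding label_def by metis
  have "q x \<in> (\<lambda>v. q (SOME y. level k y = v)) ` range (level k)" for x
    using k[of x "SOME y. level k y = level k x"] someI[of "\<lambda>y. level k y = level k x" x]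
    by auto
  then have "range q \<subseteq> (\<lambda>v. q (SOME y. level k y = v)) ` range (level k)"
    by blast
  then show ?thesis
    using finite_range_level finite_surj by blast
qed

lemma label_uniform:
  assumes "finite J" "\<And>j. j \<in> J \<Longrightarrow> label (r j)"
  shows "\<exists>k. \<forall>j\<in>J. \<forall>x y. level k x = level k y \<longrightarrow> r j x = r j y"
  using assms
proof (induction J rule: finite_induct)
  case (insert j J)
  obtain k where k: "\<forall>j\<in>J. \<forall>x y. level k x = level k y \<longrightarrow> r j x = r j y"
    using insert by auto
  obtain l where l: "\<And>m x y. l \<le> m \<Longrightarrow> level m x = level m y \<Longrightarrow> r j x = r j y"
    using insert.prems label_obtain_bound by (metis insertI1)
  have "\<forall>i\<in>insert j J. \<forall>x y. level (max k l) x = level (max k l) y \<longrightarrow> r i x = r i y"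
    using k l level_mono by (metis insert_iff max.cobounded1 max.cobounded2)
  then show ?case by blast
qed auto

text \<open>Gluing over a clopen partition: the partition has finitely many pieces, so the moduli of the
  pieces have a maximum.\<close>

lemma label_switch:
  assumes "label q" "\<And>j. j \<in> range q \<Longrightarrow> label (r j)"
  shows "label (\<lambda>x. r (q x) x)"
proof -
  obtain k where k: "\<And>m x y. k \<le> m \<Longrightarrow> level m x = level m y \<Longrightarrow> q x = q y"
    using assms(1) label_obtain_bound by blast
  obtain l where l: "\<forall>j\<in>range q. \<forall>x y. level l x = level l y \<longrightarrow> r j x = r j y"
    using label_uniform[OF label_finite_range[OF assms(1)], of r] assms(2) by blast
  have "r (q x) x = r (q y) y" if "level (max k l) x = level (max k l) y" for x y
  proof -
    have "q x = q y" using k[OF _ that] by simp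
    moreover have "level l x = level l y" using that level_mono by (metis max.cobounded2)
    ultimately show ?thesis using l by (metis rangeI)
  qed
  then show ?thesis unfolding label_def by blast
qed

lemma label_pair: "label q \<Longrightarrow> label r \<Longrightarrow> label (\<lambda>x. f (q x) (r x))"
  by (rule label_switch[of q "\<lambda>j x. f j (r x)"]) (simp_all add: label_comp)

lemma label_eq_comp_level:
  assumes "label p"
  obtains k where "\<And>M. k \<le> M \<Longrightarrow> \<exists>\<pi>. p = \<pi> \<circ> level M"
proof -
  obtain k where k: "\<And>m x y. k \<le> m \<Longrightarrow> level m x = level m y \<Longrightarrow> p x = p y"
    using assms label_obtain_bound by blast
  have "p = (\<lambda>v. p (SOME y. level M y = v)) \<circ> level M" if "k \<le> M" for M
  proof
    fix x show "p x = ((\<lambda>v. p (SOME y. level M y = v)) \<circ> level M) x"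
      using k[OF that, of x "SOME y. level M y = level M x"]
         someI[of "\<lambda>y. level M y = level M x" x] by auto
  qed
  then show thesis using that by blast
qed

lemma countable_labels: "countable {p :: cantor \<Rightarrow> 'l::countable. label p}"
proof -
  define D where "D = (\<lambda>(m, t :: (nat \<times> 'l) list). \<lambda>x::cantor. the (map_of t (level m x)))"
  have "{p :: cantor \<Rightarrow> 'l. label p} \<subseteq> range D"
  proof
    fix p :: "cantor \<Rightarrow> 'l" assume "p \<in> {p. label p}"
    then obtain m \<pi> where p: "p = \<pi> \<circ> level m"
      using label_eq_comp_level by (metis mem_Collect_eq order_refl)
    obtain vs where vs: "set vs = range (level m)"
      using finite_list[OF finite_range_level] by blast
    have "map_of (map (\<lambda>v. (v, \<pi> v)) vs) (level m x) = Some (\<pi> (level m x))" for x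
      using vs by (simp add: map_of_map_restrict)
    then have "p = D (m, map (\<lambda>v. (v, \<pi> v)) vs)"
      unfolding D_def p by auto
    then show "p \<in> range D" by blast
  qed
  then show ?thesis by (rule countable_subset) simp
qed

lemma open_cantor_iff:
  "open (U :: cantor set) \<longleftrightarrow> (\<forall>x\<in>U. \<exists>k. \<forall>y. level k x = level k y \<longrightarrow> y \<in> U)"
proof -
  interpret M: Metric_space "UNIV :: cantor set" cantor_dist by (rule Metric_space_cantor)
  have "open U \<longleftrightarrow> openin (mtopology_of cantor_metric) U" by simp
  also have "\<dots> \<longleftrightarrow> (\<forall>x\<in>U. \<exists>r>0. M.mball x r \<subseteq> U)"
    unfolding mtopology_of_def by (auto simp: M.openin_mtopology)
  also have "\<dots> \<longleftrightarrow> (\<forall>x\<in>U. \<exists>k. \<forall>y. level k x = level k y \<longrightarrow> y \<in> U)"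
  proof (intro ball_cong[OF HOL.refl] iffI)
    fix x assume "\<exists>r>0. M.mball x r \<subseteq> U"
    then obtain r where r: "r > 0" "M.mball x r \<subseteq> U" by blast
    obtain n where n: "(1/2::real) ^ n < r" using real_arch_pow_inv[OF r(1), of "1/2"] by auto
    have "y \<in> U" if "level (Suc n) x = level (Suc n) y" for y
    proof -
      have "cantor_dist x y < (1/2) ^ n"
        using that by (simp add: cantor_dist_less_iff level_eq_iff less_Suc_eq_le)
      then show ?thesis using r n by (auto simp: M.mball_def)
    qed
    then show "\<exists>k. \<forall>y. level k x = level k y \<longrightarrow> y \<in> U" by blast
  next
    fix x assume "\<exists>k. \<forall>y. level k x = level k y \<longrightarrow> y \<in> U"
    then obtain k where "\<forall>y. level k x = level k y \<longrightarrow> y \<in> U" by blast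
    then have "M.mball x ((1/2)^k) \<subseteq> U"
      by (auto simp: M.mball_def cantor_dist_less_iff level_eq_iff)
    then show "\<exists>r>0. M.mball x r \<subseteq> U" by (intro exI[of _ "(1/2)^k"]) auto
  qed
  finally show ?thesis .
qed

lemma compact_cantor: "compact (UNIV :: cantor set)"
proof -
  have "compact_space (euclidean :: bool topology)"
    by (simp add: compact_space_def finite_imp_compact)
  then have "compact_space (product_topology (\<lambda>_::nat. euclidean :: bool topology) UNIV)"
    by (simp add: compact_space_product_topology)
  then have "compact_space (euclidean :: cantor topology)"
    by (simp only: euclidean_product_topology)
  then show ?thesis by (simp add: compact_space_def)
qed

text \<open>A Lebesgue number for the cover by the cylinders of depth \<open>k x\<close> around the points
  \<open>x\<close>.\<close>

lemma level_Lebesgue_number: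
  fixes k :: "cantor \<Rightarrow> nat"
  shows "\<exists>K. \<forall>y. \<exists>x. k x \<le> K \<and> level (k x) x = level (k x) y"
proof -
  have op: "open {y. level (k x) x = level (k x) y}" for x
    unfolding open_cantor_iff by (intro ballI exI[of _ "k x"]) simp
  obtain X where X: "finite X" "UNIV \<subseteq> (\<Union>x\<in>X. {y. level (k x) x = level (k x) y})"
    by (rule compactE_image[OF compact_cantor, of UNIV "\<lambda>x. {y. level (k x) x = level (k x) y}"])
       (use op in auto)
  have "\<exists>x. k x \<le> Max (k ` X) \<and> level (k x) x = level (k x) y" for y
  proof -
    obtain x where "x \<in> X" "level (k x) x = level (k x) y" using X(2) by blast
    then show ?thesis using X(1) by (intro exI[of _ x]) auto
  qed
  then show ?thesis by blast
qed

lemma label_iff_open: "label q \<longleftrightarrow> (\<forall>v. open (q -` {v}))"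
proof
  assume "label q"
  then obtain k where k: "\<And>x y. level k x = level k y \<Longrightarrow> q x = q y"
    unfolding label_def by blast
  show "\<forall>v. open (q -` {v})"
    unfolding open_cantor_iff
  proof (intro allI ballI exI impI)
    fix v x y assume "x \<in> q -` {v}" "level k x = level k y"
    then show "y \<in> q -` {v}" using k[of x y] by simp
  qed
next
  assume "\<forall>v. open (q -` {v})"
  then have "open (q -` {q x})" for x by blast
  then have "\<forall>x. \<exists>k. \<forall>y. level k x = level k y \<longrightarrow> q y = q x"
    unfolding open_cantor_iff vimage_def by auto
  then obtain k where k: "\<And>x y. level (k x) x = level (k x) y \<Longrightarrow> q y = q x" by metis
  obtain K where K: "\<And>y. \<exists>x. k x \<le> K \<and> level (k x) x = level (k x) y"
    using level_Lebesgue_number by blast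
  have "q y = q z" if "level K y = level K z" for y z
  proof -
    obtain x where x: "k x \<le> K" "level (k x) x = level (k x) y" using K by blast
    then have "level (k x) x = level (k x) z" using that level_mono by metis
    then show ?thesis using k x(2) by metis
  qed
  then show "label q" unfolding label_def by blast
qed


lemma continuous_iff_label:
  "continuous_on UNIV (f :: cantor \<Rightarrow> cantor) \<longleftrightarrow> (\<forall>m. label (\<lambda>x. level m (f x)))"
proof
  assume f: "continuous_on UNIV f"
  have "open ((\<lambda>x. level m (f x)) -` {v})" for m v
  proof -
    have "open (level m -` {v})" using label_level[of m] unfolding label_iff_open by simp
    then have "open (f -` (level m -` {v}))" using f by (metis open_vimage)
    then show ?thesis by (simp add: vimage_def)
  qed
  then show "\<forall>m. label (\<lambda>x. level m (f x))" by (simp add: label_iff_open)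
next
  assume f: "\<forall>m. label (\<lambda>x. level m (f x))"
  have "open (f -` U)" if "open U" for U
    unfolding open_cantor_iff
  proof
    fix x assume "x \<in> f -` U"
    then obtain m where m: "\<forall>y. level m (f x) = level m y \<longrightarrow> y \<in> U"
      using \<open>open U\<close> unfolding open_cantor_iff by auto
    have "label (\<lambda>x. level m (f x))" using f by simp
    then obtain k where k: "\<forall>x y. level k x = level k y \<longrightarrow> level m (f x) = level m (f y)"
      by (rule labelE) 
    show "\<exists>k. \<forall>y. level k x = level k y \<longrightarrow> y \<in> f -` U"
    proof (intro exI allI impI)
      fix y assume "level k x = level k y"
      then have "level m (f x) = level m (f y)" by (rule k[rule_format])
      then show "y \<in> f -` U" using m[rule_format, of "f y"] by simp
    qed
  qed
  then show "continuous_on UNIV f" by (simp add: continuous_on_open_vimage)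
qed

lemma label_continuous:
  assumes "label q" "continuous_on UNIV f"
  shows "label (\<lambda>x. q (f x))"
proof -
  obtain m \<pi> where "q = \<pi> \<circ> level m" using label_eq_comp_level[OF assms(1)] by (metis order_refl)
  moreover have "label (\<lambda>x. level m (f x))" using assms(2) by (simp add: continuous_iff_label)
  ultimately show ?thesis using label_comp[of "\<lambda>x. level m (f x)" \<pi>] by (simp add: o_def)
qed

lemma continuous_switch:
  fixes F :: "'j \<Rightarrow> cantor \<Rightarrow> cantor"
  assumes "label q" "\<And>j. j \<in> range q \<Longrightarrow> continuous_on UNIV (F j)"
  shows "continuous_on UNIV (\<lambda>x. F (q x) x)"
  unfolding continuous_iff_label
proof
  fix m
  have "label (\<lambda>x. level m (F j x))" if "j \<in> range q" for j
    using assms(2)[OF that] by (simp add: continuous_iff_label)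
  then show "label (\<lambda>x. level m (F (q x) x))"
    using label_switch[OF assms(1), of "\<lambda>j x. level m (F j x)"] by simp
qed

text \<open>A continuous bijection of a compact Hausdorff space is a homeomorphism.\<close>

lemma homeo_group_iff:
  "f \<in> carrier homeo_group \<longleftrightarrow> bij f \<and> continuous_on UNIV f"
proof -
  have "homeomorphic_map euclidean euclidean f" if f: "bij f" "continuous_on UNIV f"
  proof (rule continuous_imp_homeomorphic_map)
    show "compact_space (euclidean :: cantor topology)"
      using compact_cantor by (simp add: compact_space_def)
    show "inj_on f (topspace euclidean)" "f ` topspace euclidean = topspace euclidean"
      using f(1) by (simp_all add: bij_def)
    show "continuous_map euclidean euclidean f" using f(2) by simp
    show "Hausdorff_space (euclidean :: cantor topology)"
      using Metric_space.Hausdorff_space_mtopology[OF Metric_space_cantor]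
      by (metis mtopology_of_cantor_metric mtopology_of_def mspace_cantor_metric mdist_cantor_metric)
  qed
  moreover have "bij f \<and> continuous_on UNIV f" if "homeomorphic_map euclidean euclidean f"
  proof
    show "bij f"
      using homeomorphic_imp_injective_map[OF that] homeomorphic_imp_surjective_map[OF that]
      by (simp add: bij_def)
    show "continuous_on UNIV f" using homeomorphic_imp_continuous_map[OF that] by simp
  qed
  ultimately show ?thesis by (auto simp: homeo_group_def)
qed

lemma homeo_groupI:
  assumes "continuous_on UNIV f" "\<And>x. g (f x) = x" "\<And>x. f (g x) = x"
  shows "f \<in> carrier homeo_group"
proof -
  have "bij f" by (rule o_bij[of g]) (auto simp: fun_eq_iff assms(2,3))
  then show ?thesis using assms(1) by (simp add: homeo_group_iff)
qed

lemma cantor_nested_nonempty: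
  fixes C :: "nat \<Rightarrow> cantor set"
  assumes "\<And>m. closed (C m)" "\<And>m. C m \<noteq> {}" "\<And>m. C (Suc m) \<subseteq> C m"
  shows "\<exists>y. \<forall>m. y \<in> C m"
proof -
  have "(\<Inter>m. C m) \<noteq> {}"
  proof (rule compact_space_imp_nest[of euclidean])
    show "decseq C" using assms(3) by (rule decseq_SucI)
  qed (use compact_cantor assms in \<open>auto simp: compact_space_def\<close>)
  then show ?thesis by blast
qed

lemma closed_label_eq: "label q \<Longrightarrow> closed {y. q y = v}"
proof -
  assume "label q"
  then have "label (\<lambda>y. q y = v)" by (rule label_comp)
  then have "open ((\<lambda>y. q y = v) -` {False})" unfolding label_iff_open by blast
  then show "closed {y. q y = v}" by (simp add: closed_def vimage_def Compl_eq)
qed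

section \<open>Cutting clopen sets into copies of the Cantor space\<close>

text \<open>\<open>idx\<close> cuts the Cantor space into clopen pieces, and \<open>e j\<close> is a
  homeomorphism of the whole Cantor space onto the piece with index \<open>j\<close>, whose
  inverse is the restriction of \<open>rest\<close>. The index type is arbitrary, so that pieces
  can be named by the patterns they are meant to carry.\<close>

definition cantor_copies ::
  "'j set \<Rightarrow> ('j \<Rightarrow> cantor \<Rightarrow> cantor) \<Rightarrow> (cantor \<Rightarrow> 'j) \<Rightarrow> (cantor \<Rightarrow> cantor) \<Rightarrow> bool" where
  "cantor_copies J e idx rest \<longleftrightarrow>
     (\<forall>j\<in>J. continuous_on UNIV (e j)) \<and> continuous_on UNIV rest \<and> label idx \<and>
     (\<forall>x. idx x \<in> J \<and> e (idx x) (rest x) = x) \<and>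
     (\<forall>j\<in>J. \<forall>c. idx (e j c) = j \<and> rest (e j c) = c)"

lemma cantor_copiesI:
  assumes "\<And>j. j \<in> J \<Longrightarrow> continuous_on UNIV (e j)" "continuous_on UNIV rest" "label idx"
    and "\<And>x. idx x \<in> J" "\<And>x. e (idx x) (rest x) = x"
    and "\<And>j c. j \<in> J \<Longrightarrow> idx (e j c) = j" "\<And>j c. j \<in> J \<Longrightarrow> rest (e j c) = c"
  shows "cantor_copies J e idx rest"
  using assms by (simp add: cantor_copies_def)

lemma cantor_copiesD:
  assumes "cantor_copies J e idx rest"
  shows "j \<in> J \<Longrightarrow> continuous_on UNIV (e j)" "continuous_on UNIV rest" "label idx"
    and "idx x \<in> J" "e (idx x) (rest x) = x"
    and "j \<in> J \<Longrightarrow> idx (e j c) = j" "j \<in> J \<Longrightarrow> rest (e j c) = c"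
  using assms by (simp_all add: cantor_copies_def)

lemma continuous_cantorI:
  assumes "\<And>n. continuous_on UNIV (\<lambda>x. (f x :: cantor) n)"
  shows "continuous_on UNIV (f :: cantor \<Rightarrow> cantor)"
  using assms by (rule continuous_on_coordinatewise_then_product)

lemma continuous_coordinate: "continuous_on UNIV (\<lambda>x::cantor. x n)"
  by (simp add: continuous_on_product_coordinates)

text \<open>The first coordinate splits the Cantor space into two copies of itself; splitting one of the
  copies again and again produces any finite number of pieces.\<close>

lemma cantor_copies_exist:
  assumes "finite J" "J \<noteq> {}"
  shows "\<exists>e idx rest. cantor_copies J e idx rest"
  using assms
proof (induction J rule: finite_ne_induct)
  case (singleton j)
  have "cantor_copies {j} (\<lambda>_ c. c) (\<lambda>_. j) (\<lambda>x. x)"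
    by (simp add: cantor_copies_def label_const)
  then show ?case by blast
next
  case (insert j J)
  then obtain e idx rest where eir: "cantor_copies J e idx rest" by blast
  define tl where "tl = (\<lambda>(x::cantor) n. x (Suc n))"
  define cons where "cons = (\<lambda>b (c::cantor) n. case n of 0 \<Rightarrow> b | Suc n \<Rightarrow> c n)"
  have tl_cons [simp]: "tl (cons b c) = c" "cons b c 0 = b" for b c
    by (auto simp: tl_def cons_def)
  have cons_tl [simp]: "cons b (tl x) = x" if "b = x 0" for b x
  proof
    fix n show "cons b (tl x) n = x n" using that by (cases n) (auto simp: tl_def cons_def)
  qed
  have c_tl: "continuous_on UNIV tl"
    unfolding tl_def by (intro continuous_cantorI continuous_coordinate)
  have c_cons: "continuous_on UNIV (cons b)" for b
  proof (rule continuous_cantorI)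
    show "continuous_on UNIV (\<lambda>x. cons b x n)" for n
      by (cases n) (auto simp: cons_def continuous_coordinate)
  qed
  have hd: "label (\<lambda>x::cantor. x 0)"
    unfolding label_def level_eq_iff by (intro exI[of _ 1]) simp
  define e' where "e' = (\<lambda>i c. if i = j then cons True c else cons False (e i c))"
  define idx' where "idx' = (\<lambda>x. if x 0 then j else idx (tl x))"
  define rest' where "rest' = (\<lambda>x. if x 0 then tl x else rest (tl x))"
  have "continuous_on UNIV (\<lambda>c. cons False (e i c))" if "i \<in> J" for i
    using eir that by (intro continuous_on_compose2[OF c_cons[of False]]) (auto simp: cantor_copies_def)
  then have "continuous_on UNIV (e' i)" if "i \<in> insert j J" for i
    using that c_cons[of True] insert.hyps(3) unfolding e'_def by (cases "i = j") simp_all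
  then have "\<forall>i\<in>insert j J. continuous_on UNIV (e' i)" by blast
  moreover have "label idx'"
    unfolding idx'_def
  proof (rule label_switch[OF hd, of "\<lambda>b x. if b then j else idx (tl x)"])
    have "label (\<lambda>x. idx (tl x))"
      by (rule label_continuous[OF _ c_tl]) (use eir in \<open>simp add: cantor_copies_def\<close>)
    then show "label (\<lambda>x. if b then j else idx (tl x))" for b
      by (cases b) (simp_all add: label_const)
  qed
  moreover have "continuous_on UNIV rest'"
    unfolding rest'_def
  proof (rule continuous_switch[OF hd, of "\<lambda>b x. if b then tl x else rest (tl x)"])
    have "continuous_on UNIV (\<lambda>x. rest (tl x))"
      by (rule continuous_on_compose2[OF _ c_tl]) (use eir in \<open>auto simp: cantor_copies_def\<close>)
    then show "continuous_on UNIV (\<lambda>x. if b then tl x else rest (tl x))" for b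
      by (cases b) (simp_all add: c_tl)
  qed
  moreover have "idx' x \<in> insert j J \<and> e' (idx' x) (rest' x) = x" for x
  proof (cases "x 0")
    case True
    then show ?thesis by (simp add: e'_def idx'_def rest'_def)
  next
    case False
    moreover have "idx (tl x) \<in> J" "e (idx (tl x)) (rest (tl x)) = tl x"
      using eir by (simp_all add: cantor_copies_def)
    ultimately show ?thesis using insert.hyps(3) by (auto simp: e'_def idx'_def rest'_def)
  qed
  moreover have "idx' (e' i c) = i \<and> rest' (e' i c) = c" if "i \<in> insert j J" for i c
  proof (cases "i = j")
    case True
    then show ?thesis by (simp add: e'_def idx'_def rest'_def)
  next
    case False
    then have "idx (e i c) = i \<and> rest (e i c) = c" using eir that by (simp add: cantor_copies_def)
    then show ?thesis using False by (simp add: e'_def idx'_def rest'_def)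
  qed
  ultimately have "cantor_copies (insert j J) e' idx' rest'"
    by (intro cantor_copiesI) blast+
  then show ?case by (intro exI)
qed

lemma cantor_copies_on_fibres:
  assumes J: "finite J" "l ` J = B"
  shows "\<exists>E I R. \<forall>b\<in>B. cantor_copies {j \<in> J. l j = b} (E b) (I b) (R b)"
proof -
  have "\<exists>t. cantor_copies {j \<in> J. l j = b} (fst t) (fst (snd t)) (snd (snd t))" if "b \<in> B" for b
  proof -
    have "finite {j \<in> J. l j = b}" "{j \<in> J. l j = b} \<noteq> {}" using J that by auto
    then obtain e i r where "cantor_copies {j \<in> J. l j = b} e i r"
      using cantor_copies_exist by blast
    then show ?thesis by (intro exI[of _ "(e, i, r)"]) simp
  qed
  then obtain t where t: "\<And>b. b \<in> B \<Longrightarrow>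
      cantor_copies {j \<in> J. l j = b} (fst (t b)) (fst (snd (t b))) (snd (snd (t b)))"
    using bchoice[of B "\<lambda>b t. cantor_copies {j \<in> J. l j = b} (fst t) (fst (snd t)) (snd (snd t))"]
    by blast
  define E I R where "E b = fst (t b)" and "I b = fst (snd (t b))" and "R b = snd (snd (t b))" for b
  show ?thesis using t unfolding E_def I_def R_def by (intro exI ballI)
qed

text \<open>Subdivision: each piece is itself a Cantor space, so it can be cut further into one piece for
  each index lying over it.\<close>

lemma cantor_copies_fibres:
  assumes base: "cantor_copies B e idx rest" and J: "finite J" "l ` J = B"
  shows "\<exists>e' idx' rest'. cantor_copies J e' idx' rest' \<and> (\<forall>x. l (idx' x) = idx x)"
proof -
  obtain E I R where EIR: "\<And>b. b \<in> B \<Longrightarrow> cantor_copies {j \<in> J. l j = b} (E b) (I b) (R b)"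
    using cantor_copies_on_fibres[OF J] by blast
  note base' = cantor_copiesD[OF base] and EIR' = cantor_copiesD[OF EIR]
  have lJ: "l j \<in> B" "j \<in> {i \<in> J. l i = l j}" if "j \<in> J" for j using J that by auto
  have I: "I (idx x) (rest x) \<in> J" "l (I (idx x) (rest x)) = idx x" for x
    using EIR'(4)[OF base'(4), of x "rest x"] by simp_all
  have "cantor_copies J (\<lambda>j c. e (l j) (E (l j) j c)) (\<lambda>x. I (idx x) (rest x))
      (\<lambda>x. R (idx x) (rest x))"
  proof (rule cantor_copiesI)
    show "continuous_on UNIV (\<lambda>c. e (l j) (E (l j) j c))" if "j \<in> J" for j
      by (rule continuous_on_compose2[OF base'(1) EIR'(1)]) (use lJ[OF that] in auto)
    show "continuous_on UNIV (\<lambda>x. R (idx x) (rest x))"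
      by (rule continuous_switch[OF base'(3)], rule continuous_on_compose2[OF EIR'(2) base'(2)])
         (use base'(4) in auto)
    show "label (\<lambda>x. I (idx x) (rest x))"
      by (rule label_switch[OF base'(3)], rule label_continuous[OF EIR'(3) base'(2)])
         (use base'(4) in auto)
    show "e (l (I (idx x) (rest x))) (E (l (I (idx x) (rest x))) (I (idx x) (rest x)) (R (idx x) (rest x))) = x"
      for x unfolding I(2) using EIR'(5)[OF base'(4)] base'(5) by simp
    show "I (idx (e (l j) (E (l j) j c))) (rest (e (l j) (E (l j) j c))) = j" if "j \<in> J" for j c
      using base'(6,7)[OF lJ(1)[OF that]] EIR'(6)[OF lJ[OF that]] by simp
    show "R (idx (e (l j) (E (l j) j c))) (rest (e (l j) (E (l j) j c))) = c" if "j \<in> J" for j c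
      using base'(6,7)[OF lJ(1)[OF that]] EIR'(7)[OF lJ[OF that]] by simp
  qed (rule I(1))
  then show ?thesis using I(2) by blast
qed

text \<open>The inverse of subdivision: finitely many pieces together form a Cantor space again, because a
  single Cantor space can be cut into the same number of pieces.\<close>

lemma cantor_copies_merge:
  assumes base: "cantor_copies J e idx rest" and J: "finite J" "l ` J = B"
  shows "\<exists>e' rest'. cantor_copies B e' (\<lambda>x. l (idx x)) rest'"
proof -
  obtain E I R where EIR: "\<And>b. b \<in> B \<Longrightarrow> cantor_copies {j \<in> J. l j = b} (E b) (I b) (R b)"
    using cantor_copies_on_fibres[OF J] by blast
  note base' = cantor_copiesD[OF base] and EIR' = cantor_copiesD[OF EIR]
  have lJ: "l j \<in> B" "j \<in> {i \<in> J. l i = l j}" if "j \<in> J" for j using J that by auto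
  have I: "I b c \<in> J" "l (I b c) = b" if "b \<in> B" for b c
    using EIR'(4)[OF that, of c] by simp_all
  have "cantor_copies B (\<lambda>b c. e (I b c) (R b c)) (\<lambda>x. l (idx x)) (\<lambda>x. E (l (idx x)) (idx x) (rest x))"
  proof (rule cantor_copiesI)
    show "continuous_on UNIV (\<lambda>c. e (I b c) (R b c))" if b: "b \<in> B" for b
      by (rule continuous_switch[OF EIR'(3)[OF b]], rule continuous_on_compose2[OF base'(1) EIR'(2)])
         (use b I in auto)
    show "continuous_on UNIV (\<lambda>x. E (l (idx x)) (idx x) (rest x))"
      by (rule continuous_switch[OF base'(3)], rule continuous_on_compose2[OF EIR'(1) base'(2)])
         (use lJ base'(4) in auto)
    show "label (\<lambda>x. l (idx x))" by (rule label_comp) (rule base'(3))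
    show "l (idx x) \<in> B" for x using lJ(1) base'(4) .
    show "e (I (l (idx x)) (E (l (idx x)) (idx x) (rest x))) (R (l (idx x)) (E (l (idx x)) (idx x) (rest x))) = x"
      for x using EIR'(6,7)[OF lJ[OF base'(4)]] base'(5) by simp
    show "l (idx (e (I b c) (R b c))) = b" if "b \<in> B" for b c
      using base'(6) I that by simp
    show "E (l (idx (e (I b c) (R b c)))) (idx (e (I b c) (R b c))) (rest (e (I b c) (R b c))) = c"
      if "b \<in> B" for b c
      using base'(6,7)[OF I(1)[OF that]] I(2)[OF that] EIR'(5)[OF that] by simp
  qed
  then show ?thesis by blast
qed

lemma cantor_copies_cylinders:
  "cantor_copies {w. \<forall>n\<ge>m. \<not> w n} (\<lambda>w c n. if n < m then w n else c (n - m))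
     (\<lambda>x n. n < m \<and> x n) (\<lambda>x n. x (n + m))"
proof (rule cantor_copiesI)
  show "continuous_on UNIV (\<lambda>(c::cantor) n. if n < m then w n else c (n - m))" for w
  proof (rule continuous_cantorI)
    show "continuous_on UNIV (\<lambda>c::cantor. if n < m then w n else c (n - m))" for n
      by (cases "n < m") (simp_all add: continuous_coordinate)
  qed
  show "continuous_on UNIV (\<lambda>(x::cantor) n. x (n + m))"
    by (rule continuous_cantorI) (rule continuous_coordinate)
  show "label (\<lambda>(x::cantor) n. n < m \<and> x n)"
    unfolding label_def level_eq_iff by (intro exI[of _ m]) auto
qed (auto simp: fun_eq_iff not_less)

text \<open>A label depends on finitely many coordinates, so each of its fibres is a finite disjoint union
  of cylinders, and these merge into one copy of the Cantor space.\<close>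

lemma cantor_copies_label:
  assumes "label q"
  shows "\<exists>e rest. cantor_copies (range q) e q rest"
proof -
  obtain m where "\<forall>x y. level m x = level m y \<longrightarrow> q x = q y"
    using assms by (rule labelE)
  note m = this[rule_format]
  define W where "W = {w::cantor. \<forall>n\<ge>m. \<not> w n}"
  define E where "E = (\<lambda>(w::cantor) (c::cantor) n. if n < m then w n else c (n - m))"
  define T where "T = (\<lambda>(x::cantor) n. n < m \<and> x n)"
  define D where "D = (\<lambda>(x::cantor) n. x (n + m))"
  have base: "cantor_copies W E T D"
    unfolding W_def E_def T_def D_def by (rule cantor_copies_cylinders)
  have "W \<subseteq> (\<lambda>S n. n \<in> S) ` Pow {..<m}"
  proof
    fix w assume "w \<in> W"
    then have "w = (\<lambda>S n. n \<in> S) {n. w n}" "{n. w n} \<in> Pow {..<m}"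
      by (auto simp: W_def) (meson not_le)
    then show "w \<in> (\<lambda>S n. n \<in> S) ` Pow {..<m}" by blast
  qed
  then have finW: "finite W" by (rule finite_subset) simp
  have qT: "q (T x) = q x" for x
    by (rule m) (simp add: level_eq_iff T_def)
  have TW: "T x \<in> W" for x by (simp add: T_def W_def)
  \<comment> \<open>\<open>W\<close> names the cylinders of depth \<open>m\<close> by their members ending in \<open>False\<close>\<close>
  have "q ` W = range q" using qT TW by (auto, metis imageI)
  from cantor_copies_merge[OF base finW this]
  show ?thesis by (simp only: qT)
qed

text \<open>The fibres of a label can be cut into as many pieces as desired, with names prescribed in
  advance. All actions below are built by permuting such pieces.\<close>

lemma cantor_copies_over_label:
  assumes "label q" "finite J" "l ` J = range q"
  shows "\<exists>e idx rest. cantor_copies J e idx rest \<and> (\<forall>x. l (idx x) = q x)"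
  using cantor_copies_label[OF assms(1)] cantor_copies_fibres[OF _ assms(2,3)] by blast

text \<open>Any finite set of values lying over the values of a label is the range of a finer label, since
  nonempty clopen sets split into any number of nonempty clopen sets.\<close>

lemma label_refinement:
  assumes p: "label p" and V: "finite V" "f ` V = range p"
  obtains l where "label l" "f \<circ> l = p" "range l = V"
proof -
  obtain e l rest where l: "cantor_copies V e l rest" "\<forall>x. f (l x) = p x"
    using cantor_copies_over_label[OF p V] by blast
  have "range l = V"
    using cantor_copiesD(4,6)[OF l(1)] by (auto, metis rangeI)
  moreover have "f \<circ> l = p" using l(2) by (simp add: fun_eq_iff)
  ultimately show thesis using that cantor_copiesD(3)[OF l(1)] by blast
qed

section \<open>The topology of the homeomorphism group\<close>

definition cantor_maps :: "(cantor \<Rightarrow> cantor) metric" where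
  "cantor_maps = cfunspace euclidean cantor_metric"

lemma in_cantor_maps_iff: "f \<in> mspace cantor_maps \<longleftrightarrow> continuous_on UNIV f"
  unfolding cantor_maps_def
  by (subst compactin_mspace_cfunspace) (simp_all add: compact_cantor)

lemma mdist_cantor_maps_le:
  assumes "f \<in> mspace cantor_maps" "h \<in> mspace cantor_maps"
  shows "mdist cantor_maps f h \<le> r \<longleftrightarrow> (\<forall>x. cantor_dist (f x) (h x) \<le> r)"
  using cfunspace_mdist_le[of f euclidean cantor_metric h r] assms by (simp add: cantor_maps_def)

lemma level_eq_if_near:
  assumes "f \<in> mspace cantor_maps" "h \<in> mspace cantor_maps" "mdist cantor_maps f h < (1/2) ^ m"
  shows "level m (h x) = level m (f x)"
proof -
  have "cantor_dist (f x) (h x) \<le> mdist cantor_maps f h"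
    using mdist_cantor_maps_le[OF assms(1,2)] by blast
  then have "cantor_dist (f x) (h x) < (1/2) ^ m" using assms(3) by (rule le_less_trans)
  then show ?thesis by (simp add: cantor_dist_less_iff level_eq_iff)
qed

lemma near_if_level_eq:
  assumes "f \<in> mspace cantor_maps" "h \<in> mspace cantor_maps"
    and "\<And>x. level (Suc n) (h x) = level (Suc n) (f x)"
  shows "mdist cantor_maps f h \<le> (1/2) ^ n"
proof -
  have "cantor_dist (f x) (h x) < (1/2) ^ n" for x
    using assms(3)[of x] by (simp add: cantor_dist_less_iff level_eq_iff less_Suc_eq_le)
  then show ?thesis using mdist_cantor_maps_le[OF assms(1,2)] less_imp_le by blast
qed

text \<open>In terms of coordinates, the uniform topology is the topology of agreement up to some level,
  uniformly in the point.\<close>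

lemma openin_cantor_maps_iff:
  "openin (mtopology_of cantor_maps) U \<longleftrightarrow> U \<subseteq> mspace cantor_maps \<and>
     (\<forall>f\<in>U. \<exists>m. \<forall>h\<in>mspace cantor_maps. (\<forall>x. level m (h x) = level m (f x)) \<longrightarrow> h \<in> U)"
proof -
  interpret M: Metric_space "mspace cantor_maps" "mdist cantor_maps"
    by (rule Metric_space_mspace_mdist)
  have "(\<exists>r>0. M.mball f r \<subseteq> U) \<longleftrightarrow>
      (\<exists>m. \<forall>h\<in>mspace cantor_maps. (\<forall>x. level m (h x) = level m (f x)) \<longrightarrow> h \<in> U)"
    if f: "f \<in> mspace cantor_maps" for f
  proof
    assume "\<exists>r>0. M.mball f r \<subseteq> U"
    then obtain r where r: "r > 0" "M.mball f r \<subseteq> U" by blast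
    obtain n where n: "(1/2::real) ^ n < r" using real_arch_pow_inv[OF r(1), of "1/2"] by auto
    show "\<exists>m. \<forall>h\<in>mspace cantor_maps. (\<forall>x. level m (h x) = level m (f x)) \<longrightarrow> h \<in> U"
    proof (intro exI ballI impI)
      fix h assume h: "h \<in> mspace cantor_maps" "\<forall>x. level (Suc n) (h x) = level (Suc n) (f x)"
      have "mdist cantor_maps f h \<le> (1/2) ^ n"
        by (rule near_if_level_eq[OF f h(1)]) (rule h(2)[rule_format])
      then have "h \<in> M.mball f r" using n f h(1) by simp
      then show "h \<in> U" using r(2) by blast
    qed
  next
    assume "\<exists>m. \<forall>h\<in>mspace cantor_maps. (\<forall>x. level m (h x) = level m (f x)) \<longrightarrow> h \<in> U"
    then obtain m where m: "\<forall>h\<in>mspace cantor_maps. (\<forall>x. level m (h x) = level m (f x)) \<longrightarrow> h \<in> U" ..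
    have "M.mball f ((1/2)^m) \<subseteq> U"
    proof
      fix h assume "h \<in> M.mball f ((1/2)^m)"
      then have h: "h \<in> mspace cantor_maps" "mdist cantor_maps f h < (1/2)^m" by simp_all
      show "h \<in> U" by (rule m[rule_format, OF h(1)]) (rule level_eq_if_near[OF f h])
    qed
    then show "\<exists>r>0. M.mball f r \<subseteq> U" by (intro exI[of _ "(1/2)^m"]) simp
  qed
  then show ?thesis
    unfolding mtopology_of_def M.openin_mtopology by blast
qed

lemma homeo_topology_alt:
  "homeo_topology = subtopology (mtopology_of cantor_maps) (carrier homeo_group)"
  by (simp add: homeo_topology_def cantor_maps_def)

lemma openin_homeo_level:
  "openin homeo_topology {h \<in> carrier homeo_group. \<forall>x. level m (h x) = level m (f x)}"
proof -
  define U where "U = {h \<in> mspace cantor_maps. \<forall>x. level m (h x) = level m (f x)}"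
  have "openin (mtopology_of cantor_maps) U"
    unfolding openin_cantor_maps_iff
  proof (intro conjI ballI exI impI)
    fix h k assume "h \<in> U" "k \<in> mspace cantor_maps" "\<forall>x. level m (k x) = level m (h x)"
    then show "k \<in> U" by (simp add: U_def)
  qed (auto simp: U_def)
  moreover have "{h \<in> carrier homeo_group. \<forall>x. level m (h x) = level m (f x)} = U \<inter> carrier homeo_group"
    by (auto simp: U_def in_cantor_maps_iff homeo_group_iff)
  ultimately show ?thesis
    unfolding homeo_topology_alt openin_subtopology by blast
qed

lemma openin_homeo_imp_level:
  assumes "openin homeo_topology U" "f \<in> U"
  shows "\<exists>m. \<forall>h\<in>carrier homeo_group. (\<forall>x. level m (h x) = level m (f x)) \<longrightarrow> h \<in> U"
proof -
  obtain T where T: "openin (mtopology_of cantor_maps) T" "U = T \<inter> carrier homeo_group"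
    using assms(1) unfolding homeo_topology_alt openin_subtopology by blast
  then obtain m where m: "\<forall>h\<in>mspace cantor_maps. (\<forall>x. level m (h x) = level m (f x)) \<longrightarrow> h \<in> T"
    using assms(2) unfolding openin_cantor_maps_iff by (elim conjE ballE[of _ _ f]) auto
  show ?thesis
  proof (intro exI ballI impI)
    fix h assume h: "h \<in> carrier homeo_group" "\<forall>x. level m (h x) = level m (f x)"
    then have "h \<in> mspace cantor_maps" by (simp add: in_cantor_maps_iff homeo_group_iff)
    then have "h \<in> T" by (rule m[rule_format]) (rule h(2)[rule_format])
    then show "h \<in> U" using h(1) T(2) by blast
  qed
qed

lemma mcomplete_cantor: "mcomplete_of cantor_metric"
proof -
  interpret Metric_space "UNIV :: cantor set" cantor_dist by (rule Metric_space_cantor)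
  have "mtopology = euclidean"
    using mtopology_of_cantor_metric by (simp add: mtopology_of_def)
  then have "compact_space mtopology"
    using compact_cantor by (simp add: compact_space_def)
  then have "mcomplete" by (rule compact_space_imp_mcomplete)
  then show ?thesis by (simp add: mcomplete_of_def)
qed

lemma completely_metrizable_cantor_maps: "completely_metrizable_space (mtopology_of cantor_maps)"
proof -
  interpret Metric_space "UNIV :: cantor set" cantor_dist by (rule Metric_space_cantor)
  have "mcomplete" using mcomplete_cantor by (simp add: mcomplete_of_def)
  then have "mcomplete_of cantor_maps"
    using mcomplete_cfunspace[of euclidean] by (simp add: cantor_maps_def cantor_metric_def Self_def)
  then show ?thesis
    unfolding mtopology_of_def mcomplete_of_def
    by (rule Metric_space.completely_metrizable_space_mtopology[OF Metric_space_mspace_mdist])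
qed

lemma cantor_eqI: "(\<And>m. level m x = level m y) \<Longrightarrow> x = y"
  by (rule ext) (meson level_eq_iff lessI)

lemma homeo_inverse:
  assumes "f \<in> carrier homeo_group"
  obtains g where "g \<in> carrier homeo_group" "\<And>x. g (f x) = x" "\<And>x. f (g x) = x"
proof -
  interpret group homeo_group by (rule group_homeo_group)
  have "inv\<^bsub>homeo_group\<^esub> f \<in> carrier homeo_group" using assms by simp
  moreover have "inv\<^bsub>homeo_group\<^esub> f \<circ> f = id" "f \<circ> inv\<^bsub>homeo_group\<^esub> f = id"
    using l_inv[OF assms] r_inv[OF assms] by (simp_all add: homeo_group_def)
  ultimately show thesis using that by (metis comp_apply id_apply)
qed

text \<open>The homeomorphisms form a \<open>G\<^sub>\<delta>\<close> set in the complete space of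
  continuous maps, described by the open conditions \<open>S m\<close> (the image meets all
  cylinders of depth \<open>m\<close>) and \<open>N m\<close> (the first \<open>m\<close>
  coordinates of a point can be read off from finitely many coordinates of its image).\<close>

lemma completely_metrizable_homeo_topology: "completely_metrizable_space homeo_topology"
proof -
  let ?X = "mtopology_of cantor_maps"
  define S where "S m = {f \<in> mspace cantor_maps. \<forall>v. \<exists>x. level m (f x) = level m v}" for m
  define N where "N m = {f \<in> mspace cantor_maps. \<exists>k. \<forall>x y. level k (f x) = level k (f y) \<longrightarrow> level m x = level m y}" for m
  have "openin ?X (S m)" for m
    unfolding openin_cantor_maps_iff
  proof (intro conjI ballI exI impI)
    fix f h assume "f \<in> S m" "h \<in> mspace cantor_maps" "\<forall>x. level m (h x) = level m (f x)"
    then show "h \<in> S m" by (simp add: S_def)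
  qed (auto simp: S_def)
  moreover have "openin ?X (N m)" for m
    unfolding openin_cantor_maps_iff
  proof (intro conjI ballI)
    fix f assume "f \<in> N m"
    then obtain k where k: "\<forall>x y. level k (f x) = level k (f y) \<longrightarrow> level m x = level m y"
      unfolding N_def by (elim CollectE conjE exE)
    show "\<exists>j. \<forall>h\<in>mspace cantor_maps. (\<forall>x. level j (h x) = level j (f x)) \<longrightarrow> h \<in> N m"
    proof (intro exI ballI impI)
      fix h assume h: "h \<in> mspace cantor_maps" and eq: "\<forall>x. level k (h x) = level k (f x)"
      have "\<forall>x y. level k (h x) = level k (h y) \<longrightarrow> level m x = level m y"
        using k unfolding eq[rule_format] .
      then show "h \<in> N m" using h unfolding N_def by (intro CollectI conjI exI[of _ k])
    qed
  qed (auto simp: N_def)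
  ultimately have "gdelta_in ?X ((\<Inter>m. S m) \<inter> (\<Inter>m. N m))"
    by (intro gdelta_in_Int gdelta_in_Inter) (auto intro: open_imp_gdelta_in)
  moreover have "(\<Inter>m. S m) \<inter> (\<Inter>m. N m) = carrier homeo_group"
  proof (intro subset_antisym subsetI)
    fix f assume f: "f \<in> (\<Inter>m. S m) \<inter> (\<Inter>m. N m)"
    then have cont: "continuous_on UNIV f" by (auto simp: S_def in_cantor_maps_iff)
    have "x = y" if "f x = f y" for x y
    proof (rule cantor_eqI)
      fix m
      have "f \<in> N m" using f by blast
      then obtain k where k: "\<forall>x y. level k (f x) = level k (f y) \<longrightarrow> level m x = level m y"
        unfolding N_def by (elim CollectE conjE exE)
      show "level m x = level m y" by (rule k[rule_format]) (simp only: that)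
    qed
    then have "inj f" by (rule injI)
    moreover have "\<exists>x. f x = v" for v
    proof -
      have "\<exists>x. \<forall>m. x \<in> {x. level m (f x) = level m v}"
      proof (rule cantor_nested_nonempty)
        show "closed {x. level m (f x) = level m v}" for m
          by (rule closed_label_eq, rule label_continuous[OF label_level cont])
        show "{x. level m (f x) = level m v} \<noteq> {}" for m
          using f by (auto simp: S_def)
        show "{x. level (Suc m) (f x) = level (Suc m) v} \<subseteq> {x. level m (f x) = level m v}" for m
          by (intro subsetI CollectI, elim CollectE) (rule level_mono[OF _ le_SucI[OF order_refl]])
      qed
      then obtain x where x: "\<forall>m. x \<in> {x. level m (f x) = level m v}" ..
      have "f x = v" by (rule cantor_eqI) (rule CollectD[OF x[rule_format]])
      then show ?thesis by (intro exI[of _ x])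
    qed
    then have "surj f" unfolding surj_def by metis
    ultimately show "f \<in> carrier homeo_group" using cont by (simp add: homeo_group_iff bij_def)
  next
    fix f assume fH: "f \<in> carrier homeo_group"
    obtain g where g: "g \<in> carrier homeo_group" "\<And>x. g (f x) = x" "\<And>x. f (g x) = x"
      using homeo_inverse[OF fH] by blast
    have f: "bij f" "continuous_on UNIV f"
      using fH by (simp_all add: homeo_group_iff)
    have "f \<in> S m" for m
    proof -
      have "\<exists>x. level m (f x) = level m v" for v by (rule exI[of _ "g v"]) (simp only: g(3))
      then show ?thesis using f(2) by (simp add: S_def in_cantor_maps_iff)
    qed
    moreover have "f \<in> N m" for m
    proof -
      have "label (\<lambda>y. level m (g y))"
        using g(1) by (simp add: homeo_group_iff continuous_iff_label)
      then obtain k where k: "\<forall>x y. level k x = level k y \<longrightarrow> level m (g x) = level m (g y)"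
        by (rule labelE)
      have "level m x = level m y" if "level k (f x) = level k (f y)" for x y
        using k[rule_format, OF that] by (simp only: g(2))
      then show ?thesis
        unfolding N_def in_cantor_maps_iff using f(2) by (intro CollectI conjI exI allI impI)
    qed
    ultimately show "f \<in> (\<Inter>m. S m) \<inter> (\<Inter>m. N m)" by blast
  qed
  ultimately show ?thesis
    using completely_metrizable_space_gdelta_in[OF completely_metrizable_cantor_maps]
    by (simp add: homeo_topology_alt)
qed

section \<open>Comeager sets from dense open sets\<close>

lemma comeager_in_superset:
  assumes \<W>: "countable \<W>" "\<And>W. W \<in> \<W> \<Longrightarrow> openin X W \<and> X closure_of W = topspace X"
    and S: "S \<subseteq> topspace X" "\<And>x. x \<in> topspace X \<Longrightarrow> (\<And>W. W \<in> \<W> \<Longrightarrow> x \<in> W) \<Longrightarrow> x \<in> S"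
  shows "comeager_in X S"
proof -
  define \<F> where "\<F> = (\<lambda>W. (topspace X - W) \<inter> (topspace X - S)) ` \<W>"
  have "nowhere_dense_in X A" if A: "A \<in> \<F>" for A
  proof -
    obtain W where W: "W \<in> \<W>" "A = (topspace X - W) \<inter> (topspace X - S)" using A by (auto simp: \<F>_def)
    have "X closure_of A \<subseteq> topspace X - W"
      using \<W>(2)[OF W(1)] W(2) by (intro closure_of_minimal) auto
    then have "X interior_of (X closure_of A) \<subseteq> X interior_of (topspace X - W)"
      by (rule interior_of_mono)
    then show ?thesis
      using \<W>(2)[OF W(1)] W(2) by (auto simp: nowhere_dense_in_def interior_of_complement)
  qed
  moreover have "topspace X - S = \<Union>\<F>" using S(2) unfolding \<F>_def by blast
  moreover have "countable \<F>" using \<W>(1) by (simp add: \<F>_def)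
  ultimately show ?thesis using S(1) unfolding comeager_in_def meager_in_def by blast
qed

section \<open>The space of actions\<close>

lemma action_homeo:
  assumes "\<alpha> \<in> actions G" "g \<in> carrier G" shows "\<alpha> g \<in> carrier homeo_group"
  using assms by (auto simp: actions_def hom_def)

lemma action_mult:
  assumes "\<alpha> \<in> actions G" "g \<in> carrier G" "h \<in> carrier G"
  shows "\<alpha> (g \<otimes>\<^bsub>G\<^esub> h) x = \<alpha> g (\<alpha> h x)"
  using assms by (auto simp: actions_def hom_def homeo_group_def)

lemma (in group) action_one:
  assumes "\<alpha> \<in> actions G" shows "\<alpha> \<one> x = x"
proof -
  interpret group_hom G homeo_group \<alpha>
    using assms by (auto simp: group_hom_def group_hom_axioms_def group_homeo_group actions_def is_group)
  show ?thesis using hom_one by (simp add: homeo_group_def)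
qed

lemma action_continuous:
  assumes "\<alpha> \<in> actions G" "g \<in> carrier G" shows "continuous_on UNIV (\<alpha> g)"
  using action_homeo[OF assms] by (simp add: homeo_group_iff)

abbreviation (input) homeo_power :: "('g, 'b) monoid_scheme \<Rightarrow> ('g \<Rightarrow> cantor \<Rightarrow> cantor) topology" where
  "homeo_power G \<equiv> product_topology (\<lambda>_. homeo_topology) (carrier G)"

lemma openin_homeo_power_level:
  assumes "g \<in> carrier G"
  shows "openin (homeo_power G) {\<alpha> \<in> topspace (homeo_power G). \<forall>x. level m (\<alpha> g x) = level m (f x)}"
proof -
  have "openin (homeo_power G) {\<alpha> \<in> topspace (homeo_power G).
      \<alpha> g \<in> {h \<in> carrier homeo_group. \<forall>x. level m (h x) = level m (f x)}}"
    by (rule openin_continuous_map_preimage[where Y = homeo_topology],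
        rule continuous_map_product_projection[OF assms], rule openin_homeo_level)
  moreover have "{\<alpha> \<in> topspace (homeo_power G). \<alpha> g \<in> {h \<in> carrier homeo_group. \<forall>x. level m (h x) = level m (f x)}}
     = {\<alpha> \<in> topspace (homeo_power G). \<forall>x. level m (\<alpha> g x) = level m (f x)}"
    using assms by auto
  ultimately show ?thesis by simp
qed

lemma openin_action_level:
  assumes "g \<in> carrier G"
  shows "openin (action_topology G) {\<alpha> \<in> actions G. \<forall>x. level m (\<alpha> g x) = level m (f x)}"
proof -
  have "actions G \<subseteq> topspace (homeo_power G)"
    by (auto simp: actions_def PiE_def hom_def)
  then have eq: "{\<alpha> \<in> actions G. \<forall>x. level m (\<alpha> g x) = level m (f x)} =
      {\<alpha> \<in> topspace (homeo_power G). \<forall>x. level m (\<alpha> g x) = level m (f x)} \<inter> actions G"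
    by blast
  show ?thesis
    unfolding action_topology_def eq
    by (rule openin_subtopology_Int[OF openin_homeo_power_level[OF assms]])
qed

text \<open>A basic neighbourhood of an action restricts finitely many group elements, each to finite
  precision; a maximum makes the precision common to all of them.\<close>

lemma openin_action_imp_level:
  assumes U: "openin (action_topology G) U" "\<alpha> \<in> U"
  obtains F m where "finite F" "F \<subseteq> carrier G"
    "\<And>\<beta>. \<beta> \<in> actions G \<Longrightarrow> (\<And>g x. g \<in> F \<Longrightarrow> level m (\<beta> g x) = level m (\<alpha> g x)) \<Longrightarrow> \<beta> \<in> U"
proof -
  obtain T where T: "openin (homeo_power G) T" "U = T \<inter> actions G"
    using U(1) unfolding action_topology_def openin_subtopology by blast
  then have "\<exists>V. finite {g \<in> carrier G. V g \<noteq> topspace homeo_topology} \<and>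
      (\<forall>g\<in>carrier G. openin homeo_topology (V g)) \<and> \<alpha> \<in> Pi\<^sub>E (carrier G) V \<and> Pi\<^sub>E (carrier G) V \<subseteq> T"
    using U(2) unfolding openin_product_topology_alt by blast
  then obtain V where V: "finite {g \<in> carrier G. V g \<noteq> carrier homeo_group}"
      "\<And>g. g \<in> carrier G \<Longrightarrow> openin homeo_topology (V g)" "\<alpha> \<in> Pi\<^sub>E (carrier G) V" "Pi\<^sub>E (carrier G) V \<subseteq> T"
    by auto
  define F where "F = {g \<in> carrier G. V g \<noteq> carrier homeo_group}"
  have "\<exists>m. \<forall>h\<in>carrier homeo_group. (\<forall>x. level m (h x) = level m (\<alpha> g x)) \<longrightarrow> h \<in> V g" if "g \<in> F" for g
    by (rule openin_homeo_imp_level) (use that V(2,3) in \<open>auto simp: F_def\<close>)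
  then have "\<exists>M. \<forall>g\<in>F. \<forall>h\<in>carrier homeo_group. (\<forall>x. level (M g) (h x) = level (M g) (\<alpha> g x)) \<longrightarrow> h \<in> V g"
    by (intro bchoice ballI)
  then obtain M where M: "\<forall>g\<in>F. \<forall>h\<in>carrier homeo_group.
      (\<forall>x. level (M g) (h x) = level (M g) (\<alpha> g x)) \<longrightarrow> h \<in> V g" ..
  \<comment> \<open>for empty \<open>F\<close> the maximum is arbitrary, and so is the precision\<close>
  define m where "m = Max (M ` F)"
  have Mm: "M g \<le> m" if "g \<in> F" for g
    unfolding m_def using that V(1) by (intro Max_ge) (auto simp: F_def)
  show thesis
  proof (rule that)
    show "finite F" "F \<subseteq> carrier G" using V(1) by (auto simp: F_def)
    fix \<beta> assume \<beta>: "\<beta> \<in> actions G" and near: "\<And>g x. g \<in> F \<Longrightarrow> level m (\<beta> g x) = level m (\<alpha> g x)"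
    have "\<beta> g \<in> V g" if g: "g \<in> carrier G" for g
    proof (cases "g \<in> F")
      case True
      show ?thesis
        by (rule M[rule_format, OF True action_homeo[OF \<beta> g]])
           (rule level_mono[OF near[OF True] Mm[OF True]])
    next
      case False
      then show ?thesis using action_homeo[OF \<beta> g] g by (simp add: F_def)
    qed
    then have "\<beta> \<in> Pi\<^sub>E (carrier G) V" using \<beta> by (auto simp: actions_def PiE_iff)
    then show "\<beta> \<in> U" using V(4) T(2) \<beta> by blast
  qed
qed

text \<open>If the homomorphism law fails for a family of homeomorphisms, it fails at a point and in some
  coordinate, and it keeps failing there for all nearby families.\<close>

lemma (in group) closedin_actions: "closedin (homeo_power G) (actions G)"
proof -
  let ?P = "homeo_power G"
  have top: "topspace ?P = carrier G \<rightarrow>\<^sub>E carrier homeo_group" by simp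
  define D where "D g h x m = {\<alpha> \<in> topspace ?P. level m (\<alpha> (g \<otimes> h) x) \<noteq> level m (\<alpha> g (\<alpha> h x))}" for g h x m
  have "openin ?P (D g h x m)" if gh: "g \<in> carrier G" "h \<in> carrier G" for g h x m
  proof (subst openin_subopen, intro ballI)
    fix \<alpha> assume \<alpha>: "\<alpha> \<in> D g h x m"
    then have "continuous_on UNIV (\<alpha> g)" using gh by (auto simp: D_def homeo_group_iff PiE_iff)
    then have "label (\<lambda>x. level m (\<alpha> g x))" by (simp add: continuous_iff_label)
    then obtain k where k: "\<forall>x y. level k x = level k y \<longrightarrow> level m (\<alpha> g x) = level m (\<alpha> g y)"
      by (rule labelE)
    define N where "N j g = {\<beta> \<in> topspace ?P. \<forall>x. level j (\<beta> g x) = level j (\<alpha> g x)}" for j g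
    have "openin ?P (N m (g \<otimes> h) \<inter> N m g \<inter> N k h)"
      unfolding N_def using gh by (intro openin_Int openin_homeo_power_level) auto
    moreover have "\<alpha> \<in> N m (g \<otimes> h) \<inter> N m g \<inter> N k h" using \<alpha> by (auto simp: N_def D_def)
    moreover have "N m (g \<otimes> h) \<inter> N m g \<inter> N k h \<subseteq> D g h x m"
    proof
      fix \<beta> assume \<beta>: "\<beta> \<in> N m (g \<otimes> h) \<inter> N m g \<inter> N k h"
      then have "level m (\<beta> g (\<beta> h x)) = level m (\<alpha> g (\<beta> h x))" "level k (\<beta> h x) = level k (\<alpha> h x)"
        "level m (\<beta> (g \<otimes> h) x) = level m (\<alpha> (g \<otimes> h) x)"
        by (auto simp: N_def)
      then show "\<beta> \<in> D g h x m" using k[rule_format, of "\<beta> h x" "\<alpha> h x"] \<alpha> \<beta> by (simp add: D_def N_def)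
    qed
    ultimately show "\<exists>T. openin ?P T \<and> \<alpha> \<in> T \<and> T \<subseteq> D g h x m" by blast
  qed
  then have "openin ?P (\<Union>g\<in>carrier G. \<Union>h\<in>carrier G. \<Union>x. \<Union>m. D g h x m)"
    by (intro openin_Union) (auto intro!: openin_Union)
  moreover have "topspace ?P - actions G = (\<Union>g\<in>carrier G. \<Union>h\<in>carrier G. \<Union>x. \<Union>m. D g h x m)"
  proof (intro subset_antisym subsetI)
    fix \<alpha> assume \<alpha>: "\<alpha> \<in> topspace ?P - actions G"
    then have "\<alpha> \<notin> hom G homeo_group" by (auto simp: actions_def PiE_iff)
    moreover have "f \<otimes>\<^bsub>homeo_group\<^esub> h = f \<circ> h" for f h by (simp add: homeo_group_def)
    ultimately obtain g h where gh: "g \<in> carrier G" "h \<in> carrier G" "\<alpha> (g \<otimes> h) \<noteq> \<alpha> g \<circ> \<alpha> h"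
      using \<alpha> by (auto simp: hom_def PiE_iff)
    then obtain x where "\<alpha> (g \<otimes> h) x \<noteq> \<alpha> g (\<alpha> h x)" by (auto simp: fun_eq_iff)
    then obtain m where "level m (\<alpha> (g \<otimes> h) x) \<noteq> level m (\<alpha> g (\<alpha> h x))" using cantor_eqI by blast
    then show "\<alpha> \<in> (\<Union>g\<in>carrier G. \<Union>h\<in>carrier G. \<Union>x. \<Union>m. D g h x m)"
      using gh \<alpha> unfolding D_def by blast
  next
    fix \<alpha> assume "\<alpha> \<in> (\<Union>g\<in>carrier G. \<Union>h\<in>carrier G. \<Union>x. \<Union>m. D g h x m)"
    then obtain g h x m where "g \<in> carrier G" "h \<in> carrier G" "\<alpha> \<in> D g h x m" by blast
    then show "\<alpha> \<in> topspace ?P - actions G" using action_mult[of \<alpha> G g h x] by (auto simp: D_def)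
  qed
  moreover have "actions G \<subseteq> topspace ?P" by (auto simp: actions_def PiE_def hom_def)
  ultimately show ?thesis by (simp add: closedin_def)
qed

lemma (in group) completely_metrizable_action_topology:
  assumes "countable (carrier G)"
  shows "completely_metrizable_space (action_topology G)"
  unfolding action_topology_def
proof (rule completely_metrizable_space_closedin[OF _ closedin_actions])
  have "countable {g \<in> carrier G. \<not> (\<exists>a. topspace homeo_topology \<subseteq> {a})}"
    by (rule countable_subset[OF _ assms]) auto
  then show "completely_metrizable_space (homeo_power G)"
    using completely_metrizable_homeo_topology
    by (simp add: completely_metrizable_space_product_topology)
qed

lemma (in group) trivial_action: "(\<lambda>g\<in>carrier G. id) \<in> actions G"
  by (auto simp: actions_def hom_def homeo_group_def)

section \<open>Windows and patterns\<close>

text \<open>A window is a finite set of group elements containing the identity, through which the orbit of a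
  point is observed. Observed from the point \<open>k x\<close> instead of \<open>x\<close>, the
  window \<open>K d\<close> becomes the translate of \<open>K d\<close> by \<open>inv k\<close>,
  which is again a window and has the name \<open>opp d k\<close>. A finite subgroup is a window
  that looks the same from each of its members. An edge \<open>{\<one>, s}\<close>, observed
  from its other end, is \<open>{\<one>, inv s}\<close>.

  The windows at a point are the directions in which one can leave it; the opposite direction
  \<open>opp d k\<close> leads back. For a free product of finite and cyclic groups the windows
  are the edges of a tree-like (hyper)graph on the group.\<close>

locale window_system = group G for G (structure) +
  fixes T :: "nat set" and K :: "nat \<Rightarrow> 'a set" and opp :: "nat \<Rightarrow> 'a \<Rightarrow> nat"
  assumes countable_carrier: "countable (carrier G)"
    and T_finite: "finite T" and T_nonempty: "T \<noteq> {}"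
    and K_finite: "d \<in> T \<Longrightarrow> finite (K d)"
    and K_carrier: "d \<in> T \<Longrightarrow> k \<in> K d \<Longrightarrow> k \<in> carrier G"
    and one_in_K: "d \<in> T \<Longrightarrow> \<one> \<in> K d"
    and opp_in_T: "d \<in> T \<Longrightarrow> k \<in> K d \<Longrightarrow> opp d k \<in> T"
    and K_opp: "d \<in> T \<Longrightarrow> k \<in> K d \<Longrightarrow> K (opp d k) = (\<lambda>h. h \<otimes> inv k) ` K d"
    and opp_opp: "d \<in> T \<Longrightarrow> k \<in> K d \<Longrightarrow> h \<in> K d \<Longrightarrow> opp (opp d k) (h \<otimes> inv k) = opp d h"
    and opp_one: "d \<in> T \<Longrightarrow> opp d \<one> = d"
    and generation: "Y \<subseteq> carrier G \<Longrightarrow> \<one> \<in> Y \<Longrightarrow>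
      (\<And>d k g. d \<in> T \<Longrightarrow> k \<in> K d \<Longrightarrow> g \<in> Y \<Longrightarrow> k \<otimes> g \<in> Y) \<Longrightarrow> Y = carrier G"
begin

lemma div_in_K_opp: "d \<in> T \<Longrightarrow> k \<in> K d \<Longrightarrow> h \<in> K d \<Longrightarrow> h \<otimes> inv k \<in> K (opp d k)"
  by (simp add: K_opp)

lemma inv_in_K_opp: "d \<in> T \<Longrightarrow> k \<in> K d \<Longrightarrow> inv k \<in> K (opp d k)"
  using div_in_K_opp[of d k \<one>] by (simp add: one_in_K K_carrier)

lemma opp_opp_inv: "d \<in> T \<Longrightarrow> k \<in> K d \<Longrightarrow> opp (opp d k) (inv k) = d"
  using opp_opp[of d k \<one>] by (simp add: one_in_K K_carrier opp_one)

text \<open>Moving by \<open>k\<close> and then by \<open>h\<close> within one window is the single move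
  \<open>h \<otimes> k\<close> of that window.\<close>

lemma mult_in_K:
  assumes "d \<in> T" "k \<in> K d" "h \<in> K (opp d k)"
  shows "h \<otimes> k \<in> K d" "opp (opp d k) h = opp d (h \<otimes> k)"
proof -
  obtain h' where h': "h' \<in> K d" "h = h' \<otimes> inv k" using assms by (auto simp: K_opp)
  have "h \<otimes> k = h'" using h' assms K_carrier by (simp add: m_assoc)
  then show "h \<otimes> k \<in> K d" "opp (opp d k) h = opp d (h \<otimes> k)"
    using h' assms opp_opp by auto
qed

text \<open>The pattern \<open>P\<close> as it is observed from its member \<open>k\<close>.\<close>

definition shift :: "nat \<Rightarrow> 'a \<Rightarrow> ('a \<Rightarrow> nat) \<Rightarrow> 'a \<Rightarrow> nat" where
  "shift d k P = (\<lambda>h\<in>K (opp d k). P (h \<otimes> k))"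

lemma shift_apply: "h \<in> K (opp d k) \<Longrightarrow> shift d k P h = P (h \<otimes> k)"
  by (simp add: shift_def)

lemma shift_extensional: "shift d k P \<in> extensional (K (opp d k))"
  by (simp add: shift_def)

lemma shift_one: "d \<in> T \<Longrightarrow> P \<in> extensional (K d) \<Longrightarrow> shift d \<one> P = P"
  by (rule extensionalityI[of _ "K d"]) (auto simp: shift_def opp_one K_carrier)

lemma shift_shift:
  assumes "d \<in> T" "k \<in> K d" "h \<in> K d"
  shows "shift (opp d k) (h \<otimes> inv k) (shift d k P) = shift d h P"
proof -
  have "(h' \<otimes> (h \<otimes> inv k)) \<otimes> k = h' \<otimes> h" "h' \<otimes> (h \<otimes> inv k) \<in> K (opp d k)" if h': "h' \<in> K (opp d h)" for h'
  proof -
    have c: "h' \<in> carrier G" "h \<in> carrier G" "k \<in> carrier G"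
      using assms h' K_carrier opp_in_T by blast+
    show "(h' \<otimes> (h \<otimes> inv k)) \<otimes> k = h' \<otimes> h" using c by (simp add: m_assoc)
    have "h' \<otimes> h \<in> K d" using mult_in_K(1) assms h' by blast
    then have "(h' \<otimes> h) \<otimes> inv k \<in> K (opp d k)" using assms by (intro div_in_K_opp)
    then show "h' \<otimes> (h \<otimes> inv k) \<in> K (opp d k)" using c by (simp add: m_assoc)
  qed
  then show ?thesis using assms by (auto simp: shift_def opp_opp fun_eq_iff restrict_def)
qed

lemma shift_unshift:
  assumes "d \<in> T" "k \<in> K d" "P \<in> extensional (K d)"
  shows "shift (opp d k) (inv k) (shift d k P) = P"
  using shift_shift[of d k \<one> P] assms by (simp add: one_in_K K_carrier shift_one)

text \<open>The pattern sets of a labeled action always have these properties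
  (\<open>consistent_patterns\<close>): they do not depend on the member from which a window is
  observed, and every vertex label is visible in every window. Families are taken to be
  undefined outside \<open>T\<close>, which makes equality of families a plain equation.\<close>

definition consistent :: "(nat \<Rightarrow> ('a \<Rightarrow> nat) set) \<Rightarrow> nat set \<Rightarrow> bool" where
  "consistent E V \<longleftrightarrow> E \<in> extensional T \<and> (\<forall>d\<in>T. E d \<subseteq> extensional (K d) \<and>
     (\<forall>P\<in>E d. \<forall>k\<in>K d. shift d k P \<in> E (opp d k)) \<and> (\<lambda>P. P \<one>) ` E d = V)"

lemma consistentI:
  assumes "E \<in> extensional T" "\<And>d P. d \<in> T \<Longrightarrow> P \<in> E d \<Longrightarrow> P \<in> extensional (K d)"
    and "\<And>d P k. d \<in> T \<Longrightarrow> P \<in> E d \<Longrightarrow> k \<in> K d \<Longrightarrow> shift d k P \<in> E (opp d k)"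
    and "\<And>d. d \<in> T \<Longrightarrow> (\<lambda>P. P \<one>) ` E d = V"
  shows "consistent E V"
  using assms unfolding consistent_def by blast

lemma consistentD:
  assumes "consistent E V" "d \<in> T"
  shows "E \<in> extensional T" "P \<in> E d \<Longrightarrow> P \<in> extensional (K d)"
    and "P \<in> E d \<Longrightarrow> k \<in> K d \<Longrightarrow> shift d k P \<in> E (opp d k)" "(\<lambda>P. P \<one>) ` E d = V"
  using assms unfolding consistent_def by blast+

lemma consistent_value:
  assumes "consistent E V" "d \<in> T" "P \<in> E d" "k \<in> K d"
  shows "P k \<in> V"
proof -
  have "shift d k P \<in> E (opp d k)" "opp d k \<in> T"
    using consistentD(3)[OF assms(1,2)] assms opp_in_T by blast+
  then have "shift d k P \<one> \<in> V" using consistentD(4)[OF assms(1)] by blast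
  then show ?thesis using assms K_carrier by (simp add: shift_apply one_in_K opp_in_T)
qed

definition pattern :: "('a \<Rightarrow> cantor \<Rightarrow> cantor) \<Rightarrow> (cantor \<Rightarrow> nat) \<Rightarrow> nat \<Rightarrow> cantor \<Rightarrow> 'a \<Rightarrow> nat" where
  "pattern \<alpha> p d x = (\<lambda>k\<in>K d. p (\<alpha> k x))"

definition patterns :: "('a \<Rightarrow> cantor \<Rightarrow> cantor) \<Rightarrow> (cantor \<Rightarrow> nat) \<Rightarrow> nat \<Rightarrow> ('a \<Rightarrow> nat) set" where
  "patterns \<alpha> p = (\<lambda>d\<in>T. range (pattern \<alpha> p d))"

lemma patterns_apply: "d \<in> T \<Longrightarrow> patterns \<alpha> p d = range (pattern \<alpha> p d)"
  by (simp add: patterns_def)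

lemma patterns_mem: "d \<in> T \<Longrightarrow> pattern \<alpha> p d x \<in> patterns \<alpha> p d"
  by (simp add: patterns_def)

lemma pattern_apply: "k \<in> K d \<Longrightarrow> pattern \<alpha> p d x k = p (\<alpha> k x)"
  by (simp add: pattern_def)

lemma pattern_one: "\<alpha> \<in> actions G \<Longrightarrow> d \<in> T \<Longrightarrow> pattern \<alpha> p d x \<one> = p x"
  by (simp add: pattern_def one_in_K action_one)

lemma shift_pattern:
  assumes "\<alpha> \<in> actions G" "d \<in> T" "k \<in> K d"
  shows "shift d k (pattern \<alpha> p d x) = pattern \<alpha> p (opp d k) (\<alpha> k x)"
proof -
  have "p (\<alpha> (h \<otimes> k) x) = p (\<alpha> h (\<alpha> k x))" "h \<otimes> k \<in> K d" if "h \<in> K (opp d k)" for h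
  proof -
    have "h \<in> carrier G" "k \<in> carrier G" using assms that K_carrier opp_in_T by blast+
    then show "p (\<alpha> (h \<otimes> k) x) = p (\<alpha> h (\<alpha> k x))" using action_mult[OF assms(1)] by simp
    show "h \<otimes> k \<in> K d" using assms that by (intro mult_in_K(1))
  qed
  then show ?thesis by (simp add: shift_def pattern_def restrict_def fun_eq_iff)
qed

lemma consistent_patterns:
  assumes "\<alpha> \<in> actions G" shows "consistent (patterns \<alpha> p) (range p)"
proof (rule consistentI)
  fix d P k assume "d \<in> T" "P \<in> patterns \<alpha> p d" "k \<in> K d"
  then show "shift d k P \<in> patterns \<alpha> p (opp d k)"
    by (auto simp: patterns_apply shift_pattern[OF assms] opp_in_T)
next
  fix d assume "d \<in> T"
  then have "(\<lambda>P. P \<one>) ` patterns \<alpha> p d = range (\<lambda>x. pattern \<alpha> p d x \<one>)"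
    by (simp add: patterns_apply image_image)
  then show "(\<lambda>P. P \<one>) ` patterns \<alpha> p d = range p"
    using \<open>d \<in> T\<close> by (simp add: pattern_one[OF assms])
qed (auto simp: patterns_def pattern_def)

definition map_patterns :: "(nat \<Rightarrow> nat) \<Rightarrow> (nat \<Rightarrow> ('a \<Rightarrow> nat) set) \<Rightarrow> nat \<Rightarrow> ('a \<Rightarrow> nat) set" where
  "map_patterns f E = (\<lambda>d\<in>T. (\<lambda>P. \<lambda>k\<in>K d. f (P k)) ` E d)"

lemma map_patterns_patterns: "map_patterns f (patterns \<alpha> p) = patterns \<alpha> (\<lambda>x. f (p x))"
proof -
  have eq: "(\<lambda>k\<in>K d. f (pattern \<alpha> p d x k)) = pattern \<alpha> (\<lambda>x. f (p x)) d x" for d x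
    by (rule extensionalityI[of _ "K d"]) (simp_all add: pattern_def)
  show ?thesis
    by (rule extensionalityI[of _ T]) (simp_all add: map_patterns_def patterns_def image_image eq)
qed

text \<open>The patterns seen through single windows then determine the whole subshift of itineraries: the
  two labeled actions can be exchanged, so the inclusion stated here is an equality.\<close>

definition rigid :: "(nat \<Rightarrow> ('a \<Rightarrow> nat) set) \<Rightarrow> bool" where
  "rigid E \<longleftrightarrow> (\<forall>\<alpha>\<in>actions G. \<forall>\<beta>\<in>actions G. \<forall>p q. label p \<longrightarrow> label q \<longrightarrow>
     patterns \<alpha> p = E \<longrightarrow> patterns \<beta> q = E \<longrightarrow>
     (\<forall>x. \<exists>y. \<forall>g\<in>carrier G. q (\<beta> g y) = p (\<alpha> g x)))"

lemma rigidD: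
  assumes "rigid E" "\<alpha> \<in> actions G" "\<beta> \<in> actions G" "label p" "label q"
    and "patterns \<alpha> p = E" "patterns \<beta> q = E"
  shows "\<exists>y. \<forall>g\<in>carrier G. q (\<beta> g y) = p (\<alpha> g x)"
  using assms(1)[unfolded rigid_def, rule_format, OF assms(2-)] .

section \<open>Rooted patterns\<close>

text \<open>A fixed choice of continuation in direction \<open>d\<close> for a vertex labeled
  \<open>a\<close>.\<close>

definition branch :: "(nat \<Rightarrow> ('a \<Rightarrow> nat) set) \<Rightarrow> nat \<Rightarrow> nat \<Rightarrow> 'a \<Rightarrow> nat" where
  "branch E d a = (SOME P. P \<in> E d \<and> P \<one> = a)"

text \<open>A root is an arbitrary pattern of the given family, all of whose members point at it: at the
  member \<open>k\<close> the window has the name \<open>opp d k\<close>.\<close>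

definition root_pattern :: "nat \<Rightarrow> ('a \<Rightarrow> nat) \<Rightarrow> 'a \<Rightarrow> nat" where
  "root_pattern d P = (\<lambda>k\<in>K d. prod_encode (P k, opp d k))"

text \<open>Observed from a vertex whose root lies in another direction \<open>t\<close>, a window carries
  the chosen continuation, and its other members point back.\<close>

definition away_pattern :: "(nat \<Rightarrow> ('a \<Rightarrow> nat) set) \<Rightarrow> nat \<Rightarrow> nat \<Rightarrow> nat \<Rightarrow> 'a \<Rightarrow> nat" where
  "away_pattern E d a t =
     (\<lambda>k\<in>K d. if k = \<one> then prod_encode (a, t) else prod_encode (branch E d a k, opp d k))"

text \<open>New labels are pairs of an old label and the direction in which the root lies. A window either
  is the root, or has exactly one member \<open>k\<close> whose root lies elsewhere; observed
  from that member, it is an \<open>away_pattern\<close>.\<close>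

definition rooted :: "(nat \<Rightarrow> ('a \<Rightarrow> nat) set) \<Rightarrow> nat set \<Rightarrow> nat \<Rightarrow> ('a \<Rightarrow> nat) set" where
  "rooted E V = (\<lambda>d\<in>T. root_pattern d ` E d \<union>
     {Q \<in> extensional (K d). \<exists>k\<in>K d. \<exists>a\<in>V. \<exists>t\<in>T. t \<noteq> opp d k \<and>
        shift d k Q = away_pattern E (opp d k) a t})"

lemma rooted_cases:
  assumes "d \<in> T" "Q \<in> rooted E V d"
  obtains (root) P where "P \<in> E d" "Q = root_pattern d P"
  | (away) k a t where "k \<in> K d" "a \<in> V" "t \<in> T" "t \<noteq> opp d k" "Q \<in> extensional (K d)"
      "shift d k Q = away_pattern E (opp d k) a t"
  using assms by (auto simp: rooted_def)

lemma root_in_rooted: "d \<in> T \<Longrightarrow> P \<in> E d \<Longrightarrow> root_pattern d P \<in> rooted E V d"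
  by (simp add: rooted_def)

lemma away_in_rooted:
  assumes "d \<in> T" "k \<in> K d" "a \<in> V" "t \<in> T" "t \<noteq> opp d k" "Q \<in> extensional (K d)"
    and "shift d k Q = away_pattern E (opp d k) a t"
  shows "Q \<in> rooted E V d"
  using assms by (auto simp: rooted_def)

definition dir :: "nat \<Rightarrow> nat" where "dir v = snd (prod_decode v)"

lemma dir_encode [simp]: "dir (prod_encode (a, t)) = t"
  by (simp add: dir_def)

context
  fixes E V assumes E: "consistent E V"
begin

lemma branch_in:
  assumes "d \<in> T" "a \<in> V"
  shows "branch E d a \<in> E d" "branch E d a \<one> = a"
proof -
  have "\<exists>P. P \<in> E d \<and> P \<one> = a" using consistentD(4)[OF E assms(1)] assms(2) by auto
  from someI_ex[OF this] show "branch E d a \<in> E d" "branch E d a \<one> = a"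
    by (simp_all add: branch_def)
qed

lemma away_extensional: "away_pattern E d a t \<in> extensional (K d)"
  by (simp add: away_pattern_def)

lemma away_one: "d \<in> T \<Longrightarrow> away_pattern E d a t \<one> = prod_encode (a, t)"
  by (simp add: away_pattern_def one_in_K)

lemma away_other: "k \<in> K d \<Longrightarrow> k \<noteq> \<one> \<Longrightarrow> away_pattern E d a t k = prod_encode (branch E d a k, opp d k)"
  by (simp add: away_pattern_def)

lemma unshift_apply:
  assumes "d \<in> T" "k \<in> K d" "h \<in> K d"
  shows "Q h = shift d k Q (h \<otimes> inv k)"
  using assms div_in_K_opp[of d k h] K_carrier by (simp add: shift_apply m_assoc)

text \<open>The value is read off at the distinguished member \<open>k\<close>, from which the identity is
  \<open>inv k\<close>.\<close>

lemma rooted_value: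
  assumes "d \<in> T" "Q \<in> rooted E V d"
  shows "Q \<one> \<in> prod_encode ` (V \<times> T)"
  using assms
proof (cases rule: rooted_cases)
  case (root P)
  then show ?thesis
    using assms(1) consistent_value[OF E assms(1) root(1) one_in_K[OF assms(1)]]
    by (simp add: root_pattern_def one_in_K opp_one)
next
  case (away k a t)
  have k: "inv k \<in> K (opp d k)" "opp d k \<in> T" "opp (opp d k) (inv k) = d" 
    using assms(1) away(1) inv_in_K_opp opp_in_T opp_opp_inv by auto
  have "Q \<one> = away_pattern E (opp d k) a t (inv k)"
    using unshift_apply[OF assms(1) away(1) one_in_K[OF assms(1)], of Q] away assms(1) K_carrier by simp
  then show ?thesis
    using k away assms(1) consistent_value[OF E k(2) branch_in(1)[OF k(2) away(2)] k(1)]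
    by (simp add: away_pattern_def)
qed

text \<open>The vertex \<open>(a, t)\<close> is visible in the window \<open>t\<close> as a member of a
  root, and in every other window as the distinguished member.\<close>

lemma consistent_rooted: "consistent (rooted E V) (prod_encode ` (V \<times> T))"
proof (rule consistentI)
  show "rooted E V \<in> extensional T" by (simp add: rooted_def)
next
  fix d Q assume "d \<in> T" "Q \<in> rooted E V d"
  then show "Q \<in> extensional (K d)"
    by (cases rule: rooted_cases) (simp_all add: root_pattern_def)
next
  fix d Q j assume d: "d \<in> T" and Q: "Q \<in> rooted E V d" and j: "j \<in> K d"
  show "shift d j Q \<in> rooted E V (opp d j)"
    using d Q
  proof (cases rule: rooted_cases)
    case (root P)
    have "shift d j Q = root_pattern (opp d j) (shift d j P)"
      using mult_in_K[OF d j] by (auto simp: root root_pattern_def shift_def restrict_def fun_eq_iff)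
    then show ?thesis
      using root_in_rooted[OF opp_in_T[OF d j]] consistentD(3)[OF E d root(1) j] by simp
  next
    case (away k a t)
    have "opp (opp d j) (k \<otimes> inv j) = opp d k" by (rule opp_opp[OF d j away(1)])
    then show ?thesis
      using away shift_shift[OF d j away(1), of Q] div_in_K_opp[OF d j away(1)]
      by (intro away_in_rooted[of _ "k \<otimes> inv j" a V t]) (auto simp: opp_in_T d j shift_extensional)
  qed
next
  fix d assume d: "d \<in> T"
  have "prod_encode (a, t) \<in> (\<lambda>P. P \<one>) ` rooted E V d" if at: "a \<in> V" "t \<in> T" for a t
  proof (cases "t = d")
    case True
    have "root_pattern d (branch E d a) \<one> = prod_encode (a, t)"
      using branch_in(2)[OF d at(1)] d True by (simp add: root_pattern_def one_in_K opp_one)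
    then show ?thesis
      using root_in_rooted[of d "branch E d a" E V, OF d branch_in(1)[OF d at(1)]]
      by (metis (no_types, lifting) image_eqI)
  next
    case False
    have "away_pattern E d a t \<in> rooted E V d"
      using d at False away_extensional
      by (intro away_in_rooted[of d \<one> a V t]) (simp_all add: one_in_K opp_one shift_one)
    then show ?thesis using away_one[OF d] by (metis (no_types, lifting) image_eqI)
  qed
  then show "(\<lambda>P. P \<one>) ` rooted E V d = prod_encode ` (V \<times> T)"
    using rooted_value[OF d] by auto
qed

text \<open>Forgetting the directions gives back the family: roots show all patterns of \<open>E\<close>,
  and the chosen continuations are shifts of patterns of \<open>E\<close>.\<close>

lemma map_patterns_rooted: "map_patterns (\<lambda>v. fst (prod_decode v)) (rooted E V) = E"
proof (rule extensionalityI[of _ T])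
  fix d assume d: "d \<in> T"
  let ?f = "\<lambda>P. \<lambda>k\<in>K d. fst (prod_decode (P k))"
  have root: "?f (root_pattern d P) = P" if "P \<in> E d" for P
    using consistentD(2)[OF E d that]
    by (intro extensionalityI[of _ "K d"]) (simp_all add: root_pattern_def)
  have "?f Q \<in> E d" if "Q \<in> rooted E V d" for Q
    using d that
  proof (cases rule: rooted_cases)
    case (away k a t)
    let ?B = "branch E (opp d k) a"
    have k: "opp d k \<in> T" "inv k \<in> K (opp d k)" "opp (opp d k) (inv k) = d"
      using d away(1) inv_in_K_opp opp_in_T opp_opp_inv by auto
    have "fst (prod_decode (Q h)) = ?B (h \<otimes> inv k)" if h: "h \<in> K d" for h
      using unshift_apply[OF d away(1) h, of Q] away div_in_K_opp[OF d away(1) h]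
        branch_in(2)[OF k(1) away(2)] by (simp add: away_pattern_def)
    then have "?f Q = shift (opp d k) (inv k) ?B"
      by (simp add: shift_def k(3) restrict_def fun_eq_iff)
    then show ?thesis
      using consistentD(3)[OF E k(1) branch_in(1)[OF k(1) away(2)] k(2)] k(3) by simp
  qed (simp add: root)
  moreover have "P \<in> ?f ` rooted E V d" if "P \<in> E d" for P
    by (rule image_eqI[of _ _ "root_pattern d P"]) (simp_all add: root[OF that] root_in_rooted[of d P E V, OF d that])
  ultimately show "map_patterns (\<lambda>v. fst (prod_decode v)) (rooted E V) d = E d"
    using d by (auto simp: map_patterns_def)
qed (use consistentD(1)[OF E] T_nonempty in \<open>auto simp: map_patterns_def\<close>)

end

section \<open>Rigidity of rooted patterns\<close>

text \<open>\<open>reach t g e\<close>: from a vertex whose root lies in direction \<open>t\<close>, the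
  element \<open>g\<close> is reached by moves that never go toward the root, and
  \<open>e\<close> is the direction of the root at the place reached. Every move sets that
  direction to the one leading back.\<close>

inductive reach :: "nat \<Rightarrow> 'a \<Rightarrow> nat \<Rightarrow> bool" for t :: nat where
  start: "reach t \<one> t"
| step: "reach t g e \<Longrightarrow> d \<in> T \<Longrightarrow> d \<noteq> e \<Longrightarrow> k \<in> K d \<Longrightarrow> k \<noteq> \<one> \<Longrightarrow> reach t (k \<otimes> g) (opp d k)"

lemma reach_carrier: "reach t g e \<Longrightarrow> g \<in> carrier G"
  by (induction rule: reach.induct) (auto intro: K_carrier)

text \<open>Once the starting point has been left, the only forbidden direction is the window of the last
  move, and a further move in that window merely replaces the last move by another one or
  cancels it. So the reachable elements can only be left from the starting point itself, in
  direction \<open>t\<close>.\<close>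

lemma reach_move:
  assumes "reach t g e" and d: "d \<in> T" and k: "k \<in> K d"
  shows "(\<exists>e'. reach t (k \<otimes> g) e') \<or> (g = \<one> \<and> d = t)"
proof (cases "k = \<one> \<or> d \<noteq> e")
  case True
  then have "\<exists>e'. reach t (k \<otimes> g) e'"
    using assms(1) reach_carrier[OF assms(1)] reach.step[OF assms(1) d _ k]
    by (cases "k = \<one>") auto
  then show ?thesis ..
next
  case False
  then have ke: "k \<noteq> \<one>" "d = e" by auto
  from assms(1) show ?thesis
  proof cases
    case start
    then show ?thesis using ke by simp
  next
    case (step g' e' d' k')
    have k': "k \<otimes> k' \<in> K d'"
      using mult_in_K(1)[of d' k' k] step k ke by simp
    have c: "k \<in> carrier G" "k' \<in> carrier G" "g' \<in> carrier G"
      using K_carrier d k step reach_carrier by blast+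
    have eq: "k \<otimes> g = (k \<otimes> k') \<otimes> g'" using step c by (simp add: m_assoc)
    show ?thesis
    proof (cases "k \<otimes> k' = \<one>")
      case True
      then show ?thesis using eq step c by auto
    next
      case False
      then show ?thesis using eq reach.step[OF step(3) step(4,5) k'] by auto
    qed
  qed
qed

text \<open>Going one step toward the root, from \<open>\<one>\<close> to \<open>k\<close>, keeps everything
  reachable: the step back is a move away from the root, since the root now lies elsewhere.\<close>

lemma reach_rebase:
  assumes "reach t v e" and t: "t \<in> T" and k: "k \<in> K t" "k \<noteq> \<one>" and t': "t' \<noteq> opp t k"
  shows "reach t' (v \<otimes> inv k) e"
  using assms(1)
proof induction
  case start
  have c: "k \<in> carrier G" using K_carrier t k by blast
  have "inv k \<noteq> \<one>" using k c by (metis inv_inv inv_one)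
  then have "reach t' (inv k \<otimes> \<one>) (opp (opp t k) (inv k))"
    by (intro reach.step[OF reach.start]) (use t t' k opp_in_T inv_in_K_opp in auto)
  then show ?case using c opp_opp_inv[OF t k(1)] by simp
next
  case (step g e d j)
  have "g \<in> carrier G" "j \<in> carrier G" "k \<in> carrier G"
    using reach_carrier step K_carrier t k by blast+
  then show ?case using reach.step[OF step.IH step.hyps(2-5)] by (simp add: m_assoc)
qed

primrec word_ball :: "nat \<Rightarrow> 'a set" where
  "word_ball 0 = {\<one>}"
| "word_ball (Suc m) = word_ball m \<union> (\<Union>d\<in>T. \<Union>k\<in>K d. (\<lambda>g. k \<otimes> g) ` word_ball m)"

lemma word_ball_carrier: "word_ball m \<subseteq> carrier G"
  by (induction m) (auto intro: K_carrier)

lemma word_ball_exhausts: 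
  assumes "g \<in> carrier G" shows "\<exists>m. g \<in> word_ball m"
proof -
  have "(\<Union>m. word_ball m) = carrier G"
  proof (rule generation)
    show "(\<Union>m. word_ball m) \<subseteq> carrier G" using word_ball_carrier by blast
    have "\<one> \<in> word_ball 0" by simp
    then show "\<one> \<in> (\<Union>m. word_ball m)" by blast
    fix d k g assume "d \<in> T" "k \<in> K d" "g \<in> (\<Union>m. word_ball m)"
    then obtain m where "g \<in> word_ball m" by blast
    then have "k \<otimes> g \<in> word_ball (Suc m)" using \<open>d \<in> T\<close> \<open>k \<in> K d\<close> by auto
    then show "k \<otimes> g \<in> (\<Union>m. word_ball m)" by blast
  qed
  then show ?thesis using assms by blast
qed

text \<open>Compactness: agreement on each ball is a closed condition, and the balls exhaust the group.\<close>

lemma itinerary_from_balls: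
  assumes \<beta>: "\<beta> \<in> actions G" and q: "label q"
    and ball: "\<And>m. \<exists>y. \<forall>g\<in>word_ball m. q (\<beta> g y) = f g"
  shows "\<exists>y. \<forall>g\<in>carrier G. q (\<beta> g y) = f g"
proof -
  define C where "C m = {y. \<forall>g\<in>word_ball m. q (\<beta> g y) = f g}" for m
  have "\<exists>y. \<forall>m. y \<in> C m"
  proof (rule cantor_nested_nonempty)
    fix m
    have "C m = (\<Inter>g\<in>word_ball m. {y. q (\<beta> g y) = f g})" by (auto simp: C_def)
    moreover have "closed {y. q (\<beta> g y) = f g}" if "g \<in> word_ball m" for g
      by (rule closed_label_eq, rule label_continuous[OF q])
         (use action_continuous[OF \<beta>] word_ball_carrier that in blast)
    ultimately show "closed (C m)" by auto
    show "C m \<noteq> {}" using ball[of m] by (auto simp: C_def)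
    show "C (Suc m) \<subseteq> C m" by (auto simp: C_def)
  qed
  then obtain y where y: "\<And>m. y \<in> C m" by blast
  show ?thesis
  proof (intro exI ballI)
    fix g assume "g \<in> carrier G"
    then obtain m where "g \<in> word_ball m" using word_ball_exhausts by blast
    then show "q (\<beta> g y) = f g" using y[of m] by (simp add: C_def)
  qed
qed

lemma action_cancel:
  assumes "\<alpha> \<in> actions G" "g \<in> carrier G" "w \<in> carrier G"
  shows "\<alpha> (g \<otimes> inv w) (\<alpha> w x) = \<alpha> g x"
  using action_mult[OF assms(1), of "g \<otimes> inv w" w x] assms by (simp add: m_assoc)

context
  fixes E V assumes E: "consistent E V"
begin

text \<open>In any direction but that of the root, the label of a vertex determines the pattern: the window
  is not a root, and a distinguished member other than the vertex itself would force the root to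
  lie in direction \<open>d\<close>.\<close>

lemma pattern_away_from_root:
  assumes \<alpha>: "\<alpha> \<in> actions G" "patterns \<alpha> p = rooted E V" and d: "d \<in> T" "d \<noteq> dir (p x)"
  shows "pattern \<alpha> p d x = away_pattern E d (fst (prod_decode (p x))) (dir (p x))"
proof -
  let ?Q = "pattern \<alpha> p d x"
  have Q1: "?Q \<one> = p x" by (rule pattern_one[OF \<alpha>(1) d(1)])
  have "?Q \<in> rooted E V d" using patterns_mem[OF d(1), of \<alpha> p x] \<alpha>(2) by simp
  with d(1) show ?thesis
  proof (cases rule: rooted_cases)
    case (root P)
    then have "?Q \<one> = prod_encode (P \<one>, d)"
      using d(1) by (simp add: root_pattern_def one_in_K opp_one)
    then have "dir (p x) = d" using Q1 by (metis dir_encode)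
    then show ?thesis using d by simp
  next
    case (away k a t)
    show ?thesis
    proof (cases "k = \<one>")
      case True
      then have Q: "?Q = away_pattern E d a t"
        using away d(1) shift_one by (simp add: opp_one)
      then have "p x = prod_encode (a, t)" using Q1 away_one[OF E d(1)] by simp
      then show ?thesis using Q by simp
    next
      case False
      have c: "k \<in> carrier G" using K_carrier d away by blast
      then have "inv k \<noteq> \<one>" using False by (metis inv_inv inv_one)
      moreover have "?Q \<one> = away_pattern E (opp d k) a t (inv k)"
        using unshift_apply[OF E d(1) away(1) one_in_K[OF d(1)], of ?Q] away c by simp
      ultimately have "dir (p x) = opp (opp d k) (inv k)"
        using away_other[OF E inv_in_K_opp[OF d(1) away(1)]] Q1 by (metis dir_encode)
      then show ?thesis using opp_opp_inv[OF d(1) away(1)] d by simp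
    qed
  qed
qed

lemma labels_agree_on_reach:
  assumes \<alpha>: "\<alpha> \<in> actions G" "patterns \<alpha> p = rooted E V" 
    and \<beta>: "\<beta> \<in> actions G" "patterns \<beta> q = rooted E V"
    and xy: "p x = q y" "dir (p x) = t" and "reach t g e"
  shows "p (\<alpha> g x) = q (\<beta> g y) \<and> dir (p (\<alpha> g x)) = e"
  using \<open>reach t g e\<close>
proof induction
  case start
  then show ?case using xy action_one \<alpha>(1) \<beta>(1) by simp
next
  case (step g e d k)
  let ?x = "\<alpha> g x" and ?y = "\<beta> g y"
  have c: "g \<in> carrier G" "k \<in> carrier G" using reach_carrier step K_carrier by blast+
  have px: "p ?x = q ?y" "d \<noteq> dir (p ?x)" "d \<noteq> dir (q ?y)" using step by auto
  have "pattern \<alpha> p d ?x = pattern \<beta> q d ?y"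
    using pattern_away_from_root[OF \<alpha> step.hyps(2) px(2)] pattern_away_from_root[OF \<beta> step.hyps(2) px(3)]
      px(1) by simp
  then have "p (\<alpha> k ?x) = q (\<beta> k ?y)" using pattern_apply[OF step.hyps(4)] by metis
  moreover have "pattern \<alpha> p d ?x k = prod_encode (branch E d (fst (prod_decode (p ?x))) k, opp d k)"
    unfolding pattern_away_from_root[OF \<alpha> step.hyps(2) px(2)] by (rule away_other[OF E step.hyps(4,5)])
  ultimately show ?case
    unfolding action_mult[OF \<alpha>(1) c(2,1)] action_mult[OF \<beta>(1) c(2,1)] pattern_apply[OF step.hyps(4)]
    by (metis dir_encode)
qed

text \<open>From the members of a root all moves except those within the root go away from it, so the
  elements reachable from these members fill the group.\<close>

lemma root_pattern_determines_itinerary: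
  assumes \<alpha>: "\<alpha> \<in> actions G" "patterns \<alpha> p = rooted E V" 
    and \<beta>: "\<beta> \<in> actions G" "patterns \<beta> q = rooted E V"
    and d: "d \<in> T" and x: "pattern \<alpha> p d x = root_pattern d P" and y: "pattern \<beta> q d y = root_pattern d P"
    and g: "g \<in> carrier G"
  shows "q (\<beta> g y) = p (\<alpha> g x)"
proof -
  \<comment> \<open>the elements reachable from the members of the root\<close>
  define Y where "Y = {g \<in> carrier G. \<exists>k\<in>K d. \<exists>v e. g = v \<otimes> k \<and> reach (opp d k) v e}"
  have "Y = carrier G"
  proof (rule generation)
    show "Y \<subseteq> carrier G" by (auto simp: Y_def)
    have "\<one> = \<one> \<otimes> \<one>" by simp
    then show "\<one> \<in> Y" unfolding Y_def using one_in_K[OF d] reach.start[of "opp d \<one>"] by blast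
    fix c k g assume c: "c \<in> T" and k: "k \<in> K c" and "g \<in> Y"
    then obtain j v e where j: "j \<in> K d" "g = v \<otimes> j" "reach (opp d j) v e" by (auto simp: Y_def)
    have carr: "k \<in> carrier G" "j \<in> carrier G" "v \<in> carrier G"
      using K_carrier reach_carrier c k j d by blast+
    from reach_move[OF j(3) c k] show "k \<otimes> g \<in> Y"
    proof
      assume "\<exists>e'. reach (opp d j) (k \<otimes> v) e'"
      moreover have "k \<otimes> g = (k \<otimes> v) \<otimes> j" using carr j by (simp add: m_assoc)
      ultimately show ?thesis using j carr unfolding Y_def by blast
    next
      assume vc: "v = \<one> \<and> c = opp d j"
      then have "k \<otimes> j \<in> K d" using mult_in_K(1)[OF d j(1)] k by simp
      moreover have "k \<otimes> g = \<one> \<otimes> (k \<otimes> j)" using carr j vc by simp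
      ultimately show ?thesis using carr j reach.start[of "opp d (k \<otimes> j)"] unfolding Y_def by blast
    qed
  qed
  then have "g \<in> Y" using g by simp
  then obtain k v e where k: "k \<in> K d" "g = v \<otimes> k" "reach (opp d k) v e" unfolding Y_def by blast
  have c: "v \<in> carrier G" "k \<in> carrier G" using reach_carrier K_carrier k d by blast+
  have px: "p (\<alpha> k x) = prod_encode (P k, opp d k)" and qy: "q (\<beta> k y) = prod_encode (P k, opp d k)"
    using fun_cong[OF x, of k] fun_cong[OF y, of k] k(1) by (simp_all add: pattern_apply root_pattern_def)
  have "p (\<alpha> v (\<alpha> k x)) = q (\<beta> v (\<beta> k y))"
    using labels_agree_on_reach[OF \<alpha> \<beta> _ _ k(3), of "\<alpha> k x" "\<beta> k y"] px qy by simp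
  then show ?thesis using action_mult[OF \<alpha>(1) c] action_mult[OF \<beta>(1) c] k(2) by simp
qed

text \<open>Walk toward the root. Either the walk meets it, and then a point with the same root pattern in
  the other action has the same itinerary; or each step enlarges the reachable set by one more
  layer, until it covers the ball of radius \<open>m\<close>.\<close>

lemma root_or_large_reach:
  assumes \<alpha>: "\<alpha> \<in> actions G" "patterns \<alpha> p = rooted E V" 
    and \<beta>: "\<beta> \<in> actions G" "patterns \<beta> q = rooted E V"
  shows "(\<exists>y. \<forall>g\<in>carrier G. q (\<beta> g y) = p (\<alpha> g x)) \<or>
    (\<exists>w\<in>carrier G. \<forall>g\<in>word_ball m. \<exists>e. reach (dir (p (\<alpha> w x))) (g \<otimes> inv w) e)"
proof (induction m)
  case 0
  have "reach (dir (p (\<alpha> \<one> x))) (\<one> \<otimes> inv \<one>) (dir (p (\<alpha> \<one> x)))" using reach.start by simp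
  then show ?case by (intro disjI2 bexI[of _ \<one>]) auto
next
  case (Suc m)
  then show ?case
  proof
    assume "\<exists>w\<in>carrier G. \<forall>g\<in>word_ball m. \<exists>e. reach (dir (p (\<alpha> w x))) (g \<otimes> inv w) e"
    then obtain w where w: "w \<in> carrier G"
      and reach_w: "\<And>g. g \<in> word_ball m \<Longrightarrow> \<exists>e. reach (dir (p (\<alpha> w x))) (g \<otimes> inv w) e" by blast
    define x' where "x' = \<alpha> w x"
    define t where "t = dir (p x')"
    obtain d0 where d0: "d0 \<in> T" using T_nonempty by blast
    have "p x' \<in> prod_encode ` (V \<times> T)"
      using rooted_value[OF E d0, of "pattern \<alpha> p d0 x'"] patterns_mem[OF d0, of \<alpha> p x'] \<alpha> pattern_one[OF \<alpha>(1) d0]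
      by simp
    then have t: "t \<in> T" by (auto simp: t_def)
    have Q: "pattern \<alpha> p t x' \<in> rooted E V t" using patterns_mem[OF t, of \<alpha> p x'] \<alpha>(2) by simp
    from t Q show ?thesis
    proof (cases rule: rooted_cases)
      case (root P)
      then have "root_pattern t P \<in> patterns \<beta> q t" using root_in_rooted[of t P E V] t \<beta>(2) by simp
      then obtain y' where y': "pattern \<beta> q t y' = root_pattern t P" using t by (auto simp: patterns_apply)
      have "q (\<beta> g (\<beta> (inv w) y')) = p (\<alpha> g x)" if g: "g \<in> carrier G" for g
      proof -
        have "q (\<beta> (g \<otimes> inv w) y') = p (\<alpha> (g \<otimes> inv w) x')"
          by (rule root_pattern_determines_itinerary[OF \<alpha> \<beta> t root(2) y']) (use g w in simp)
        then show ?thesis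
          using action_cancel[OF \<alpha>(1) g w] action_mult[OF \<beta>(1) g inv_closed[OF w]] by (simp add: x'_def)
      qed
      then show ?thesis by blast
    next
      case (away k a s)
      \<comment> \<open>otherwise the root would lie in a direction other than \<open>t\<close>\<close>
      have k1: "k \<noteq> \<one>"
      proof
        assume "k = \<one>"
        then have "pattern \<alpha> p t x' = away_pattern E t a s" using away t shift_one by (simp add: opp_one)
        then have "p x' = prod_encode (a, s)" using pattern_one[OF \<alpha>(1) t] away_one[OF E t] by metis
        then have "s = t" by (simp add: t_def)
        then show False using away(4) \<open>k = \<one>\<close> opp_one[OF t] by simp
      qed
      have c: "k \<in> carrier G" using K_carrier t away(1) by blast
      have opp: "opp t k \<in> T" using opp_in_T t away(1) by blast
      have "pattern \<alpha> p (opp t k) (\<alpha> k x') = away_pattern E (opp t k) a s"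
        using shift_pattern[OF \<alpha>(1) t away(1)] away(6) by simp
      then have "p (\<alpha> k x') = prod_encode (a, s)"
        using pattern_one[OF \<alpha>(1) opp] away_one[OF E opp] by metis
      then have dir: "dir (p (\<alpha> (k \<otimes> w) x)) = s"
        using action_mult[OF \<alpha>(1) c w] by (simp add: x'_def)
      have "\<exists>e. reach s (g \<otimes> inv (k \<otimes> w)) e" if g: "g \<in> word_ball (Suc m)" for g
      proof -
        have "\<exists>d\<in>T. \<exists>j\<in>K d. \<exists>h\<in>word_ball m. g = j \<otimes> h"
        proof -
          have "g = \<one> \<otimes> g" using g word_ball_carrier by (metis l_one subsetD)
          then show ?thesis using g d0 one_in_K by auto
        qed
        then obtain d j h where j: "d \<in> T" "j \<in> K d" "h \<in> word_ball m" "g = j \<otimes> h" by blast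
        have jh: "j \<in> carrier G" "h \<in> carrier G" using K_carrier j word_ball_carrier by blast+
        obtain e where e: "reach t (h \<otimes> inv w) e" using reach_w[OF j(3)] by (auto simp: t_def x'_def)
        \<comment> \<open>observed from the new base point \<open>k \<otimes> w\<close>, the element \<open>g\<close> is one move away from the old reachable set\<close>
        have g_eq: "g \<otimes> inv (k \<otimes> w) = (j \<otimes> (h \<otimes> inv w)) \<otimes> inv k"
          using jh w c j(4) by (simp add: m_assoc inv_mult_group)
        from reach_move[OF e j(1,2)] show ?thesis
        proof
          assume "\<exists>e'. reach t (j \<otimes> (h \<otimes> inv w)) e'"
          then show ?thesis using reach_rebase[OF _ t away(1) k1 away(4)] g_eq by metis
        next
          assume "h \<otimes> inv w = \<one> \<and> d = t"
          then have "g \<otimes> inv (k \<otimes> w) = j \<otimes> inv k" "j \<in> K t" using g_eq jh j by simp_all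
          then have "g \<otimes> inv (k \<otimes> w) \<in> K (opp t k)" using div_in_K_opp[OF t away(1)] by simp
          then show ?thesis using reach_move[OF reach.start[of s] opp] away(4)
            by (metis K_carrier opp r_one)
        qed
      qed
      then show ?thesis using dir c w by (intro disjI2 bexI[of _ "k \<otimes> w"]) simp_all
    qed
  qed simp
qed

text \<open>If the root is beyond the ball of radius \<open>m\<close>, the label at one place determines the
  itinerary on this ball, and the same label occurs in the other action. So every itinerary of
  one action is a limit of itineraries of the other.\<close>

lemma rigid_rooted: "rigid (rooted E V)"
  unfolding rigid_def
proof (intro ballI allI impI)
  fix \<alpha> \<beta> p q x
  assume \<alpha>: "\<alpha> \<in> actions G" and \<beta>: "\<beta> \<in> actions G" and q: "label q"
    and p_rooted: "patterns \<alpha> p = rooted E V" and q_rooted: "patterns \<beta> q = rooted E V"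
  note \<alpha>' = \<alpha> p_rooted and \<beta>' = \<beta> q_rooted
  show "\<exists>y. \<forall>g\<in>carrier G. q (\<beta> g y) = p (\<alpha> g x)"
  proof (rule itinerary_from_balls[OF \<beta> q])
    fix m
    from root_or_large_reach[OF \<alpha>' \<beta>', of x m]
    show "\<exists>y. \<forall>g\<in>word_ball m. q (\<beta> g y) = p (\<alpha> g x)"
    proof
      assume "\<exists>y. \<forall>g\<in>carrier G. q (\<beta> g y) = p (\<alpha> g x)"
      then show ?thesis using word_ball_carrier by blast
    next
      assume "\<exists>w\<in>carrier G. \<forall>g\<in>word_ball m. \<exists>e. reach (dir (p (\<alpha> w x))) (g \<otimes> inv w) e"
      then obtain w where w: "w \<in> carrier G"
        and reach_w: "\<And>g. g \<in> word_ball m \<Longrightarrow> \<exists>e. reach (dir (p (\<alpha> w x))) (g \<otimes> inv w) e" by blast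
      obtain d where d: "d \<in> T" using T_nonempty by blast
      have "pattern \<alpha> p d (\<alpha> w x) \<in> patterns \<beta> q d" using patterns_mem[OF d, of \<alpha> p "\<alpha> w x"] p_rooted q_rooted by simp
      then obtain y' where "pattern \<alpha> p d (\<alpha> w x) = pattern \<beta> q d y'" using d by (auto simp: patterns_apply)
      then have y': "p (\<alpha> w x) = q y'" using pattern_one \<alpha> \<beta> d by metis
      have "q (\<beta> g (\<beta> (inv w) y')) = p (\<alpha> g x)" if g: "g \<in> word_ball m" for g
      proof -
        have gc: "g \<in> carrier G" using g word_ball_carrier by blast
        obtain e where "reach (dir (p (\<alpha> w x))) (g \<otimes> inv w) e" using reach_w[OF g] by blast
        then have "p (\<alpha> (g \<otimes> inv w) (\<alpha> w x)) = q (\<beta> (g \<otimes> inv w) y')"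
          using labels_agree_on_reach[OF \<alpha>' \<beta>' y' HOL.refl] by blast
        then show ?thesis
          using action_cancel[OF \<alpha> gc w] action_mult[OF \<beta> gc inv_closed[OF w]] by simp
      qed
      then show ?thesis by blast
    qed
  qed
qed

end

section \<open>Patterns and the topology of the space of actions\<close>

definition close_to :: "nat \<Rightarrow> ('a \<Rightarrow> cantor \<Rightarrow> cantor) \<Rightarrow> ('a \<Rightarrow> cantor \<Rightarrow> cantor) \<Rightarrow> bool" where
  "close_to M \<alpha> \<beta> \<longleftrightarrow> (\<forall>d\<in>T. \<forall>k\<in>K d. \<forall>x. level M (\<beta> k x) = level M (\<alpha> k x))"

lemma close_to_mono: 
  assumes "close_to M \<alpha> \<beta>" "m \<le> M" shows "close_to m \<alpha> \<beta>"
  unfolding close_to_def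
  by (intro ballI allI level_mono[OF assms(1)[unfolded close_to_def, rule_format] assms(2)])

text \<open>The elements controlled by closeness on the windows contain the identity and are closed under
  multiplication by window elements, by the chain rule for moduli of continuity. So they are all
  of \<open>G\<close>.\<close>

lemma close_to_imp_level_eq:
  assumes \<alpha>: "\<alpha> \<in> actions G" and "g \<in> carrier G"
  shows "\<exists>M. \<forall>\<beta>\<in>actions G. close_to M \<alpha> \<beta> \<longrightarrow> (\<forall>x. level m (\<beta> g x) = level m (\<alpha> g x))"
proof -
  define Y where "Y = {g \<in> carrier G. \<forall>m. \<exists>M. \<forall>\<beta>\<in>actions G.
    close_to M \<alpha> \<beta> \<longrightarrow> (\<forall>x. level m (\<beta> g x) = level m (\<alpha> g x))}"
  have "Y = carrier G"
  proof (rule generation)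
    show "Y \<subseteq> carrier G" by (auto simp: Y_def)
    show "\<one> \<in> Y" using action_one \<alpha> by (auto simp: Y_def)
    fix d k g assume d: "d \<in> T" and k: "k \<in> K d" and g: "g \<in> Y"
    have c: "k \<in> carrier G" "g \<in> carrier G" using K_carrier d k g by (auto simp: Y_def)
    have "\<exists>M. \<forall>\<beta>\<in>actions G. close_to M \<alpha> \<beta> \<longrightarrow> (\<forall>x. level m (\<beta> (k \<otimes> g) x) = level m (\<alpha> (k \<otimes> g) x))" for m
    proof -
      have "label (\<lambda>x. level m (\<alpha> k x))"
        using action_continuous[OF \<alpha> c(1)] by (simp add: continuous_iff_label)
      then obtain N where N: "\<forall>x y. level N x = level N y \<longrightarrow> level m (\<alpha> k x) = level m (\<alpha> k y)"
        by (rule labelE)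
      obtain M where M: "\<And>\<beta> x. \<beta> \<in> actions G \<Longrightarrow> close_to M \<alpha> \<beta> \<Longrightarrow> level N (\<beta> g x) = level N (\<alpha> g x)"
        using g unfolding Y_def by blast
      show ?thesis
      proof (intro exI[of _ "max m M"] ballI impI allI)
        fix \<beta> x assume \<beta>: "\<beta> \<in> actions G" and close: "close_to (max m M) \<alpha> \<beta>"
        have "level m (\<beta> k (\<beta> g x)) = level m (\<alpha> k (\<beta> g x))"
          using close_to_mono[OF close, of m] d k by (simp add: close_to_def)
        also have "\<dots> = level m (\<alpha> k (\<alpha> g x))"
          by (rule N[rule_format], rule M[OF \<beta>], rule close_to_mono[OF close]) simp
        finally show "level m (\<beta> (k \<otimes> g) x) = level m (\<alpha> (k \<otimes> g) x)"
          using action_mult[OF \<beta> c] action_mult[OF \<alpha> c] by simp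
      qed
    qed
    then show "k \<otimes> g \<in> Y" using c unfolding Y_def by blast
  qed
  then have "g \<in> Y" using assms(2) by simp
  then show ?thesis unfolding Y_def by blast
qed

lemma openin_imp_close_to:
  assumes U: "openin (action_topology G) U" "\<alpha> \<in> U"
  shows "\<exists>M. \<forall>\<beta>\<in>actions G. close_to M \<alpha> \<beta> \<longrightarrow> \<beta> \<in> U"
proof -
  have \<alpha>: "\<alpha> \<in> actions G" using openin_subset[OF U(1)] U(2) by auto
  obtain F m where F: "finite F" "F \<subseteq> carrier G"
    and near: "\<And>\<beta>. \<beta> \<in> actions G \<Longrightarrow> (\<And>g x. g \<in> F \<Longrightarrow> level m (\<beta> g x) = level m (\<alpha> g x)) \<Longrightarrow> \<beta> \<in> U"
    using openin_action_imp_level[OF U] by metis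
  have "\<exists>M. \<forall>g\<in>F. \<forall>\<beta>\<in>actions G. close_to (M g) \<alpha> \<beta> \<longrightarrow> (\<forall>x. level m (\<beta> g x) = level m (\<alpha> g x))"
    using close_to_imp_level_eq[OF \<alpha>] F(2) by (intro bchoice) blast
  then obtain M where M: "\<forall>g\<in>F. \<forall>\<beta>\<in>actions G. close_to (M g) \<alpha> \<beta> \<longrightarrow>
    (\<forall>x. level m (\<beta> g x) = level m (\<alpha> g x))" ..
  show ?thesis
  proof (intro exI[of _ "Max (M ` F)"] ballI impI)
    fix \<beta> assume \<beta>: "\<beta> \<in> actions G" and close: "close_to (Max (M ` F)) \<alpha> \<beta>"
    show "\<beta> \<in> U"
    proof (rule near[OF \<beta>])
      fix g x assume g: "g \<in> F"
      have "close_to (M g) \<alpha> \<beta>" by (rule close_to_mono[OF close]) (use F(1) g in auto)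
      then show "level m (\<beta> g x) = level m (\<alpha> g x)" by (rule M[rule_format, OF g \<beta>])
    qed
  qed
qed

text \<open>Neighbourhoods can be described by patterns. Let \<open>p1\<close> record so many coordinates of
  \<open>x\<close> that they determine \<open>\<alpha> k x\<close> up to level \<open>M\<close>.
  If the pattern of \<open>\<beta>\<close> at \<open>x\<close> is that of
  \<open>\<alpha>\<close> at some \<open>y\<close>, then \<open>x\<close> and \<open>y\<close>
  share these coordinates, so \<open>\<beta> k x\<close>, \<open>\<alpha> k y\<close> and
  \<open>\<alpha> k x\<close> agree up to level \<open>M\<close>.\<close>

lemma near_by_patterns:
  assumes U: "openin (action_topology G) U" "\<alpha> \<in> U" and p: "label p"
  shows "\<exists>p1 \<pi>. label p1 \<and> p = \<pi> \<circ> p1 \<and> (\<forall>\<beta>\<in>actions G. patterns \<beta> p1 = patterns \<alpha> p1 \<longrightarrow> \<beta> \<in> U)"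
proof -
  have \<alpha>: "\<alpha> \<in> actions G" using openin_subset[OF U(1)] U(2) by auto
  obtain M where M: "\<forall>\<beta>\<in>actions G. close_to M \<alpha> \<beta> \<longrightarrow> \<beta> \<in> U"
    using openin_imp_close_to[OF U] by blast
  have "finite (\<Union>d\<in>T. K d)" using T_finite K_finite by blast
  moreover have "label (\<lambda>x. level M (\<alpha> k x))" if "k \<in> (\<Union>d\<in>T. K d)" for k
    using action_continuous[OF \<alpha>, of k] K_carrier that by (auto simp: continuous_iff_label)
  ultimately have "\<exists>N. \<forall>k\<in>(\<Union>d\<in>T. K d). \<forall>x y. level N x = level N y \<longrightarrow> level M (\<alpha> k x) = level M (\<alpha> k y)"
    by (rule label_uniform)
  then obtain N where N: "\<forall>k\<in>(\<Union>d\<in>T. K d). \<forall>x y. level N x = level N y \<longrightarrow> level M (\<alpha> k x) = level M (\<alpha> k y)" ..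
  obtain L0 where L0: "\<And>L. L0 \<le> L \<Longrightarrow> \<exists>\<pi>. p = \<pi> \<circ> level L" using label_eq_comp_level[OF p] by blast
  define L where "L = max L0 (max M N)"
  obtain \<pi> where \<pi>: "p = \<pi> \<circ> level L" using L0[of L] by (auto simp: L_def)
  have "\<beta> \<in> U" if \<beta>: "\<beta> \<in> actions G" and eq: "patterns \<beta> (level L) = patterns \<alpha> (level L)" for \<beta>
  proof (rule M[rule_format, OF \<beta>])
    have "level M (\<beta> k x) = level M (\<alpha> k x)" if d: "d \<in> T" and k: "k \<in> K d" for d k x
    proof -
      have "pattern \<beta> (level L) d x \<in> patterns \<alpha> (level L) d" using patterns_mem[OF d, of \<beta> "level L" x] eq by simp
      then obtain y where y: "pattern \<beta> (level L) d x = pattern \<alpha> (level L) d y"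
        using d by (auto simp: patterns_apply)
      have "level L x = level L y" using fun_cong[OF y, of \<one>] pattern_one d \<alpha> \<beta> by simp
      then have "level N x = level N y" by (rule level_mono) (simp add: L_def)
      then have "level M (\<alpha> k x) = level M (\<alpha> k y)" by (rule N[rule_format, rotated]) (use d k in blast)
      moreover have "level L (\<beta> k x) = level L (\<alpha> k y)" using fun_cong[OF y, of k] k by (simp add: pattern_apply)
      then have "level M (\<beta> k x) = level M (\<alpha> k y)" by (rule level_mono) (simp add: L_def)
      ultimately show ?thesis by simp
    qed
    then show "close_to M \<alpha> \<beta>" by (simp add: close_to_def)
  qed
  then show ?thesis using label_level \<pi> by blast
qed

lemma openin_patterns:
  assumes q: "label q"
  shows "openin (action_topology G) {\<alpha> \<in> actions G. patterns \<alpha> q = E}"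
proof (subst openin_subopen, intro ballI)
  fix \<alpha> assume \<alpha>: "\<alpha> \<in> {\<alpha> \<in> actions G. patterns \<alpha> q = E}"
  obtain m where m: "\<forall>x y. level m x = level m y \<longrightarrow> q x = q y" using q by (rule labelE)
  define N where "N k = {\<beta> \<in> actions G. \<forall>x. level m (\<beta> k x) = level m (\<alpha> k x)}" for k
  define I where "I = (\<Inter>k\<in>(\<Union>d\<in>T. K d). N k)"
  have fin: "finite (\<Union>d\<in>T. K d)" and ne: "(\<Union>d\<in>T. K d) \<noteq> {}"
    using T_finite K_finite T_nonempty one_in_K by blast+
  have "openin (action_topology G) (N k)" if "k \<in> (\<Union>d\<in>T. K d)" for k
    unfolding N_def by (rule openin_action_level) (use K_carrier that in blast)
  then have "openin (action_topology G) I"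
    unfolding I_def by (rule openin_INT2[OF fin ne])
  moreover have "\<alpha> \<in> I" using \<alpha> by (auto simp: I_def N_def)
  moreover have "I \<subseteq> {\<alpha> \<in> actions G. patterns \<alpha> q = E}"
  proof
    fix \<beta> assume \<beta>: "\<beta> \<in> I"
    have "pattern \<beta> q d = pattern \<alpha> q d" if "d \<in> T" for d
    proof (rule ext, rule extensionalityI[of _ "K d"])
      fix x k assume k: "k \<in> K d"
      have "\<beta> \<in> N k" using \<beta> that k by (auto simp: I_def)
      then have "level m (\<beta> k x) = level m (\<alpha> k x)" by (simp add: N_def)
      then have "q (\<beta> k x) = q (\<alpha> k x)" by (rule m[rule_format])
      then show "pattern \<beta> q d x k = pattern \<alpha> q d x k" using k by (simp add: pattern_apply)
    qed (simp_all add: pattern_def)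
    then have "patterns \<beta> q = patterns \<alpha> q"
      unfolding patterns_def by (intro restrict_ext) simp
    moreover have "\<beta> \<in> actions G"
    proof -
      obtain k where "k \<in> (\<Union>d\<in>T. K d)" using ne by blast
      then have "\<beta> \<in> N k" using \<beta> unfolding I_def by blast
      then show ?thesis by (simp add: N_def)
    qed
    ultimately show "\<beta> \<in> {\<alpha> \<in> actions G. patterns \<alpha> q = E}" using \<alpha> by simp
  qed
  ultimately show "\<exists>S. openin (action_topology G) S \<and> \<alpha> \<in> S \<and> S \<subseteq> {\<alpha> \<in> actions G. patterns \<alpha> q = E}"
    by blast
qed

section \<open>Refinable labels and liftable patterns\<close>

definition refinable :: "(cantor \<Rightarrow> nat) \<Rightarrow> ('a \<Rightarrow> cantor \<Rightarrow> cantor) set" where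
  "refinable p = {\<alpha> \<in> actions G. \<exists>q \<pi>. label q \<and> rigid (patterns \<alpha> q) \<and> p = \<pi> \<circ> q}"

text \<open>If the patterns of \<open>q\<close> are rigid and \<open>F\<close> projects onto them, then
  \<open>q\<close> lifts to a label with the patterns \<open>F\<close>. Labels of
  \<open>F\<close> are coded pairs, so that the projection is always the first component.\<close>

definition lifting :: "(cantor \<Rightarrow> nat) \<Rightarrow> (nat \<Rightarrow> ('a \<Rightarrow> nat) set) \<Rightarrow> ('a \<Rightarrow> cantor \<Rightarrow> cantor) set" where
  "lifting q F = {\<alpha> \<in> actions G.
     rigid (patterns \<alpha> q) \<and> patterns \<alpha> q = map_patterns (\<lambda>v. fst (prod_decode v)) F \<longrightarrow>
     (\<exists>r. label r \<and> patterns \<alpha> (\<lambda>x. prod_encode (q x, r x)) = F)}"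

definition realized_patterns :: "(nat \<Rightarrow> ('a \<Rightarrow> nat) set) set" where
  "realized_patterns = {patterns \<beta> r |\<beta> r. \<beta> \<in> actions G \<and> label r}"

lemma openin_refinable: "openin (action_topology G) (refinable p)"
proof -
  have "refinable p = (\<Union>(q, E)\<in>{(q, E). label q \<and> rigid E \<and> (\<exists>\<pi>. p = \<pi> \<circ> q)}.
      {\<alpha> \<in> actions G. patterns \<alpha> q = E})"
    by (auto simp: refinable_def)
  also have "openin (action_topology G) \<dots>" using openin_patterns by (intro openin_Union) auto
  finally show ?thesis .
qed

lemma openin_lifting:
  assumes "label q"
  shows "openin (action_topology G) (lifting q F)"
proof -
  have "lifting q F = (\<Union>E\<in>{E. \<not> (rigid E \<and> E = map_patterns (\<lambda>v. fst (prod_decode v)) F)}.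
        {\<alpha> \<in> actions G. patterns \<alpha> q = E}) \<union>
      (\<Union>r\<in>{r. label r}. {\<alpha> \<in> actions G. patterns \<alpha> (\<lambda>x. prod_encode (q x, r x)) = F})"
    by (auto simp: lifting_def)
  also have "openin (action_topology G) \<dots>"
    using openin_patterns assms label_pair[OF assms, of _ "\<lambda>a b. prod_encode (a, b)"]
    by (intro openin_Un openin_Union) auto
  finally show ?thesis .
qed

lemma countable_realized_patterns: "countable realized_patterns"
proof (rule countable_subset)
  show "realized_patterns \<subseteq> (\<Pi>\<^sub>E d\<in>T. {A. finite A \<and> A \<subseteq> (\<Pi>\<^sub>E k\<in>K d. UNIV)})"
  proof
    fix F assume "F \<in> realized_patterns"
    then obtain \<beta> r where F: "F = patterns \<beta> r" "label r" by (auto simp: realized_patterns_def)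
    have "finite (F d) \<and> F d \<subseteq> (\<Pi>\<^sub>E k\<in>K d. UNIV)" if d: "d \<in> T" for d
    proof
      have "F d \<subseteq> (\<Pi>\<^sub>E k\<in>K d. range r)" using d F by (auto simp: patterns_apply pattern_def)
      then show "finite (F d)"
        using finite_PiE[OF K_finite[OF d], of "\<lambda>_. range r"] label_finite_range[OF F(2)] finite_subset by blast
      show "F d \<subseteq> (\<Pi>\<^sub>E k\<in>K d. UNIV)" using d F by (auto simp: patterns_apply pattern_def)
    qed
    then show "F \<in> (\<Pi>\<^sub>E d\<in>T. {A. finite A \<and> A \<subseteq> (\<Pi>\<^sub>E k\<in>K d. UNIV)})"
      using F by (auto simp: patterns_def PiE_iff)
  qed
  show "countable (\<Pi>\<^sub>E d\<in>T. {A. finite A \<and> A \<subseteq> (\<Pi>\<^sub>E k\<in>K d. (UNIV :: nat set))})"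
    using T_finite K_finite by (intro countable_PiE countable_Collect_finite_subset) auto
qed

end

text \<open>Free products of finite and cyclic groups enter only through this property: the necessary
  conditions on the patterns of a labeled action are sufficient.\<close>

locale realizable_system = window_system +
  assumes realization: "label q \<Longrightarrow> consistent E (range q) \<Longrightarrow> \<exists>\<alpha>\<in>actions G. patterns \<alpha> q = E"
begin

text \<open>Near any action, a rooted family over its patterns is realized; the projection to the old labels
  keeps the new action in the given neighbourhood.\<close>

lemma dense_refinable:
  assumes p: "label p"
  shows "action_topology G closure_of refinable p = topspace (action_topology G)"
  unfolding dense_intersects_open
proof (intro allI impI)
  fix U assume "openin (action_topology G) U \<and> U \<noteq> {}"
  then obtain \<alpha> where U: "openin (action_topology G) U" "\<alpha> \<in> U" by blast
  have \<alpha>: "\<alpha> \<in> actions G" using openin_subset[OF U(1)] U(2) by auto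
  obtain p1 \<pi> where p1: "label p1" "p = \<pi> \<circ> p1"
    and near: "\<And>\<beta>. \<beta> \<in> actions G \<Longrightarrow> patterns \<beta> p1 = patterns \<alpha> p1 \<Longrightarrow> \<beta> \<in> U"
    using near_by_patterns[OF U p] by blast
  let ?E = "patterns \<alpha> p1" and ?V = "range p1" and ?fst = "\<lambda>v. fst (prod_decode v)"
  have E: "consistent ?E ?V" by (rule consistent_patterns[OF \<alpha>])
  have V: "finite (prod_encode ` (?V \<times> T))" "?fst ` prod_encode ` (?V \<times> T) = ?V"
    using label_finite_range[OF p1(1)] T_finite T_nonempty by (auto simp: image_image) 
  obtain q where q: "label q" "?fst \<circ> q = p1" "range q = prod_encode ` (?V \<times> T)"
    using label_refinement[OF p1(1) V] by blast
  obtain \<beta> where \<beta>: "\<beta> \<in> actions G" "patterns \<beta> q = rooted ?E ?V"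
    using realization[OF q(1)] consistent_rooted[OF E] q(3) by metis
  have "patterns \<beta> p1 = ?E"
    using map_patterns_patterns[of ?fst \<beta> q] map_patterns_rooted[OF E] \<beta>(2) q(2) by (simp add: o_def)
  then have "\<beta> \<in> U" by (rule near[OF \<beta>(1)])
  moreover have "\<beta> \<in> refinable p"
    unfolding refinable_def using \<beta> q p1(2) rigid_rooted[OF E]
    by (intro CollectI conjI exI[of _ q] exI[of _ "\<pi> \<circ> ?fst"]) (simp_all add: o_assoc[symmetric])
  ultimately show "refinable p \<inter> U \<noteq> {}" by blast
qed

text \<open>Amalgamation. The point pairs with equal itineraries under \<open>q\<close> and under the first
  component of \<open>r\<close> form an invariant set \<open>Z\<close>, which by rigidity
  projects onto both Cantor spaces. The patterns of \<open>p1\<close> and \<open>r\<close>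
  jointly seen along \<open>Z\<close> therefore project onto the patterns of \<open>p1\<close>,
  which keeps their realization close to \<open>\<alpha>\<close>, and, after recoding, onto
  those of \<open>r\<close>, which gives the lift.\<close>

lemma dense_lifting:
  assumes q: "label q" and F: "F \<in> realized_patterns"
  shows "action_topology G closure_of lifting q F = topspace (action_topology G)"
  unfolding dense_intersects_open
proof (intro allI impI)
  let ?fst = "\<lambda>v. fst (prod_decode v)" and ?snd = "\<lambda>v. snd (prod_decode v)"
  fix U assume "openin (action_topology G) U \<and> U \<noteq> {}"
  then obtain \<alpha> where U: "openin (action_topology G) U" "\<alpha> \<in> U" by blast
  have \<alpha>: "\<alpha> \<in> actions G" using openin_subset[OF U(1)] U(2) by auto
  show "lifting q F \<inter> U \<noteq> {}"
  proof (cases "rigid (patterns \<alpha> q) \<and> patterns \<alpha> q = map_patterns ?fst F")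
    case False
    then show ?thesis using U \<alpha> by (auto simp: lifting_def)
  next
    case True
    obtain \<beta> r where \<beta>: "\<beta> \<in> actions G" and r: "label r" "F = patterns \<beta> r"
      using F by (auto simp: realized_patterns_def)
    \<comment> \<open>\<open>r0\<close> has the patterns of \<open>q\<close>, and \<open>r1\<close> is the additional information in \<open>r\<close>\<close>
    define r0 r1 where "r0 = (\<lambda>y. ?fst (r y))" and "r1 = (\<lambda>y. ?snd (r y))"
    have l01: "label r0" "label r1" unfolding r0_def r1_def by (rule label_comp[OF r(1)])+
    have qr0: "patterns \<beta> r0 = patterns \<alpha> q"
      using True r(2) map_patterns_patterns[of ?fst \<beta> r] by (simp add: r0_def)
    obtain p1 \<pi> where p1: "label p1" "q = \<pi> \<circ> p1"
      and near: "\<And>\<beta>. \<beta> \<in> actions G \<Longrightarrow> patterns \<beta> p1 = patterns \<alpha> p1 \<Longrightarrow> \<beta> \<in> U"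
      using near_by_patterns[OF U q] by blast
    define Z where "Z = {(x, y). \<forall>g\<in>carrier G. r0 (\<beta> g y) = q (\<alpha> g x)}"
    have Z1: "\<exists>y. (x, y) \<in> Z" for x
      using rigidD[OF conjunct1[OF True] \<alpha> \<beta> q l01(1) HOL.refl qr0, of x] by (simp add: Z_def)
    have Z2: "\<exists>x. (x, y) \<in> Z" for y
    proof -
      obtain x where "\<forall>g\<in>carrier G. q (\<alpha> g x) = r0 (\<beta> g y)"
        using rigidD[OF conjunct1[OF True] \<beta> \<alpha> l01(1) q qr0 HOL.refl, of y] by blast
      then have "(x, y) \<in> Z" by (simp add: Z_def)
      then show ?thesis by blast
    qed
    have fstZ: "fst ` Z = UNIV"
    proof (intro subset_antisym subset_UNIV subsetI)
      fix x
      obtain y where "(x, y) \<in> Z" using Z1 by blast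
      then show "x \<in> fst ` Z" by (rule image_eqI[rotated]) simp
    qed
    have sndZ: "snd ` Z = UNIV"
    proof (intro subset_antisym subset_UNIV subsetI)
      fix y
      obtain x where "(x, y) \<in> Z" using Z2 by blast
      then show "y \<in> snd ` Z" by (rule image_eqI[rotated]) simp
    qed
    have Z_inv: "(\<alpha> k x, \<beta> k y) \<in> Z" if xy: "(x, y) \<in> Z" and k: "k \<in> carrier G" for x y k
    proof -
      have "r0 (\<beta> g (\<beta> k y)) = q (\<alpha> g (\<alpha> k x))" if g: "g \<in> carrier G" for g
        using xy action_mult[OF \<alpha> g k] action_mult[OF \<beta> g k] m_closed[OF g k] by (auto simp: Z_def)
      then show ?thesis by (simp add: Z_def)
    qed
    have Z_one: "r0 y = q x" if "(x, y) \<in> Z" for x y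
    proof -
      have "r0 (\<beta> \<one> y) = q (\<alpha> \<one> x)" using that one_closed unfolding Z_def by blast
      then show ?thesis by (simp add: action_one[OF \<alpha>] action_one[OF \<beta>])
    qed
    define J where "J d z = (\<lambda>k\<in>K d. prod_encode (p1 (\<alpha> k (fst z)), r1 (\<beta> k (snd z))))" for d z
    define E where "E = (\<lambda>d\<in>T. J d ` Z)"
    define V where "V = (\<lambda>(x, y). prod_encode (p1 x, r1 y)) ` Z"
    have "consistent E V"
    proof (rule consistentI)
      fix d P k assume d: "d \<in> T" and P: "P \<in> E d" and k: "k \<in> K d"
      have kc: "k \<in> carrier G" using K_carrier d k by blast
      obtain x y where z: "(x, y) \<in> Z" "P = J d (x, y)" using P d by (auto simp: E_def)
      have "shift d k P = J (opp d k) (\<alpha> k x, \<beta> k y)"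
      proof (rule extensionalityI[of _ "K (opp d k)"])
        fix h assume h: "h \<in> K (opp d k)"
        then have "h \<in> carrier G" using K_carrier opp_in_T d k by blast
        then show "shift d k P h = J (opp d k) (\<alpha> k x, \<beta> k y) h"
          using h kc mult_in_K(1)[OF d k h] action_mult[OF \<alpha>, of h k x] action_mult[OF \<beta>, of h k y]
          by (simp add: shift_apply z(2) J_def)
      qed (simp_all add: shift_def J_def)
      then show "shift d k P \<in> E (opp d k)"
        using Z_inv[OF z(1) kc] opp_in_T[OF d k] by (simp add: E_def)
    next
      fix d assume d: "d \<in> T"
      have "J d z \<one> = (\<lambda>(x, y). prod_encode (p1 x, r1 y)) z" for z
        using one_in_K[OF d] action_one \<alpha> \<beta> by (simp add: J_def split: prod.split)
      then show "(\<lambda>P. P \<one>) ` E d = V" using d by (simp add: E_def V_def image_image)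
    qed (auto simp: E_def J_def)
    have "V \<subseteq> prod_encode ` (range p1 \<times> range r1)" by (auto simp: V_def)
    then have finV: "finite V"
      by (rule finite_subset) (use label_finite_range[OF p1(1)] label_finite_range[OF l01(2)] in simp)
    have fstV: "?fst ` V = range p1"
    proof -
      have "?fst ` V = p1 ` fst ` Z" by (simp add: V_def image_image split_def)
      then show ?thesis by (simp add: fstZ)
    qed
    obtain l where l: "label l" "?fst \<circ> l = p1" "range l = V"
      using label_refinement[OF p1(1) finV fstV] by blast
    obtain \<gamma> where \<gamma>: "\<gamma> \<in> actions G" "patterns \<gamma> l = E"
      using realization[OF l(1)] \<open>consistent E V\<close> l(3) by metis
    have "map_patterns ?fst E = patterns \<alpha> p1"
    proof (rule extensionalityI[of _ T])
      fix d assume d: "d \<in> T"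
      have "(\<lambda>k\<in>K d. ?fst (J d z k)) = pattern \<alpha> p1 d (fst z)" for z
        by (rule extensionalityI[of _ "K d"]) (simp_all add: J_def pattern_def)
      then have "map_patterns ?fst E d = pattern \<alpha> p1 d ` fst ` Z"
        using d by (simp add: map_patterns_def E_def image_image)
      then show "map_patterns ?fst E d = patterns \<alpha> p1 d" using d by (simp add: patterns_apply fstZ)
    qed (simp_all add: map_patterns_def patterns_def)
    then have "patterns \<gamma> p1 = patterns \<alpha> p1"
      using map_patterns_patterns[of ?fst \<gamma> l] \<gamma>(2) l(2) by (simp add: o_def)
    then have "\<gamma> \<in> U" by (rule near[OF \<gamma>(1)])
    \<comment> \<open>\<open>l\<close> codes pairs of values of \<open>p1\<close> and \<open>r1\<close>; turning \<open>p1\<close> into \<open>q\<close> makes them values of \<open>r\<close>\<close>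
    let ?h = "\<lambda>v. prod_encode (\<pi> (?fst v), ?snd v)"
    have "map_patterns ?h E = F"
    proof (rule extensionalityI[of _ T])
      fix d assume d: "d \<in> T"
      have "(\<lambda>k\<in>K d. ?h (J d z k)) = pattern \<beta> r d (snd z)" if "z \<in> Z" for z
      proof (rule extensionalityI[of _ "K d"])
        fix k assume k: "k \<in> K d"
        have "(\<alpha> k (fst z), \<beta> k (snd z)) \<in> Z" using Z_inv[of "fst z" "snd z" k] that K_carrier d k by simp
        then have "r0 (\<beta> k (snd z)) = q (\<alpha> k (fst z))" by (rule Z_one)
        \<comment> \<open>this is what membership in \<open>Z\<close> was defined for\<close>
        then have eqZ: "\<pi> (p1 (\<alpha> k (fst z))) = fst (prod_decode (r (\<beta> k (snd z))))"
          by (simp add: p1(2) r0_def)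
        show "(\<lambda>k\<in>K d. ?h (J d z k)) k = pattern \<beta> r d (snd z) k"
          using k by (simp add: J_def pattern_def r1_def eqZ)
      qed (simp_all add: pattern_def)
      then have "map_patterns ?h E d = pattern \<beta> r d ` snd ` Z"
        using d unfolding map_patterns_def E_def by (simp add: image_image cong: image_cong)
      then show "map_patterns ?h E d = F d" using d r(2) by (simp add: patterns_apply sndZ)
    qed (simp_all add: map_patterns_def r(2) patterns_def)
    have "patterns \<gamma> (\<lambda>x. prod_encode (q x, ?snd (l x))) = F"
    proof -
      have "q x = \<pi> (?fst (l x))" for x using p1(2) fun_cong[OF l(2), of x] by simp
      then show ?thesis using map_patterns_patterns[of ?h \<gamma> l] \<gamma>(2) \<open>map_patterns ?h E = F\<close> by simp
    qed
    then have "\<gamma> \<in> lifting q F"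
      using \<gamma>(1) label_comp[OF l(1), of ?snd] by (auto simp: lifting_def)
    then show ?thesis using \<open>\<gamma> \<in> U\<close> by blast
  qed
qed

section \<open>Generic actions exist\<close>

definition generic :: "('a \<Rightarrow> cantor \<Rightarrow> cantor) \<Rightarrow> bool" where
  "generic \<alpha> \<longleftrightarrow> \<alpha> \<in> actions G \<and> (\<forall>p. label p \<longrightarrow> \<alpha> \<in> refinable p) \<and>
     (\<forall>q. \<forall>F\<in>realized_patterns. label q \<longrightarrow> \<alpha> \<in> lifting q F)"

definition generic_conditions :: "('a \<Rightarrow> cantor \<Rightarrow> cantor) set set" where
  "generic_conditions = refinable ` {p. label p} \<union> case_prod lifting ` ({q. label q} \<times> realized_patterns)"

lemma countable_generic_conditions: "countable generic_conditions"
  unfolding generic_conditions_def using countable_labels countable_realized_patterns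
  by (intro countable_Un countable_image countable_SIGMA)

lemma generic_conditions_open_dense:
  assumes "W \<in> generic_conditions"
  shows "openin (action_topology G) W \<and> action_topology G closure_of W = topspace (action_topology G)"
  using assms openin_refinable dense_refinable openin_lifting dense_lifting
  by (auto simp: generic_conditions_def)

lemma generic_iff: "generic \<alpha> \<longleftrightarrow> \<alpha> \<in> actions G \<and> (\<forall>W\<in>generic_conditions. \<alpha> \<in> W)"
  by (auto simp: generic_def generic_conditions_def)

text \<open>Baire category, applied to countably many dense open conditions.\<close>

lemma generic_exists: "\<exists>\<alpha>. generic \<alpha>"
proof -
  have "action_topology G closure_of \<Inter>generic_conditions = topspace (action_topology G)"
    using completely_metrizable_action_topology[OF countable_carrier] countable_generic_conditions
      generic_conditions_open_dense by (intro Baire_category) auto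
  moreover have "topspace (action_topology G) \<noteq> {}" using trivial_action by auto
  ultimately have "\<Inter>generic_conditions \<noteq> {}" by auto
  then obtain \<alpha> where \<alpha>: "\<forall>W\<in>generic_conditions. \<alpha> \<in> W" by blast
  have "refinable (\<lambda>x. 0) \<in> generic_conditions"
    unfolding generic_conditions_def by (intro UnI1 imageI CollectI label_const)
  then have "\<alpha> \<in> refinable (\<lambda>x. 0)" using \<alpha> by blast
  then have "\<alpha> \<in> actions G" by (simp add: refinable_def)
  then have "generic \<alpha>" using \<alpha> by (simp add: generic_iff)
  then show ?thesis by (intro exI[of _ \<alpha>])
qed

section \<open>Back and forth\<close>

text \<open>The states of the back-and-forth construction. Rigidity makes matched labels have the same
  itineraries.\<close>

definition matched where
  "matched \<alpha> \<beta> p q \<longleftrightarrow> label p \<and> label q \<and> patterns \<alpha> p = patterns \<beta> q \<and> rigid (patterns \<alpha> p)"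

lemma matched_sym: "matched \<alpha> \<beta> p q \<Longrightarrow> matched \<beta> \<alpha> q p"
  unfolding matched_def by metis

text \<open>Refine \<open>p\<close> and \<open>s\<close> by a rigid label \<open>p'\<close> of the first
  action, then lift \<open>q\<close> to the patterns of the pair \<open>(p, p')\<close> in the
  second action. The factor map \<open>\<pi>\<close> is the same on both sides because the pairs
  of labels that occur are the same.\<close>

lemma forth:
  assumes \<alpha>: "generic \<alpha>" and \<beta>: "generic \<beta>" and pq: "matched \<alpha> \<beta> p q" and s: "label (s :: cantor \<Rightarrow> nat)"
  shows "\<exists>p' q' \<pi> \<rho>. matched \<alpha> \<beta> p' q' \<and> p = \<pi> \<circ> p' \<and> q = \<pi> \<circ> q' \<and> s = \<rho> \<circ> p'"
proof -
  let ?fst = "\<lambda>v. fst (prod_decode v)" and ?snd = "\<lambda>v. snd (prod_decode v)"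
  have act: "\<alpha> \<in> actions G" "\<beta> \<in> actions G" using \<alpha> \<beta> by (simp_all add: generic_def)
  have pq': "label p" "label q" "patterns \<alpha> p = patterns \<beta> q" "rigid (patterns \<alpha> p)"
    using pq unfolding matched_def by blast+
  have "label (\<lambda>x. prod_encode (p x, s x))" by (rule label_pair[OF pq'(1) s])
  then have "\<alpha> \<in> refinable (\<lambda>x. prod_encode (p x, s x))" using \<alpha> by (simp add: generic_def)
  then obtain p' \<pi>0 where p': "label p'" "rigid (patterns \<alpha> p')" and
    ps: "(\<lambda>x. prod_encode (p x, s x)) = \<pi>0 \<circ> p'" by (auto simp: refinable_def)
  define \<pi> \<rho> where "\<pi> = ?fst \<circ> \<pi>0" and "\<rho> = ?snd \<circ> \<pi>0"
  have p_eq: "p x = \<pi> (p' x)" and s_eq: "s x = \<rho> (p' x)" for x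
    using fun_cong[OF ps, of x, symmetric] by (simp_all add: \<pi>_def \<rho>_def)
  define F where "F = patterns \<alpha> (\<lambda>x. prod_encode (p x, p' x))"
  have "F \<in> realized_patterns"
    unfolding F_def realized_patterns_def using act(1) label_pair[OF pq'(1) p'(1), of "\<lambda>a b. prod_encode (a, b)"] by blast
  then have "\<beta> \<in> lifting q F" using \<beta> pq'(2) by (simp add: generic_def)
  moreover have "map_patterns ?fst F = patterns \<beta> q"
    unfolding F_def map_patterns_patterns using pq'(3) by simp
  ultimately obtain q' where q': "label q'" "patterns \<beta> (\<lambda>x. prod_encode (q x, q' x)) = F"
    using pq'(3,4) by (auto simp: lifting_def)
  have "patterns \<beta> q' = patterns \<alpha> p'"
    using map_patterns_patterns[of ?snd \<beta> "\<lambda>x. prod_encode (q x, q' x)"]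
      map_patterns_patterns[of ?snd \<alpha> "\<lambda>x. prod_encode (p x, p' x)"] q'(2) by (simp add: F_def)
  then have "matched \<alpha> \<beta> p' q'" using p' q'(1) by (simp add: matched_def)
  moreover have "q y = \<pi> (q' y)" for y
  proof -
    obtain d where d: "d \<in> T" using T_nonempty by blast
    have "pattern \<beta> (\<lambda>x. prod_encode (q x, q' x)) d y \<in> F d" 
      using patterns_mem[OF d, of \<beta> "\<lambda>x. prod_encode (q x, q' x)" y] q'(2) by simp
    then obtain x where x: "pattern \<beta> (\<lambda>x. prod_encode (q x, q' x)) d y = pattern \<alpha> (\<lambda>x. prod_encode (p x, p' x)) d x"
      using d by (auto simp: F_def patterns_apply)
    have "prod_encode (q y, q' y) = prod_encode (p x, p' x)"
      using fun_cong[OF x, of \<one>] by (simp add: pattern_one[OF act(1) d] pattern_one[OF act(2) d])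
    then show ?thesis using p_eq[of x] by simp
  qed
  ultimately show ?thesis
    using p_eq s_eq by (intro exI[of _ p'] exI[of _ q'] exI[of _ \<pi>] exI[of _ \<rho>]) (simp add: fun_eq_iff)
qed

definition refines_to where
  "refines_to s p q p' q' \<longleftrightarrow> (\<exists>\<pi>. p = \<pi> \<circ> p' \<and> q = \<pi> \<circ> q') \<and> (\<exists>\<rho>. s = \<rho> \<circ> p') \<and> (\<exists>\<rho>. s = \<rho> \<circ> q')"

lemma back_and_forth:
  assumes \<alpha>: "generic \<alpha>" and \<beta>: "generic \<beta>" and pq: "matched \<alpha> \<beta> p q" and s: "label (s :: cantor \<Rightarrow> nat)"
  shows "\<exists>p' q'. matched \<alpha> \<beta> p' q' \<and> refines_to s p q p' q'"
proof -
  \<comment> \<open>one step in each direction, so that \<open>s\<close> factors through the new labels of both actions\<close>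
  obtain p1 q1 \<pi>1 \<rho>1 where 1: "matched \<alpha> \<beta> p1 q1" "p = \<pi>1 \<circ> p1" "q = \<pi>1 \<circ> q1" "s = \<rho>1 \<circ> p1"
    using forth[OF \<alpha> \<beta> pq s] by (elim exE conjE)
  obtain q2 p2 \<pi>2 \<rho>2 where 2: "matched \<beta> \<alpha> q2 p2" "q1 = \<pi>2 \<circ> q2" "p1 = \<pi>2 \<circ> p2" "s = \<rho>2 \<circ> q2"
    using forth[OF \<beta> \<alpha> matched_sym[OF 1(1)] s] by (elim exE conjE)
  have "p = (\<pi>1 \<circ> \<pi>2) \<circ> p2" "q = (\<pi>1 \<circ> \<pi>2) \<circ> q2" "s = (\<rho>1 \<circ> \<pi>2) \<circ> p2"
    using 1(2-4) 2(2,3) by (simp_all add: o_assoc)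
  then show ?thesis using matched_sym[OF 2(1)] 2(4) unfolding refines_to_def by blast
qed

text \<open>A constant label is visible as such in its patterns, so its patterns are rigid.\<close>

lemma matched_constant:
  assumes "\<alpha> \<in> actions G" "\<beta> \<in> actions G"
  shows "matched \<alpha> \<beta> (\<lambda>x. 0) (\<lambda>x. 0)"
proof -
  have const: "patterns \<gamma> (\<lambda>x. 0) = (\<lambda>d\<in>T. {\<lambda>k\<in>K d. 0})" for \<gamma> :: "'a \<Rightarrow> cantor \<Rightarrow> cantor"
    by (rule extensionalityI[of _ T]) (auto simp: patterns_def pattern_def)
  have zero: "p x = 0" if "\<gamma> \<in> actions G" "patterns \<gamma> p = (\<lambda>d\<in>T. {\<lambda>k\<in>K d. 0})" for \<gamma> p x
  proof -
    obtain d where d: "d \<in> T" using T_nonempty by blast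
    then have "pattern \<gamma> p d x = (\<lambda>k\<in>K d. 0)" using patterns_mem[OF d, of \<gamma> p x] that(2) by simp
    then show ?thesis using pattern_one[OF that(1) d, of p x] one_in_K[OF d] by simp
  qed
  have "rigid (\<lambda>d\<in>T. {\<lambda>k\<in>K d. 0})"
    unfolding rigid_def
  proof (intro ballI allI impI exI)
    fix \<gamma> \<delta> p q x g
    assume "\<gamma> \<in> actions G" "patterns \<gamma> p = (\<lambda>d\<in>T. {\<lambda>k\<in>K d. 0})"
      and "\<delta> \<in> actions G" "patterns \<delta> q = (\<lambda>d\<in>T. {\<lambda>k\<in>K d. 0})"
    then show "q (\<delta> g x) = p (\<gamma> g x)" using zero[of \<gamma> p] zero[of \<delta> q] by simp
  qed
  then show ?thesis by (simp add: matched_def const label_const)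
qed

lemma back_and_forth_sequence:
  assumes \<alpha>: "generic \<alpha>" and \<beta>: "generic \<beta>"
  obtains p q where "\<And>n. matched \<alpha> \<beta> (p n) (q n)"
    and "\<And>n. refines_to (level n) (p n) (q n) (p (Suc n)) (q (Suc n))"
proof -
  have "\<exists>f. \<forall>n. matched \<alpha> \<beta> (fst (f n)) (snd (f n)) \<and>
      refines_to (level n) (fst (f n)) (snd (f n)) (fst (f (Suc n))) (snd (f (Suc n)))"
  proof (rule dependent_nat_choice)
    show "\<exists>x. matched \<alpha> \<beta> (fst x) (snd x)"
      using matched_constant \<alpha> \<beta> unfolding generic_def by (intro exI[of _ "(\<lambda>x. 0, \<lambda>x. 0)"]) simp
    fix x n assume "matched \<alpha> \<beta> (fst x) (snd x)"
    then obtain p' q' where "matched \<alpha> \<beta> p' q'" "refines_to (level n) (fst x) (snd x) p' q'"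
      using back_and_forth[OF \<alpha> \<beta> _ label_level] by blast
    then show "\<exists>y. matched \<alpha> \<beta> (fst y) (snd y) \<and> refines_to (level n) (fst x) (snd x) (fst y) (snd y)"
      by (intro exI[of _ "(p', q')"]) simp
  qed
  then obtain f where "\<forall>n. matched \<alpha> \<beta> (fst (f n)) (snd (f n)) \<and>
      refines_to (level n) (fst (f n)) (snd (f n)) (fst (f (Suc n))) (snd (f (Suc n)))" ..
  then show thesis using that[of "\<lambda>n. fst (f n)" "\<lambda>n. snd (f n)"] by blast
qed

text \<open>In the limit of the back-and-forth construction this relation is the graph of the conjugating
  homeomorphism.\<close>

definition same_itineraries where
  "same_itineraries \<alpha> p \<beta> q x y \<longleftrightarrow> (\<forall>n::nat. \<forall>g\<in>carrier G. q n (\<beta> g y) = p n (\<alpha> g x))"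

lemma same_itineraries_sym: "same_itineraries \<alpha> p \<beta> q x y \<Longrightarrow> same_itineraries \<beta> q \<alpha> p y x"
  by (simp add: same_itineraries_def)

text \<open>The points matching \<open>x\<close> at stage \<open>n\<close> form a closed set, nonempty by
  rigidity, and the factor maps make these sets decrease.\<close>

lemma same_itineraries_total:
  assumes \<alpha>: "\<alpha> \<in> actions G" and \<beta>: "\<beta> \<in> actions G"
    and matched: "\<And>n. matched \<alpha> \<beta> (p n) (q n)"
    and refines: "\<And>n. refines_to (level n) (p n) (q n) (p (Suc n)) (q (Suc n))"
  shows "\<exists>y. same_itineraries \<alpha> p \<beta> q x y"
proof -
  define C where "C n = {y. \<forall>g\<in>carrier G. q n (\<beta> g y) = p n (\<alpha> g x)}" for n
  have "\<exists>y. \<forall>n. y \<in> C n"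
  proof (rule cantor_nested_nonempty)
    fix n
    have lab: "label (p n)" "label (q n)" "patterns \<alpha> (p n) = patterns \<beta> (q n)" "rigid (patterns \<alpha> (p n))"
      using matched[of n] unfolding matched_def by blast+
    have "C n = (\<Inter>g\<in>carrier G. {y. q n (\<beta> g y) = p n (\<alpha> g x)})" by (auto simp: C_def)
    moreover have "closed {y. q n (\<beta> g y) = p n (\<alpha> g x)}" if "g \<in> carrier G" for g
      by (rule closed_label_eq, rule label_continuous[OF lab(2)], rule action_continuous[OF \<beta> that])
    ultimately show "closed (C n)" by auto
    have "\<exists>y. \<forall>g\<in>carrier G. q n (\<beta> g y) = p n (\<alpha> g x)"
      by (rule rigidD[OF lab(4) \<alpha> \<beta> lab(1,2) HOL.refl lab(3)[symmetric]])
    then show "C n \<noteq> {}" by (auto simp: C_def)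
    obtain \<pi> where \<pi>: "p n = \<pi> \<circ> p (Suc n)" "q n = \<pi> \<circ> q (Suc n)"
      using refines[of n] unfolding refines_to_def by (elim conjE exE)
    show "C (Suc n) \<subseteq> C n"
    proof
      fix y assume "y \<in> C (Suc n)"
      then have "\<forall>g\<in>carrier G. q (Suc n) (\<beta> g y) = p (Suc n) (\<alpha> g x)" unfolding C_def by blast
      then show "y \<in> C n" unfolding C_def \<pi> by simp
    qed
  qed
  then obtain y where y: "\<forall>n. y \<in> C n" ..
  show ?thesis
    unfolding same_itineraries_def
  proof (intro exI allI ballI)
    fix n g assume "g \<in> carrier G"
    then show "q n (\<beta> g y) = p n (\<alpha> g x)" using y[rule_format, of n] unfolding C_def by blast
  qed
qed

lemma same_itineraries_label:
  assumes "\<alpha> \<in> actions G" "\<beta> \<in> actions G" "same_itineraries \<alpha> p \<beta> q x y"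
  shows "q n y = p n x"
proof -
  have "q n (\<beta> \<one> y) = p n (\<alpha> \<one> x)" using assms(3) one_closed unfolding same_itineraries_def by blast
  then show ?thesis by (simp add: action_one[OF assms(1)] action_one[OF assms(2)])
qed

lemma same_itineraries_unique:
  assumes \<alpha>: "\<alpha> \<in> actions G" and \<beta>: "\<beta> \<in> actions G"
    and refines: "\<And>n. refines_to (level n) (p n) (q n) (p (Suc n)) (q (Suc n))"
    and y: "same_itineraries \<alpha> p \<beta> q x y" and z: "same_itineraries \<alpha> p \<beta> q x z"
  shows "y = z"
proof (rule cantor_eqI)
  fix n
  obtain \<rho> where \<rho>: "level n = \<rho> \<circ> q (Suc n)"
    using refines[of n] unfolding refines_to_def by (elim conjE exE)
  show "level n y = level n z"
    unfolding \<rho> using same_itineraries_label[OF \<alpha> \<beta> y, of "Suc n"] same_itineraries_label[OF \<alpha> \<beta> z, of "Suc n"] by simp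
qed

lemma refines_to_sym: "refines_to s p q p' q' \<Longrightarrow> refines_to s q p q' p'"
  unfolding refines_to_def by blast

text \<open>The labels \<open>q n\<close> separate points, so the itineraries determine the partner of a
  point; it depends continuously on the point because its coordinates are functions of the
  labels \<open>p n\<close>. Shifting an itinerary is acting on the point, whence equivariance.\<close>

lemma generic_actions_conjugate:
  assumes \<alpha>: "generic \<alpha>" and \<beta>: "generic \<beta>"
  shows "\<beta> \<in> conjugacy_class G \<alpha>"
proof -
  have act: "\<alpha> \<in> actions G" "\<beta> \<in> actions G" using \<alpha> \<beta> by (simp_all add: generic_def)
  obtain p q where matched: "\<And>n. matched \<alpha> \<beta> (p n) (q n)"
    and refines: "\<And>n. refines_to (level n) (p n) (q n) (p (Suc n)) (q (Suc n))"
    using back_and_forth_sequence[OF \<alpha> \<beta>] by blast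
  let ?R = "same_itineraries \<alpha> p \<beta> q"
  obtain \<phi> where \<phi>: "\<And>x. ?R x (\<phi> x)" 
    using same_itineraries_total[OF act matched refines] by metis
  have "\<exists>x. same_itineraries \<beta> q \<alpha> p y x" for y
    by (rule same_itineraries_total[OF act(2,1) matched_sym[OF matched] refines_to_sym[OF refines]])
  then obtain \<psi> where \<psi>: "\<And>y. same_itineraries \<beta> q \<alpha> p y (\<psi> y)" by metis
  have unique: "y = z" if "?R x y" "?R x z" for x y z
    by (rule same_itineraries_unique[OF act refines that])
  have \<phi>\<psi>: "\<phi> (\<psi> y) = y" for y
    by (rule unique[OF \<phi> same_itineraries_sym[OF \<psi>]])
  have \<psi>\<phi>: "\<psi> (\<phi> x) = x" for x
    by (rule same_itineraries_unique[OF act(2,1) refines_to_sym[OF refines] \<psi> same_itineraries_sym[OF \<phi>]])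
  have "continuous_on UNIV \<phi>"
    unfolding continuous_iff_label
  proof
    fix n
    obtain \<rho> where \<rho>: "level n = \<rho> \<circ> q (Suc n)"
      using refines[of n] unfolding refines_to_def by (elim conjE exE)
    have "level n (\<phi> x) = \<rho> (p (Suc n) x)" for x
      unfolding \<rho> using same_itineraries_label[OF act \<phi>, of "Suc n"] by simp
    moreover have "label (\<lambda>x. \<rho> (p (Suc n) x))"
      by (rule label_comp) (use matched[of "Suc n"] in \<open>simp add: matched_def\<close>)
    ultimately show "label (\<lambda>x. level n (\<phi> x))" by simp
  qed
  then have \<phi>H: "\<phi> \<in> carrier homeo_group" by (rule homeo_groupI[OF _ \<psi>\<phi> \<phi>\<psi>])
  have inv\<phi>: "inv_into UNIV \<phi> y = \<psi> y" for y
    using inv_f_eq[of \<phi> "\<psi> y" y] \<phi>\<psi> \<psi>\<phi> by (metis injI)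
  have equivariant: "\<phi> (\<alpha> h x) = \<beta> h (\<phi> x)" if h: "h \<in> carrier G" for h x
  proof (rule unique[OF \<phi>])
    show "?R (\<alpha> h x) (\<beta> h (\<phi> x))"
      unfolding same_itineraries_def
    proof (intro allI ballI)
      fix n g assume g: "g \<in> carrier G"
      have "q n (\<beta> (g \<otimes> h) (\<phi> x)) = p n (\<alpha> (g \<otimes> h) x)"
        using \<phi>[of x] m_closed[OF g h] unfolding same_itineraries_def by blast
      then show "q n (\<beta> g (\<beta> h (\<phi> x))) = p n (\<alpha> g (\<alpha> h x))"
        by (simp add: action_mult[OF act(1) g h] action_mult[OF act(2) g h])
    qed
  qed
  have "conjugate_action G \<phi> \<alpha> = \<beta>"
  proof (rule extensionalityI[of _ "carrier G"])
    show "\<beta> \<in> extensional (carrier G)" using act(2) by (simp add: actions_def)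
    fix g assume g: "g \<in> carrier G"
    show "conjugate_action G \<phi> \<alpha> g = \<beta> g"
      using g by (auto simp: conjugate_action_def inv\<phi> equivariant \<phi>\<psi>)
  qed (simp add: conjugate_action_def)
  then show ?thesis using \<phi>H unfolding conjugacy_class_def by blast
qed

lemma conjugacy_class_subset_actions:
  assumes \<alpha>: "\<alpha> \<in> actions G"
  shows "conjugacy_class G \<alpha> \<subseteq> actions G"
proof
  fix \<beta> assume "\<beta> \<in> conjugacy_class G \<alpha>"
  then obtain \<phi> where \<phi>: "\<phi> \<in> carrier homeo_group" and \<beta>: "\<beta> = conjugate_action G \<phi> \<alpha>"
    by (auto simp: conjugacy_class_def)
  obtain \<psi> where \<psi>: "\<psi> \<in> carrier homeo_group" "\<And>x. \<psi> (\<phi> x) = x" "\<And>x. \<phi> (\<psi> x) = x"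
    using homeo_inverse[OF \<phi>] by blast
  have inv\<phi>: "inv_into UNIV \<phi> = \<psi>"
    using inv_f_eq[of \<phi>] \<psi>(2,3) by (metis ext injI)
  interpret H: group homeo_group by (rule group_homeo_group)
  have mult: "f \<otimes>\<^bsub>homeo_group\<^esub> h = f \<circ> h" for f h by (simp add: homeo_group_def)
  have \<beta>g: "\<beta> g = \<phi> \<circ> \<alpha> g \<circ> \<psi>" if "g \<in> carrier G" for g
    using that by (simp add: \<beta> conjugate_action_def inv\<phi>)
  have "\<beta> \<in> hom G homeo_group"
  proof (rule homI)
    fix g assume g: "g \<in> carrier G"
    show "\<beta> g \<in> carrier homeo_group"
      using H.m_closed[OF H.m_closed[OF \<phi> action_homeo[OF \<alpha> g]] \<psi>(1)] by (simp add: mult \<beta>g[OF g])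
    fix h assume h: "h \<in> carrier G"
    show "\<beta> (g \<otimes> h) = \<beta> g \<otimes>\<^bsub>homeo_group\<^esub> \<beta> h"
      by (rule ext) (simp add: mult \<beta>g g h action_mult[OF \<alpha> g h] \<psi>(2))
  qed
  moreover have "\<beta> \<in> extensional (carrier G)" by (simp add: \<beta> conjugate_action_def)
  ultimately show "\<beta> \<in> actions G" by (simp add: actions_def)
qed

lemma generic_class_comeager: "strong_topological_Rokhlin G"
proof -
  obtain \<alpha> where \<alpha>: "generic \<alpha>" using generic_exists by blast
  then have act: "\<alpha> \<in> actions G" by (simp add: generic_def)
  have "comeager_in (action_topology G) (conjugacy_class G \<alpha>)"
  proof (rule comeager_in_superset[OF countable_generic_conditions generic_conditions_open_dense])
    show "conjugacy_class G \<alpha> \<subseteq> topspace (action_topology G)"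
      using conjugacy_class_subset_actions[OF act] by simp
    fix \<beta> assume "\<beta> \<in> topspace (action_topology G)" and "\<And>W. W \<in> generic_conditions \<Longrightarrow> \<beta> \<in> W"
    then have "generic \<beta>" by (simp add: generic_iff)
    then show "\<beta> \<in> conjugacy_class G \<alpha>" by (rule generic_actions_conjugate[OF \<alpha>])
  qed
  then show ?thesis using act unfolding strong_topological_Rokhlin_def by blast
qed

end

section \<open>Realizing patterns by one group or one homeomorphism\<close>

text \<open>Cut the Cantor space into pieces named \<open>(P, h)\<close>, inside the clopen set with label
  \<open>P h\<close>, and let \<open>k\<close> carry the piece \<open>(P, h)\<close> to
  \<open>(P, k h)\<close>. Then a point in the piece \<open>(P, h)\<close> sees the shift of
  \<open>P\<close> by \<open>h\<close>.\<close>

lemma finite_group_action_with_patterns: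
  fixes H :: "('g, 'z) monoid_scheme" and q :: "cantor \<Rightarrow> 'l"
  assumes H: "group H" "finite (carrier H)" and q: "label q"
    and E: "finite E" "E \<subseteq> extensional (carrier H)" "(\<lambda>P. P \<one>\<^bsub>H\<^esub>) ` E = range q"
    and shift: "\<And>P k. P \<in> E \<Longrightarrow> k \<in> carrier H \<Longrightarrow> (\<lambda>h\<in>carrier H. P (h \<otimes>\<^bsub>H\<^esub> k)) \<in> E"
  shows "\<exists>\<rho>\<in>hom H homeo_group. range (\<lambda>x. \<lambda>h\<in>carrier H. q (\<rho> h x)) = E"
proof -
  interpret group H by (rule H(1))
  define J where "J = E \<times> carrier H"
  define l where "l = (\<lambda>(P :: 'g \<Rightarrow> 'l, h). P h)"
  have val: "P h \<in> range q" if "P \<in> E" "h \<in> carrier H" for P h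
  proof -
    have "(\<lambda>g\<in>carrier H. P (g \<otimes>\<^bsub>H\<^esub> h)) \<one>\<^bsub>H\<^esub> \<in> range q"
      using shift[OF that] E(3) by blast
    then show ?thesis using that(2) by simp
  qed
  have "l ` J = range q"
  proof (intro subset_antisym subsetI)
    fix v assume "v \<in> l ` J"
    then show "v \<in> range q" using val by (auto simp: l_def J_def)
  next
    fix v assume "v \<in> range q"
    then obtain P where "P \<in> E" "v = P \<one>\<^bsub>H\<^esub>" using E(3) by (metis imageE)
    then show "v \<in> l ` J" by (intro image_eqI[of _ _ "(P, \<one>\<^bsub>H\<^esub>)"]) (simp_all add: l_def J_def)
  qed
  moreover have "finite J" using E(1) H(2) by (simp add: J_def)
  ultimately obtain e idx rest where copies: "cantor_copies J e idx rest" and l_idx: "\<forall>x. l (idx x) = q x"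
    using cantor_copies_over_label[OF q, of J l] by blast
  note c = cantor_copiesD[OF copies]
  define \<rho> where "\<rho> k x = e (fst (idx x), k \<otimes>\<^bsub>H\<^esub> snd (idx x)) (rest x)" for k x
  have idx: "fst (idx x) \<in> E" "snd (idx x) \<in> carrier H" for x
    using c(4)[of x] by (auto simp: J_def)
  have moved: "(fst (idx x), k \<otimes>\<^bsub>H\<^esub> snd (idx x)) \<in> J" if "k \<in> carrier H" for k x
    using idx[of x] that by (simp add: J_def)
  have \<rho>_idx: "idx (\<rho> k x) = (fst (idx x), k \<otimes>\<^bsub>H\<^esub> snd (idx x))" "rest (\<rho> k x) = rest x" if "k \<in> carrier H" for k x
    using c(6,7)[OF moved[OF that]] by (simp_all add: \<rho>_def)
  have \<rho>_mult: "\<rho> (k \<otimes>\<^bsub>H\<^esub> k') x = \<rho> k (\<rho> k' x)" if "k \<in> carrier H" "k' \<in> carrier H" for k k' x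
    using that \<rho>_idx[OF that(2), of x] idx(2)[of x] by (simp add: \<rho>_def[of k] \<rho>_def[of "k \<otimes>\<^bsub>H\<^esub> k'"] m_assoc)
  have \<rho>_one: "\<rho> \<one>\<^bsub>H\<^esub> x = x" for x
    using idx(2)[of x] c(5)[of x] by (simp add: \<rho>_def)
  have cont: "continuous_on UNIV (\<rho> k)" if k: "k \<in> carrier H" for k
    unfolding \<rho>_def
  proof (rule continuous_switch[where F = "\<lambda>j x. e (fst j, k \<otimes>\<^bsub>H\<^esub> snd j) (rest x)", OF c(3)])
    fix j assume "j \<in> range idx"
    then have "(fst j, k \<otimes>\<^bsub>H\<^esub> snd j) \<in> J" using moved[OF k] by blast
    from continuous_on_compose2[OF c(1)[OF this] c(2)]
    show "continuous_on UNIV (\<lambda>x. e (fst j, k \<otimes>\<^bsub>H\<^esub> snd j) (rest x))" by simp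
  qed
  have \<rho>_homeo: "\<rho> k \<in> carrier homeo_group" if k: "k \<in> carrier H" for k
    by (rule homeo_groupI[OF cont[OF k], of "\<rho> (inv\<^bsub>H\<^esub> k)"])
       (use k in \<open>simp_all add: \<rho>_one flip: \<rho>_mult\<close>)
  have "\<rho> \<in> hom H homeo_group"
  proof (rule homI)
    fix k k' assume k: "k \<in> carrier H" "k' \<in> carrier H"
    show "\<rho> (k \<otimes>\<^bsub>H\<^esub> k') = \<rho> k \<otimes>\<^bsub>homeo_group\<^esub> \<rho> k'"
      by (rule ext) (simp add: \<rho>_mult[OF k] homeo_group_def)
  qed (rule \<rho>_homeo)
  moreover have pat: "(\<lambda>h\<in>carrier H. q (\<rho> h x)) = (\<lambda>h\<in>carrier H. fst (idx x) (h \<otimes>\<^bsub>H\<^esub> snd (idx x)))" for x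
  proof (rule restrict_ext)
    fix h assume h: "h \<in> carrier H"
    have "q (\<rho> h x) = l (idx (\<rho> h x))" using l_idx by simp
    then show "q (\<rho> h x) = fst (idx x) (h \<otimes>\<^bsub>H\<^esub> snd (idx x))" by (simp add: \<rho>_idx[OF h] l_def)
  qed
  have "range (\<lambda>x. \<lambda>h\<in>carrier H. q (\<rho> h x)) = E"
  proof (intro subset_antisym subsetI)
    fix P assume "P \<in> range (\<lambda>x. \<lambda>h\<in>carrier H. q (\<rho> h x))"
    then show "P \<in> E" using shift[OF idx] by (auto simp: pat)
  next
    fix P assume P: "P \<in> E"
    then have j: "(P, \<one>\<^bsub>H\<^esub>) \<in> J" by (simp add: J_def)
    let ?x = "e (P, \<one>\<^bsub>H\<^esub>) (\<lambda>_. False)"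
    have "idx ?x = (P, \<one>\<^bsub>H\<^esub>)" by (rule c(6)[OF j])
    then have "(\<lambda>h\<in>carrier H. q (\<rho> h ?x)) = P"
      unfolding pat using P E(2) by (intro extensionalityI[of _ "carrier H"]) auto
    then show "P \<in> range (\<lambda>x. \<lambda>h\<in>carrier H. q (\<rho> h x))" by (metis rangeI)
  qed
  ultimately show ?thesis by blast
qed

text \<open>Cut the Cantor space twice into pieces named by the transitions, once inside the clopen set of
  the source label and once inside that of the target label, and map the pieces of the first
  kind to the pieces of the second kind.\<close>

lemma homeomorphism_with_transitions:
  assumes q: "label q" and A: "finite A" "fst ` A = range q" "snd ` A = range q"
  shows "\<exists>f\<in>carrier homeo_group. range (\<lambda>x. (q x, q (f x))) = A"
proof -
  obtain e i r where "cantor_copies A e i r" and i: "\<forall>x. fst (i x) = q x"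
    using cantor_copies_over_label[OF q A(1,2)] by blast
  note c = cantor_copiesD[OF this(1)]
  obtain e' i' r' where "cantor_copies A e' i' r'" and i': "\<forall>x. snd (i' x) = q x"
    using cantor_copies_over_label[OF q A(1,3)] by blast
  note c' = cantor_copiesD[OF this(1)]
  define f where "f x = e' (i x) (r x)" for x
  define f' where "f' x = e (i' x) (r' x)" for x
  have "continuous_on UNIV f"
    unfolding f_def
  proof (rule continuous_switch[where F = "\<lambda>j x. e' j (r x)", OF c(3)])
    fix j assume "j \<in> range i"
    then have "j \<in> A" using c(4) by blast
    from continuous_on_compose2[OF c'(1)[OF this] c(2)]
    show "continuous_on UNIV (\<lambda>x. e' j (r x))" by simp
  qed
  moreover have "f' (f x) = x" for x
    using c'(6,7)[OF c(4)] c(5) by (simp add: f_def f'_def)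
  moreover have "f (f' x) = x" for x
    using c(6,7)[OF c'(4)] c'(5) by (simp add: f_def f'_def)
  ultimately have "f \<in> carrier homeo_group" by (rule homeo_groupI)
  have pair: "(q x, q (f x)) = i x" for x
    using i[rule_format, of x] i'[rule_format, of "f x"] c'(6)[OF c(4)[of x]]
    by (simp add: f_def prod_eq_iff)
  have "range (\<lambda>x. (q x, q (f x))) = A"
    unfolding pair
  proof (intro subset_antisym subsetI)
    fix j assume "j \<in> A"
    then have "i (e j (\<lambda>_. False)) = j" by (rule c(6))
    then show "j \<in> range i" by (metis rangeI)
  qed (use c(4) in blast)
  then show ?thesis using \<open>f \<in> carrier homeo_group\<close> by blast
qed

text \<open>Observing a window from another member loses nothing, so a consistent family is determined by
  one window out of each class of windows that are translates of each other.\<close>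

lemma (in window_system) consistent_opp:
  assumes E: "consistent E V" and d: "d \<in> T" and k: "k \<in> K d"
  shows "E (opp d k) = shift d k ` E d"
proof (intro subset_antisym subsetI)
  fix Q assume Q: "Q \<in> E (opp d k)"
  have T': "opp d k \<in> T" "inv k \<in> K (opp d k)" "opp (opp d k) (inv k) = d"
    using opp_in_T[OF d k] inv_in_K_opp[OF d k] opp_opp_inv[OF d k] by simp_all
  have "shift d k (shift (opp d k) (inv k) Q) = Q"
    using shift_unshift[OF T'(1,2) consistentD(2)[OF E T'(1) Q]] T'(3) K_carrier[OF d k] by simp
  moreover have "shift (opp d k) (inv k) Q \<in> E d"
    using consistentD(3)[OF E T'(1) Q T'(2)] T'(3) by simp
  ultimately show "Q \<in> shift d k ` E d" by (metis image_eqI)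
next
  fix Q assume "Q \<in> shift d k ` E d"
  then show "Q \<in> E (opp d k)" using consistentD(3)[OF E d _ k] by blast
qed

section \<open>Groups freely generated by finite subgroups and elements\<close>

text \<open>The free product, described by its universal property into \<open>homeo_group\<close>: the
  factors with \<open>fin i\<close> are finite subgroups \<open>H i\<close>, and the others are
  generated by \<open>s i\<close>.\<close>

locale free_generation = group P for P (structure) +
  fixes I :: "nat set" and fin :: "nat \<Rightarrow> bool" and H :: "nat \<Rightarrow> 'a set" and s :: "nat \<Rightarrow> 'a"
  assumes countable_P: "countable (carrier P)"
    and I: "finite I" "I \<noteq> {}"
    and H: "i \<in> I \<Longrightarrow> fin i \<Longrightarrow> subgroup (H i) P" "i \<in> I \<Longrightarrow> fin i \<Longrightarrow> finite (H i)"
    and s: "i \<in> I \<Longrightarrow> \<not> fin i \<Longrightarrow> s i \<in> carrier P" "i \<in> I \<Longrightarrow> \<not> fin i \<Longrightarrow> s i \<noteq> \<one>"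
    and generate: "Y \<subseteq> carrier P \<Longrightarrow> \<one> \<in> Y \<Longrightarrow>
      (\<And>i h g. i \<in> I \<Longrightarrow> fin i \<Longrightarrow> h \<in> H i \<Longrightarrow> g \<in> Y \<Longrightarrow> h \<otimes> g \<in> Y) \<Longrightarrow>
      (\<And>i g. i \<in> I \<Longrightarrow> \<not> fin i \<Longrightarrow> g \<in> Y \<Longrightarrow> s i \<otimes> g \<in> Y \<and> inv (s i) \<otimes> g \<in> Y) \<Longrightarrow> Y = carrier P"
    and extend: "(\<And>i. i \<in> I \<Longrightarrow> fin i \<Longrightarrow> \<rho> i \<in> hom (P\<lparr>carrier := H i\<rparr>) homeo_group) \<Longrightarrow>
      (\<And>i. i \<in> I \<Longrightarrow> \<not> fin i \<Longrightarrow> f i \<in> carrier homeo_group) \<Longrightarrow>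
      \<exists>\<alpha>\<in>actions P. \<forall>i\<in>I. if fin i then \<forall>h\<in>H i. \<alpha> h = \<rho> i h else \<alpha> (s i) = f i"
begin

text \<open>A finite factor contributes one window, an infinite cyclic one the two half-edges at a vertex,
  under the even and the odd number with half \<open>i\<close>.\<close>

definition dirs :: "nat set" where
  "dirs = (\<lambda>i. 2 * i) ` I \<union> (\<lambda>i. 2 * i + 1) ` {i \<in> I. \<not> fin i}"

definition window :: "nat \<Rightarrow> 'a set" where
  "window d = (if fin (d div 2) then H (d div 2)
     else if even d then {\<one>, s (d div 2)} else {\<one>, inv (s (d div 2))})"

definition opposite :: "nat \<Rightarrow> 'a \<Rightarrow> nat" where
  "opposite d k = (if fin (d div 2) \<or> k = \<one> then d else if even d then d + 1 else d - 1)"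

lemma dirs_cases:
  assumes "d \<in> dirs"
  obtains (fin) i where "i \<in> I" "fin i" "d = 2 * i"
    | (even) i where "i \<in> I" "\<not> fin i" "d = 2 * i"
    | (odd) i where "i \<in> I" "\<not> fin i" "d = 2 * i + 1"
  using assms by (auto simp: dirs_def)

lemma in_dirs: "i \<in> I \<Longrightarrow> 2 * i \<in> dirs" "i \<in> I \<Longrightarrow> \<not> fin i \<Longrightarrow> Suc (2 * i) \<in> dirs"
  by (auto simp: dirs_def)

lemma window_simps:
  "fin i \<Longrightarrow> window (2 * i) = H i"
  "\<not> fin i \<Longrightarrow> window (2 * i) = {\<one>, s i}"
  "\<not> fin i \<Longrightarrow> window (Suc (2 * i)) = {\<one>, inv (s i)}"
  by (simp_all add: window_def)

lemma opposite_simps: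
  "fin i \<Longrightarrow> opposite (2 * i) k = 2 * i"
  "\<not> fin i \<Longrightarrow> k \<noteq> \<one> \<Longrightarrow> opposite (2 * i) k = Suc (2 * i)"
  "\<not> fin i \<Longrightarrow> k \<noteq> \<one> \<Longrightarrow> opposite (Suc (2 * i)) k = 2 * i"
  "opposite d \<one> = d"
  by (simp_all add: opposite_def)

lemma inv_s: "i \<in> I \<Longrightarrow> \<not> fin i \<Longrightarrow> inv (s i) \<noteq> \<one>"
  using s by (metis inv_inv inv_one)

lemma windows_form_system: "window_system P dirs window opposite"
proof unfold_locales
  show "countable (carrier P)" by (rule countable_P)
  show "finite dirs" "dirs \<noteq> {}" using I by (auto simp: dirs_def)
next
  fix d assume "d \<in> dirs"
  then show "finite (window d)"
    by (cases rule: dirs_cases) (simp_all add: window_simps H)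
next
  fix d k assume "d \<in> dirs" "k \<in> window d"
  then show "k \<in> carrier P"
    by (cases rule: dirs_cases) (auto simp: window_simps s dest: subgroup.mem_carrier[OF H(1)])
next
  fix d assume "d \<in> dirs"
  then show "\<one> \<in> window d"
    by (cases rule: dirs_cases) (simp_all add: window_simps subgroup.one_closed[OF H(1)])
next
  fix d k assume "d \<in> dirs" "k \<in> window d"
  then show "opposite d k \<in> dirs"
    by (cases rule: dirs_cases) (auto simp: window_simps opposite_simps in_dirs s inv_s)
next
  fix d k assume "d \<in> dirs" and k: "k \<in> window d"
  then show "window (opposite d k) = (\<lambda>h. h \<otimes> inv k) ` window d"
  proof (cases rule: dirs_cases)
    case (fin i)
    then interpret Hi: subgroup "H i" P using H(1) by blast
    have kH: "k \<in> H i" using k fin by (simp add: window_simps)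
    have "H i \<subseteq> (\<lambda>h. h \<otimes> inv k) ` H i"
    proof
      fix h assume h: "h \<in> H i"
      have "h = (h \<otimes> k) \<otimes> inv k" using h kH by (simp add: m_assoc)
      then show "h \<in> (\<lambda>h. h \<otimes> inv k) ` H i" using h kH by blast
    qed
    then show ?thesis using fin kH by (auto simp: window_simps opposite_simps)
  next
    case (even i)
    then show ?thesis using k s[of i] by (cases "k = \<one>") (auto simp: window_simps opposite_simps)
  next
    case (odd i)
    then show ?thesis using k s[of i] inv_s[of i] by (cases "k = \<one>") (auto simp: window_simps opposite_simps)
  qed
next
  fix d k h assume "d \<in> dirs" "k \<in> window d" "h \<in> window d"
  then show "opposite (opposite d k) (h \<otimes> inv k) = opposite d h"
  proof (cases rule: dirs_cases)
    case (fin i)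
    then show ?thesis by (simp add: opposite_simps)
  next
    case (even i)
    then show ?thesis
      using \<open>k \<in> window d\<close> \<open>h \<in> window d\<close> s[of i] inv_s[of i] by (auto simp: window_simps opposite_simps)
  next
    case (odd i)
    then show ?thesis
      using \<open>k \<in> window d\<close> \<open>h \<in> window d\<close> s[of i] inv_s[of i] by (auto simp: window_simps opposite_simps)
  qed
next
  show "opposite d \<one> = d" for d by (rule opposite_simps)
next
  fix Y assume Y: "Y \<subseteq> carrier P" "\<one> \<in> Y"
    and closed: "\<And>d k g. d \<in> dirs \<Longrightarrow> k \<in> window d \<Longrightarrow> g \<in> Y \<Longrightarrow> k \<otimes> g \<in> Y"
  show "Y = carrier P"
  proof (rule generate[OF Y])
    fix i h g assume "i \<in> I" "fin i" "h \<in> H i" "g \<in> Y"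
    then show "h \<otimes> g \<in> Y" using closed[of "2 * i" h g] in_dirs(1) by (simp add: window_simps)
  next
    fix i g assume "i \<in> I" "\<not> fin i" "g \<in> Y"
    then show "s i \<otimes> g \<in> Y \<and> inv (s i) \<otimes> g \<in> Y"
      using closed[of "2 * i" "s i" g] closed[of "Suc (2 * i)" "inv (s i)" g] in_dirs
      by (simp add: window_simps)
  qed
qed

sublocale window_system P dirs window opposite by (rule windows_form_system)

text \<open>Each factor is treated on its own, and \<open>extend\<close> puts the resulting actions
  together. The odd window of a cyclic factor needs no separate care, as it is the even one
  observed from the other end.\<close>

lemma patterns_realized:
  assumes q: "label q" and E: "consistent E (range q)"
  shows "\<exists>\<alpha>\<in>actions P. patterns \<alpha> q = E"
proof -
  have fin_range: "finite (range q)" by (rule label_finite_range[OF q])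
  have finE: "finite (E d)" if d: "d \<in> dirs" for d
  proof (rule finite_subset)
    show "E d \<subseteq> (\<Pi>\<^sub>E k\<in>window d. range q)"
    proof
      fix Q assume Q: "Q \<in> E d"
      have "\<forall>k\<in>window d. Q k \<in> range q" by (intro ballI consistent_value[OF E d Q])
      then show "Q \<in> (\<Pi>\<^sub>E k\<in>window d. range q)"
        using consistentD(2)[OF E d Q] unfolding PiE_iff by blast
    qed
    show "finite (\<Pi>\<^sub>E k\<in>window d. range q)" using K_finite[OF d] fin_range by (intro finite_PiE) auto
  qed
  have "\<exists>\<rho>. \<rho> \<in> hom (P\<lparr>carrier := H i\<rparr>) homeo_group \<and> range (\<lambda>x. \<lambda>h\<in>H i. q (\<rho> h x)) = E (2 * i)"
    if i: "i \<in> I" "fin i" for i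
  proof -
    have d: "2 * i \<in> dirs" using in_dirs(1) i by simp
    have w: "window (2 * i) = H i" using i by (simp add: window_simps)
    have "group (P\<lparr>carrier := H i\<rparr>)" using H(1)[OF i] by (rule subgroup.subgroup_is_group) (rule is_group)
    moreover have "(\<lambda>h\<in>H i. Q (h \<otimes> k)) \<in> E (2 * i)" if "Q \<in> E (2 * i)" "k \<in> H i" for Q k
      using consistentD(3)[OF E d that(1)] that(2) i by (simp add: shift_def w opposite_simps)
    moreover have "E (2 * i) \<subseteq> extensional (H i)"
      using consistentD(2)[OF E d] unfolding w by blast
    ultimately show ?thesis
      using finite_group_action_with_patterns[of "P\<lparr>carrier := H i\<rparr>" q "E (2 * i)"] q finE[OF d] H(2)[OF i]
        consistentD(4)[OF E d] by (simp add: Bex_def)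
  qed
  then have "\<forall>i\<in>{i \<in> I. fin i}. \<exists>\<rho>. \<rho> \<in> hom (P\<lparr>carrier := H i\<rparr>) homeo_group \<and>
      range (\<lambda>x. \<lambda>h\<in>H i. q (\<rho> h x)) = E (2 * i)" by simp
  from bchoice[OF this] obtain \<rho> where "\<forall>i\<in>{i \<in> I. fin i}. \<rho> i \<in> hom (P\<lparr>carrier := H i\<rparr>) homeo_group \<and>
      range (\<lambda>x. \<lambda>h\<in>H i. q (\<rho> i h x)) = E (2 * i)" ..
  then have \<rho>: "\<rho> i \<in> hom (P\<lparr>carrier := H i\<rparr>) homeo_group"
      "range (\<lambda>x. \<lambda>h\<in>H i. q (\<rho> i h x)) = E (2 * i)" if "i \<in> I" "fin i" for i
    using that by simp_all
  have "\<exists>f. f \<in> carrier homeo_group \<and> range (\<lambda>x. (q x, q (f x))) = (\<lambda>Q. (Q \<one>, Q (s i))) ` E (2 * i)"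
    if i: "i \<in> I" "\<not> fin i" for i
  proof -
    have d: "2 * i \<in> dirs" "Suc (2 * i) \<in> dirs" using in_dirs i by simp_all
    have w: "window (2 * i) = {\<one>, s i}" "window (Suc (2 * i)) = {\<one>, inv (s i)}" using i by (simp_all add: window_simps)
    have opp: "opposite (Suc (2 * i)) (inv (s i)) = 2 * i" using i inv_s by (simp add: opposite_simps)
    let ?A = "(\<lambda>Q. (Q \<one>, Q (s i))) ` E (2 * i)"
    have "snd ` ?A = range q"
    proof (intro subset_antisym subsetI)
      fix v assume "v \<in> snd ` ?A"
      then show "v \<in> range q" using consistent_value[OF E d(1), of _ "s i"] by (auto simp: w)
    next
      fix v assume "v \<in> range q"
      then have "v \<in> (\<lambda>P. P \<one>) ` E (Suc (2 * i))" unfolding consistentD(4)[OF E d(2)] .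
      then obtain Q where Q: "Q \<in> E (Suc (2 * i))" "v = Q \<one>" by blast
      let ?Q = "shift (Suc (2 * i)) (inv (s i)) Q"
      have "?Q \<in> E (2 * i)" using consistentD(3)[OF E d(2) Q(1), of "inv (s i)"] by (simp add: w opp)
      moreover have "?Q (s i) = v" using s[OF i] by (simp add: shift_def opp w Q(2))
      ultimately show "v \<in> snd ` ?A" by (intro image_eqI[OF _ imageI]) simp_all
    qed
    moreover have "fst ` ?A = range q" using consistentD(4)[OF E d(1)] by (simp add: image_image)
    ultimately show ?thesis
      using homeomorphism_with_transitions[OF q, of ?A] finE[OF d(1)] by blast
  qed
  then have "\<forall>i\<in>{i \<in> I. \<not> fin i}. \<exists>f. f \<in> carrier homeo_group \<and>
      range (\<lambda>x. (q x, q (f x))) = (\<lambda>Q. (Q \<one>, Q (s i))) ` E (2 * i)" by simp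
  from bchoice[OF this] obtain f where "\<forall>i\<in>{i \<in> I. \<not> fin i}. f i \<in> carrier homeo_group \<and>
      range (\<lambda>x. (q x, q (f i x))) = (\<lambda>Q. (Q \<one>, Q (s i))) ` E (2 * i)" ..
  then have f: "f i \<in> carrier homeo_group"
      "range (\<lambda>x. (q x, q (f i x))) = (\<lambda>Q. (Q \<one>, Q (s i))) ` E (2 * i)" if "i \<in> I" "\<not> fin i" for i
    using that by simp_all
  obtain \<alpha> where \<alpha>: "\<alpha> \<in> actions P"
    and \<alpha>_eq: "\<forall>i\<in>I. if fin i then \<forall>h\<in>H i. \<alpha> h = \<rho> i h else \<alpha> (s i) = f i"
    using extend[of \<rho> f, OF \<rho>(1) f(1)] by blast
  have con: "consistent (patterns \<alpha> q) (range q)" by (rule consistent_patterns[OF \<alpha>])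
  have fin_case: "patterns \<alpha> q (2 * i) = E (2 * i)" if i: "i \<in> I" "fin i" for i
  proof -
    have "pattern \<alpha> q (2 * i) x = (\<lambda>h\<in>H i. q (\<rho> i h x))" for x
      using \<alpha>_eq i by (simp add: pattern_def window_simps cong: restrict_cong)
    then show ?thesis using \<rho>(2)[OF i] patterns_apply[OF in_dirs(1)[OF i(1)]] by simp
  qed
  have even_case: "patterns \<alpha> q (2 * i) = E (2 * i)" if i: "i \<in> I" "\<not> fin i" for i
  proof -
    have d: "2 * i \<in> dirs" using in_dirs i by simp
    have w: "window (2 * i) = {\<one>, s i}" using i by (simp add: window_simps)
    \<comment> \<open>a pattern on a two-element window is a pair of labels\<close>
    let ?pair = "\<lambda>Q :: 'a \<Rightarrow> nat. (Q \<one>, Q (s i))"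
    have inj: "inj_on ?pair (extensional (window (2 * i)))"
    proof (rule inj_onI)
      fix Q Q' assume Q: "Q \<in> extensional (window (2 * i))" "Q' \<in> extensional (window (2 * i))"
        and eq: "?pair Q = ?pair Q'"
      show "Q = Q'"
        by (rule extensionalityI[OF Q]) (use eq in \<open>auto simp: w\<close>)
    qed
    have "\<alpha> (s i) = f i" using \<alpha>_eq i by simp
    then have "?pair (pattern \<alpha> q (2 * i) x) = (q x, q (f i x))" for x
      by (simp add: pattern_def w action_one[OF \<alpha>])
    then have "?pair ` patterns \<alpha> q (2 * i) = ?pair ` E (2 * i)"
      using f(2)[OF i] by (simp add: patterns_apply[OF d] image_image)
    moreover have "patterns \<alpha> q (2 * i) \<subseteq> extensional (window (2 * i))" "E (2 * i) \<subseteq> extensional (window (2 * i))"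
      using consistentD(2)[OF con d] consistentD(2)[OF E d] by blast+
    ultimately show ?thesis using inj_on_image_eq_iff[OF inj] by blast
  qed
  have "patterns \<alpha> q = E"
  proof (rule extensionalityI[of _ dirs])
    fix d assume "d \<in> dirs"
    then show "patterns \<alpha> q d = E d"
    proof (cases rule: dirs_cases)
      case (odd i)
      have d: "2 * i \<in> dirs" using in_dirs odd by simp
      have k: "s i \<in> window (2 * i)" "opposite (2 * i) (s i) = d"
        using odd s(2) by (simp_all add: window_simps opposite_simps)
      show ?thesis
        using consistent_opp[OF E d k(1)] consistent_opp[OF con d k(1)] even_case[of i] odd k(2) by simp
    qed (simp_all add: fin_case even_case)
  next
    show "E \<in> extensional dirs" using I(2) in_dirs(1) consistentD(1)[OF E] by blast
  qed (simp add: patterns_def)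
  then show ?thesis using \<alpha> by blast
qed

sublocale realizable_system P dirs window opposite
  by unfold_locales (rule patterns_realized)

end

section \<open>Free products of finite and cyclic groups\<close>

lemma free_product_hom_exists:
  assumes grp: "\<And>i. i \<in> I \<Longrightarrow> group (G i)" and H: "group H"
    and f: "\<And>i. i \<in> I \<Longrightarrow> f i \<in> hom (G i) H"
  shows "\<exists>F\<in>hom (free_product I G) H \<inter> extensional (carrier (free_product I G)).
    \<forall>i\<in>I. \<forall>g\<in>carrier (G i). F (free_product_incl I G i g) = f i g"
proof -
  have "\<exists>!F. F \<in> hom (free_product I G) H \<inter> extensional (carrier (free_product I G)) \<and>
     (\<forall>i\<in>I. \<forall>g\<in>carrier (G i). F (free_product_incl I G i g) = f i g)"
    by (rule free_product_universal) (use assms in simp_all)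
  from ex1_implies_ex[OF this] show ?thesis unfolding Bex_def .
qed

text \<open>The free product retracts onto each factor. This keeps the generator of an infinite cyclic
  factor apart from the identity, so that its windows are genuine edges.\<close>

lemma inj_on_free_product_incl:
  assumes grp: "\<And>i. i \<in> I \<Longrightarrow> group (G i)" and i: "i \<in> I"
  shows "inj_on (free_product_incl I G i) (carrier (G i))"
proof -
  interpret Gi: group "G i" by (rule grp[OF i])
  define f where "f j = (if j = i then (\<lambda>g. g) else (\<lambda>_. \<one>\<^bsub>G i\<^esub>))" for j
  have f: "f j \<in> hom (G j) (G i)" if "j \<in> I" for j
    by (cases "j = i"; intro homI) (simp_all add: f_def)
  have "\<exists>F\<in>hom (free_product I G) (G i) \<inter> extensional (carrier (free_product I G)).
    \<forall>j\<in>I. \<forall>g\<in>carrier (G j). F (free_product_incl I G j g) = f j g"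
    by (rule free_product_hom_exists[OF grp Gi.is_group f])
  then obtain F where "\<forall>j\<in>I. \<forall>g\<in>carrier (G j). F (free_product_incl I G j g) = f j g" ..
  then have "F (free_product_incl I G i g) = g" if "g \<in> carrier (G i)" for g
    using i that by (simp add: f_def)
  then show ?thesis by (rule inj_on_inverseI)
qed

lemma (in group) int_pow_mult_closed:
  assumes "Y \<subseteq> carrier G" "x \<in> carrier G"
    and "\<And>y. y \<in> Y \<Longrightarrow> x \<otimes> y \<in> Y" "\<And>y. y \<in> Y \<Longrightarrow> inv x \<otimes> y \<in> Y" and y: "y \<in> Y"
  shows "x [^] (k::int) \<otimes> y \<in> Y"
proof -
  have pow: "z [^] m \<otimes> y \<in> Y" if z: "z \<in> carrier G" "\<And>y. y \<in> Y \<Longrightarrow> z \<otimes> y \<in> Y" for z and m :: nat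
  proof (induction m)
    case (Suc m)
    have "z [^] Suc m \<otimes> y = z \<otimes> (z [^] m \<otimes> y)"
      unfolding nat_pow_Suc2[OF z(1)] using z(1) y assms(1) by (intro m_assoc) auto
    then show ?case using z(2)[OF Suc] by simp
  qed (use y assms(1) in auto)
  show ?thesis
  proof (cases k)
    case (nonneg m)
    then show ?thesis using pow[OF assms(2,3), of m] by (simp add: int_pow_int)
  next
    case (neg m)
    then show ?thesis
      using pow[OF inv_closed[OF assms(2)] assms(4), of "Suc m"] assms(2)
      by (simp only: int_pow_neg_int nat_pow_inv)
  qed
qed

lemma free_product_generated:
  assumes grp: "\<And>i. i \<in> I \<Longrightarrow> group (G i)"
    and Y: "\<one>\<^bsub>free_product I G\<^esub> \<in> Y" "Y \<subseteq> carrier (free_product I G)"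
    and closed: "\<And>i g y. i \<in> I \<Longrightarrow> g \<in> carrier (G i) \<Longrightarrow> y \<in> Y \<Longrightarrow>
      free_product_incl I G i g \<otimes>\<^bsub>free_product I G\<^esub> y \<in> Y"
  shows "Y = carrier (free_product I G)"
proof -
  let ?R = "free_product_rel I G"
  have "?R `` {w} \<in> Y" if "w \<in> free_product_words I G" for w
    using that
  proof (induction w)
    case Nil
    then show ?case using Y(1) by (simp add: free_product_one[OF grp])
  next
    case (Cons a w)
    obtain i g where a: "a = (i, g)" by (cases a)
    have ig: "i \<in> I" "g \<in> carrier (G i)" "w \<in> free_product_words I G"
      using Cons.prems a by (simp_all add: free_product_words_def)
    have "?R `` {a # w} = free_product_incl I G i g \<otimes>\<^bsub>free_product I G\<^esub> ?R `` {w}"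
      using free_product_mult_class[OF grp, where u = "[a]" and v = w] ig a
      by (simp add: free_product_incl_def free_product_words_def)
    then show ?case using closed[OF ig(1,2) Cons.IH[OF ig(3)]] by simp
  qed
  then have "carrier (free_product I G) \<subseteq> Y"
    by (subst free_product_carrier[OF grp]) auto
  then show ?thesis using Y(2) by blast
qed

lemma (in group) hom_of_infinite_cyclic:
  assumes s: "s \<in> carrier G" "carrier G = range (\<lambda>k::int. s [^] k)" and inf: "infinite (carrier G)"
    and H: "group H" and x: "x \<in> carrier H"
  shows "\<exists>h\<in>hom G H. h s = x"
proof -
  interpret H: group H by (rule H)
  have "carrier (subgroup_generated G {s}) = carrier G"
    using s by (simp add: carrier_subgroup_generated_by_singleton)
  then have inj: "k = l" if "s [^] (k::int) = s [^] l" for k l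
    using infinite_cyclic_subgroup_int[OF s(1)] inf that by simp
  define h where "h g = x [^]\<^bsub>H\<^esub> (THE k::int. g = s [^] k)" for g
  have h: "h (s [^] (k::int)) = x [^]\<^bsub>H\<^esub> k" for k
  proof -
    have "(THE l::int. s [^] k = s [^] l) = k" by (rule the_equality) (auto dest: inj)
    then show ?thesis by (simp add: h_def)
  qed
  have "h \<in> hom G H"
  proof (rule homI)
    fix g g' assume g: "g \<in> carrier G" "g' \<in> carrier G"
    obtain k l where kl: "g = s [^] (k::int)" "g' = s [^] (l::int)" using g s(2) by blast
    show "h g \<in> carrier H" using x by (simp add: kl(1) h)
    have "g \<otimes> g' = s [^] (k + l)" using s(1) by (simp add: kl int_pow_mult)
    then show "h (g \<otimes> g') = h g \<otimes>\<^bsub>H\<^esub> h g'" using x by (simp add: kl h H.int_pow_mult)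
  qed
  moreover have "h s = x" using h[of 1] s(1) x by simp
  ultimately show ?thesis by blast
qed

theorem theorem2:
  fixes n :: nat and G :: "nat \<Rightarrow> ('a, 'b) monoid_scheme"
  assumes "\<And>i. i \<le> n \<Longrightarrow> group (G i)"
    and "\<And>i. i \<le> n \<Longrightarrow> finite (carrier (G i)) \<or> cyclic_group (G i)"
  shows "strong_topological_Rokhlin (free_product {..n} G)"
proof -
  let ?P = "free_product {..n} G" and ?incl = "free_product_incl {..n} G"
  let ?fin = "\<lambda>i. finite (carrier (G i))"
  have grp: "group (G i)" if "i \<in> {..n}" for i using assms(1) that by simp
  interpret P: group ?P by (rule group_free_product[OF grp])
  have incl_hom: "?incl i \<in> hom (G i) ?P" if "i \<in> {..n}" for i
    by (rule free_product_incl_hom[OF grp that])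
  have hom_i: "group_hom (G i) ?P (?incl i)" if "i \<in> {..n}" for i
    using grp[OF that] incl_hom[OF that] by (simp add: group_hom_def group_hom_axioms_def)
  have "\<exists>s. s \<in> carrier (G i) \<and> carrier (G i) = range (\<lambda>k::int. s [^]\<^bsub>G i\<^esub> k)"
    if "i \<in> {i \<in> {..n}. \<not> ?fin i}" for i
    using that assms(2)[of i] group.cyclic_group[OF grp, of i] by auto
  then have "\<forall>i\<in>{i \<in> {..n}. \<not> ?fin i}. \<exists>s. s \<in> carrier (G i) \<and> carrier (G i) = range (\<lambda>k::int. s [^]\<^bsub>G i\<^esub> k)"
    by blast
  from bchoice[OF this] obtain s where "\<forall>i\<in>{i \<in> {..n}. \<not> ?fin i}. s i \<in> carrier (G i) \<and>
      carrier (G i) = range (\<lambda>k::int. s i [^]\<^bsub>G i\<^esub> k)" ..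
  then have s: "s i \<in> carrier (G i)" and s_gen: "carrier (G i) = range (\<lambda>k::int. s i [^]\<^bsub>G i\<^esub> k)"
    if "i \<in> {..n}" "\<not> ?fin i" for i
    using that by blast+
  have "free_generation ?P {..n} ?fin (\<lambda>i. ?incl i ` carrier (G i)) (\<lambda>i. ?incl i (s i))"
  proof (intro free_generation.intro free_generation_axioms.intro P.is_group)
    have "countable (carrier (G i))" if "i \<in> {..n}" for i
    proof (cases "?fin i")
      case False
      show ?thesis unfolding s_gen[OF that False] by simp
    qed (rule countable_finite)
    then show "countable (carrier ?P)" by (intro countable_free_product) auto
    fix i assume i: "i \<in> {..n}"
    interpret gh: group_hom "G i" ?P "?incl i" by (rule hom_i[OF i])
    show "subgroup (?incl i ` carrier (G i)) ?P" by (rule gh.img_is_subgroup)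
    {
      assume nf: "\<not> ?fin i"
      show "?incl i (s i) \<in> carrier ?P" using s[OF i nf] by simp
      show "?incl i (s i) \<noteq> \<one>\<^bsub>?P\<^esub>"
      proof
        assume "?incl i (s i) = \<one>\<^bsub>?P\<^esub>"
        then have "?incl i (s i) = ?incl i \<one>\<^bsub>G i\<^esub>" by simp
        then have "s i = \<one>\<^bsub>G i\<^esub>"
          using inj_onD[OF inj_on_free_product_incl[OF grp i]] s[OF i nf] by simp
        then have "carrier (G i) = {\<one>\<^bsub>G i\<^esub>}" using s_gen[OF i nf] by auto
        then show False using nf by simp
      qed
    }
  next
    fix Y assume Y: "Y \<subseteq> carrier ?P" "\<one>\<^bsub>?P\<^esub> \<in> Y"
      and fin: "\<And>i h g. i \<in> {..n} \<Longrightarrow> ?fin i \<Longrightarrow> h \<in> ?incl i ` carrier (G i) \<Longrightarrow> g \<in> Y \<Longrightarrow> h \<otimes>\<^bsub>?P\<^esub> g \<in> Y"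
      and inf: "\<And>i g. i \<in> {..n} \<Longrightarrow> \<not> ?fin i \<Longrightarrow> g \<in> Y \<Longrightarrow>
        ?incl i (s i) \<otimes>\<^bsub>?P\<^esub> g \<in> Y \<and> inv\<^bsub>?P\<^esub> (?incl i (s i)) \<otimes>\<^bsub>?P\<^esub> g \<in> Y"
    show "Y = carrier ?P"
    proof (rule free_product_generated[OF grp Y(2,1)])
      fix i g y assume i: "i \<in> {..n}" and g: "g \<in> carrier (G i)" and y: "y \<in> Y"
      interpret gh: group_hom "G i" ?P "?incl i" by (rule hom_i[OF i])
      show "?incl i g \<otimes>\<^bsub>?P\<^esub> y \<in> Y"
      proof (cases "?fin i")
        case True
        then show ?thesis using fin[OF i True _ y] g by simp
      next
        case False
        obtain k :: int where k: "g = s i [^]\<^bsub>G i\<^esub> k" using g s_gen[OF i False] by blast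
        have "?incl i g = ?incl i (s i) [^]\<^bsub>?P\<^esub> k"
          unfolding k by (rule gh.hom_int_pow) (rule s[OF i False])
        moreover have "?incl i (s i) [^]\<^bsub>?P\<^esub> k \<otimes>\<^bsub>?P\<^esub> y \<in> Y"
          by (rule P.int_pow_mult_closed[OF Y(1) _ _ _ y]) (use s[OF i False] inf[OF i False] in auto)
        ultimately show ?thesis by simp
      qed
    qed
  next
    fix \<rho> f
    assume \<rho>: "\<And>i. i \<in> {..n} \<Longrightarrow> ?fin i \<Longrightarrow> \<rho> i \<in> hom (?P\<lparr>carrier := ?incl i ` carrier (G i)\<rparr>) homeo_group"
      and f: "\<And>i. i \<in> {..n} \<Longrightarrow> \<not> ?fin i \<Longrightarrow> f i \<in> carrier homeo_group"
    show "\<exists>\<alpha>\<in>actions ?P. \<forall>i\<in>{..n}. if ?fin i then \<forall>h\<in>?incl i ` carrier (G i). \<alpha> h = \<rho> i h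
        else \<alpha> (?incl i (s i)) = f i"
    proof -
      have "\<exists>h. h \<in> hom (G i) homeo_group \<and>
          (if ?fin i then \<forall>g\<in>carrier (G i). h g = \<rho> i (?incl i g) else h (s i) = f i)" if i: "i \<in> {..n}" for i
      proof (cases "?fin i")
        case True
        have "?incl i \<in> hom (G i) (?P\<lparr>carrier := ?incl i ` carrier (G i)\<rparr>)"
          using incl_hom[OF i] by (auto simp: hom_def)
        then have "\<rho> i \<circ> ?incl i \<in> hom (G i) homeo_group"
          using \<rho>[OF i True] by (rule hom_compose)
        then show ?thesis using True by (intro exI[of _ "\<rho> i \<circ> ?incl i"]) simp
      next
        case False
        interpret Gi: group "G i" by (rule grp[OF i])
        show ?thesis
          using Gi.hom_of_infinite_cyclic[OF s[OF i False] s_gen[OF i False] False group_homeo_group f[OF i False]]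
            False by auto
      qed
      then have "\<forall>i\<in>{..n}. \<exists>h. h \<in> hom (G i) homeo_group \<and>
          (if ?fin i then \<forall>g\<in>carrier (G i). h g = \<rho> i (?incl i g) else h (s i) = f i)" by blast
      from bchoice[OF this] obtain h where h: "\<forall>i\<in>{..n}. h i \<in> hom (G i) homeo_group \<and>
          (if ?fin i then \<forall>g\<in>carrier (G i). h i g = \<rho> i (?incl i g) else h i (s i) = f i)" ..
      then have h_hom: "h i \<in> hom (G i) homeo_group" if "i \<in> {..n}" for i using that by blast
      have "\<exists>\<alpha>\<in>hom ?P homeo_group \<inter> extensional (carrier ?P).
          \<forall>i\<in>{..n}. \<forall>g\<in>carrier (G i). \<alpha> (?incl i g) = h i g"
        by (rule free_product_hom_exists) (simp_all add: grp group_homeo_group h_hom)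
      then obtain \<alpha> where \<alpha>: "\<alpha> \<in> hom ?P homeo_group \<inter> extensional (carrier ?P)"
        "\<forall>i\<in>{..n}. \<forall>g\<in>carrier (G i). \<alpha> (?incl i g) = h i g" ..
      have "if ?fin i then \<forall>k\<in>?incl i ` carrier (G i). \<alpha> k = \<rho> i k else \<alpha> (?incl i (s i)) = f i"
        if i: "i \<in> {..n}" for i
      proof (cases "?fin i")
        case True
        then have "\<forall>g\<in>carrier (G i). h i g = \<rho> i (?incl i g)" using h i by auto
        then show ?thesis using True \<alpha>(2) i by simp
      next
        case False
        then have "h i (s i) = f i" using h i by auto
        then show ?thesis using False \<alpha>(2) i s[OF i False] by simp
      qed
      then show ?thesis using \<alpha>(1) unfolding actions_def by blast
    qed
  qed auto
  then interpret free_generation ?P "{..n}" ?fin "\<lambda>i. ?incl i ` carrier (G i)" "\<lambda>i. ?incl i (s i)" .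
  show ?thesis by (rule generic_class_comeager)
qed

end
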